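(* Let $(R,\mathfrak m,k)$ be a Noetherian local ring, let $M$ be a nonzero finitely generated $R$-module of dimension $D\geq1$, and let $J_1,\ldots,J_s$ be $\mathfrak m$-primary ideals. Let $\mathbf d=(d_1,\ldots,d_s)\in\mathbb N^s$, and choose $j\in\{1,\ldots,s\}$ with $d_j>0$. (1) If $1\leq|\mathbf d|<D$, then $c^{(j)}\bigl(J_1^{[d_1]},\ldots,J_s^{[d_s]};M\bigr)=0$. (2) If $|\mathbf d|=D$, then $c^{(j)}\bigl(J_1^{[d_1]},\ldots,J_s^{[d_s]};M\bigr)=e\bigl(J_1^{[d_1]},\ldots,J_s^{[d_s]};M\bigr)$. (3) If $|\mathbf d|=D$, $d_j>0$ and $d_\ell>0$, then $c^{(j)}\bigl(J_1^{[d_1]},\ldots,J_s^{[d_s]};M\bigr)=c^{(\ell)}\bigl(J_1^{[d_1]},\ldots,J_s^{[d_s]};M\bigr)$.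
   Context: $\mathbb N=\{0,1,2,\ldots\}$; $\lambda_R$ denotes length. For $\mathbf u\in\mathbb N^s$ put $J^{\mathbf u}=J_1^{u_1}\cdots J_s^{u_s}$, $|\mathbf u|=u_1+\cdots+u_s$; $\mathbf e_j$ is the $j$-th standard basis vector. Directional mixed multiplicities (defined for proper ideals $J_\ell$ of positive height on $M$, i.e. whose image in $R/\operatorname{Ann}_R(M)$ has positive height; $\mathfrak m$-primary ideals qualify since $D\ge1$): for $r$ and all coordinates of $\mathbf u$ sufficiently large, $$H^{(j)}_{\mathbf J,M}(r,\mathbf u)=\lambda_R\left(\frac{J^{\mathbf u}M}{\mathfrak m^{r+1}J^{\mathbf u}M+J^{\mathbf u+\mathbf e_j}M}\right)$$ agrees with a polynomial of total degree at most $D-1$, whose homogeneous component of degree $D-1$ (zero if the degree is smaller) is $$\sum_{1\leq|\mathbf d|\leq D,\ d_j>0}\frac{c^{(j)}(J_1^{[d_1]},\ldots,J_s^{[d_s]};M)}{(D-|\mathbf d|)!\,(d_j-1)!\prod_{\ell\ne j}d_\ell!}\,r^{D-|\mathbf d|}u_j^{d_j-1}\prod_{\ell\neq j}u_\ell^{d_\ell};$$ this defines the nonnegative integers $c^{(j)}(J_1^{[d_1]},\ldots,J_s^{[d_s]};M)$ for $1\le|\mathbf d|\le D$, $d_j>0$. Classical mixed multiplicities: for $\mathfrak m$-primary $J_1,\ldots,J_s$, the function $\mathbf u\mapsto\lambda_R(M/J^{\mathbf u}M)$ agrees for all $\mathbf u\gg\mathbf0$ with a polynomial of total degree $D$ whose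 homogeneous component of degree $D$ is $\sum_{|\mathbf d|=D}\frac{e(J_1^{[d_1]},\ldots,J_s^{[d_s]};M)}{d_1!\cdots d_s!}u_1^{d_1}\cdots u_s^{d_s}$; this defines $e(J_1^{[d_1]},\ldots,J_s^{[d_s]};M)$ for $|\mathbf d|=D$. The symbol $J_\ell^{[d_\ell]}$ is repetition notation, not a power. *)

theory Defs
  imports
    "HOL-Algebra.Module"
    "HOL-Algebra.Ideal_Product"
    "HOL-Algebra.Ring_Divisibility"
    "HOL-Library.Extended_Nat"
    "HOL-Library.Poly_Mapping"
begin

section \<open>Noetherian local rings, primary ideals and dimension\<close>

locale noetherian_local_ring = cring R + noetherian_ring R
  for R :: "('a, 'r) ring_scheme" (structure) and \<mm> :: "'a set" +
  assumes maximal: "maximalideal \<mm> R"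
    and unique_maximal: "maximalideal \<nn> R \<Longrightarrow> \<nn> = \<mm>"

definition radical_ideal :: "('a, 'r) ring_scheme \<Rightarrow> 'a set \<Rightarrow> 'a set"
  where "radical_ideal R I = {x \<in> carrier R. \<exists>n::nat. x [^]\<^bsub>R\<^esub> n \<in> I}"

locale primary_ideal = ideal Q R + cring R for Q and R (structure) +
  assumes proper: "Q \<noteq> carrier R"
    and primary: "\<lbrakk>a \<in> carrier R; b \<in> carrier R; a \<otimes> b \<in> Q; a \<notin> Q\<rbrakk>
      \<Longrightarrow> \<exists>n::nat. b [^] n \<in> Q"

definition primary_to :: "('a, 'r) ring_scheme \<Rightarrow> 'a set \<Rightarrow> 'a set \<Rightarrow> bool"
  where "primary_to R \<pp> Q \<longleftrightarrow> primary_ideal Q R \<and> radical_ideal R Q = \<pp>"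

text \<open>The supremum of the numbers \<open>n\<close> for which there is a strict chain
  \<open>C\<^sub>0 \<subset> C\<^sub>1 \<subset> \<dots> \<subset> C\<^sub>n\<close> of sets satisfying \<open>P\<close>.\<close>

definition chain_sup :: "('x set \<Rightarrow> bool) \<Rightarrow> enat"
  where "chain_sup P =
    Sup {enat n |n. \<exists>C. (\<forall>i\<le>n. P (C i)) \<and> (\<forall>i<n. C i \<subset> C (Suc i))}"

definition krull_dim :: "('a, 'r) ring_scheme \<Rightarrow> enat"
  where "krull_dim R = chain_sup (\<lambda>P. primeideal P R)"

definition annihilator :: "('a, 'r) ring_scheme \<Rightarrow> ('a, 'b, 'm) module_scheme \<Rightarrow> 'a set"
  where "annihilator R M =
    {a \<in> carrier R. \<forall>x \<in> carrier M. a \<odot>\<^bsub>M\<^esub> x = \<zero>\<^bsub>M\<^esub>}"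

definition module_dim :: "('a, 'r) ring_scheme \<Rightarrow> ('a, 'b, 'm) module_scheme \<Rightarrow> enat"
  where "module_dim R M = krull_dim (R Quot annihilator R M)"


section \<open>Generated submodules, quotient modules and length\<close>

definition module_span ::
  "('a, 'r) ring_scheme \<Rightarrow> ('a, 'b, 'm) module_scheme \<Rightarrow> 'b set \<Rightarrow> 'b set"
  where "module_span R M S = \<Inter>{N. submodule N R M \<and> S \<subseteq> N}"

definition fin_gen_module ::
  "('a, 'r) ring_scheme \<Rightarrow> ('a, 'b, 'm) module_scheme \<Rightarrow> bool"
  where "fin_gen_module R M \<longleftrightarrow>
    (\<exists>S \<subseteq> carrier M. finite S \<and> module_span R M S = carrier M)"

text \<open>The submodule \<open>I N\<close> of \<open>M\<close>, for an ideal \<open>I\<close> and a submodule \<open>N\<close>.\<close>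

definition ideal_smult ::
  "('a, 'r) ring_scheme \<Rightarrow> ('a, 'b, 'm) module_scheme \<Rightarrow> 'a set \<Rightarrow> 'b set \<Rightarrow> 'b set"
  where "ideal_smult R M I N = module_span R M {a \<odot>\<^bsub>M\<^esub> x |a x. a \<in> I \<and> x \<in> N}"

text \<open>The fields \<open>mult\<close> and \<open>one\<close> of a module record carry no meaning.\<close>

definition quot_module ::
  "('a, 'b, 'm) module_scheme \<Rightarrow> 'b set \<Rightarrow> ('a, 'b set) module"
  where "quot_module M N =
    \<lparr>carrier = a_rcosets\<^bsub>M\<^esub> N, monoid.mult = undefined, one = undefined,
     zero = N, add = set_add M,
     smult = (\<lambda>a Q. \<Union>x\<in>Q. N +>\<^bsub>M\<^esub> (a \<odot>\<^bsub>M\<^esub> x))\<rparr>"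

definition module_length ::
  "('a, 'r) ring_scheme \<Rightarrow> ('a, 'b, 'm) module_scheme \<Rightarrow> enat"
  where "module_length R M = chain_sup (\<lambda>N. submodule N R M)"

text \<open>The length of \<open>A / B\<close>, for submodules \<open>B \<subseteq> A\<close> of \<open>M\<close>.\<close>

definition quot_length ::
  "('a, 'r) ring_scheme \<Rightarrow> ('a, 'b, 'm) module_scheme \<Rightarrow> 'b set \<Rightarrow> 'b set \<Rightarrow> enat"
  where "quot_length R M A B = module_length R (quot_module (M\<lparr>carrier := A\<rparr>) B)"


section \<open>Hilbert polynomials in several variables\<close>

text \<open>A polynomial in the variables \<open>'v\<close> is a finitely supported family of real
  coefficients, indexed by exponent vectors.\<close>

type_synonym 'v mpol = "('v \<Rightarrow> nat) \<Rightarrow>\<^sub>0 real"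

definition mpol_eval :: "'v::finite mpol \<Rightarrow> ('v \<Rightarrow> real) \<Rightarrow> real"
  where "mpol_eval p x =
    (\<Sum>a\<in>Poly_Mapping.keys p. Poly_Mapping.lookup p a * (\<Prod>v\<in>UNIV. x v ^ a v))"

text \<open>In particular the values of \<open>f\<close> are finite at all sufficiently large arguments.\<close>

definition agrees_with :: "(('v::finite \<Rightarrow> nat) \<Rightarrow> enat) \<Rightarrow> 'v mpol \<Rightarrow> bool"
  where "agrees_with f p \<longleftrightarrow>
    (\<exists>N. \<forall>u. (\<forall>v. N \<le> u v) \<longrightarrow>
      (\<exists>n. f u = enat n \<and> real n = mpol_eval p (\<lambda>v. real (u v))))"

text \<open>At most one polynomial agrees with \<open>f\<close>, since a polynomial vanishing at all
  sufficiently large integer points is zero.\<close>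

definition hilbert_poly :: "(('v::finite \<Rightarrow> nat) \<Rightarrow> enat) \<Rightarrow> 'v mpol"
  where "hilbert_poly f = (THE p. agrees_with f p)"


section \<open>Mixed multiplicities\<close>

text \<open>The ideals \<open>J\<^sub>1, \<dots>, J\<^sub>s\<close> are indexed by a finite type \<open>'s\<close>; powers and products
  of ideals are taken in the monoid of ideals \<open>ideals_set R\<close>.\<close>

definition multi_power ::
  "('a, 'r) ring_scheme \<Rightarrow> ('s::finite \<Rightarrow> 'a set) \<Rightarrow> ('s \<Rightarrow> nat) \<Rightarrow> 'a set"
  where "multi_power R J u =
    (\<Otimes>\<^bsub>ideals_set R\<^esub>l\<in>UNIV. J l [^]\<^bsub>ideals_set R\<^esub> u l)"

definition multi_power_smult ::
  "('a, 'r) ring_scheme \<Rightarrow> ('a, 'b, 'm) module_scheme \<Rightarrow> ('s::finite \<Rightarrow> 'a set) \<Rightarrow> ('s \<Rightarrow> nat) \<Rightarrow> 'b set"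
  where "multi_power_smult R M J u = ideal_smult R M (multi_power R J u) (carrier M)"

definition multi_deg :: "('s::finite \<Rightarrow> nat) \<Rightarrow> nat"
  where "multi_deg d = (\<Sum>l\<in>UNIV. d l)"

definition samuel_fun ::
  "('a, 'r) ring_scheme \<Rightarrow> ('a, 'b, 'm) module_scheme \<Rightarrow> ('s::finite \<Rightarrow> 'a set) \<Rightarrow> ('s \<Rightarrow> nat) \<Rightarrow> enat"
  where "samuel_fun R M J u = quot_length R M (carrier M) (multi_power_smult R M J u)"

text \<open>The number \<open>e(J\<^sub>1\<^sup>[\<^sup>d\<^sup>1\<^sup>], \<dots>, J\<^sub>s\<^sup>[\<^sup>d\<^sup>s\<^sup>]; M)\<close>, of interest for
  \<open>multi_deg d = dim M\<close>: the part of degree \<open>dim M\<close> of the polynomial of \<open>samuel_fun\<close> is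
  the sum of the monomials \<open>e(d) / (\<Prod>l. d\<^sub>l!) * (\<Prod>l. u\<^sub>l ^ d\<^sub>l)\<close>, so that \<open>e(d)\<close>
  is a normalised coefficient.\<close>

definition mixed_mult ::
  "('a, 'r) ring_scheme \<Rightarrow> ('a, 'b, 'm) module_scheme \<Rightarrow> ('s::finite \<Rightarrow> 'a set) \<Rightarrow> ('s \<Rightarrow> nat) \<Rightarrow> real"
  where "mixed_mult R M J d =
    (\<Prod>l\<in>UNIV. fact (d l)) * Poly_Mapping.lookup (hilbert_poly (samuel_fun R M J)) d"

text \<open>The function \<open>H\<^sup>(\<^sup>j\<^sup>)(r, u)\<close>. Its argument \<open>w\<close> combines \<open>r = w None\<close> and
  \<open>u\<^sub>l = w (Some l)\<close>.\<close>

definition dir_hilbert_fun ::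
  "('a, 'r) ring_scheme \<Rightarrow> 'a set \<Rightarrow> ('a, 'b, 'm) module_scheme \<Rightarrow> ('s::finite \<Rightarrow> 'a set) \<Rightarrow>
    's \<Rightarrow> ('s option \<Rightarrow> nat) \<Rightarrow> enat"
  where "dir_hilbert_fun R \<mm> M J j w =
    (let r = w None; u = (\<lambda>l. w (Some l)); N = multi_power_smult R M J u in
      quot_length R M N
        (ideal_smult R M (\<mm> [^]\<^bsub>ideals_set R\<^esub> (r + 1)) N
          <+>\<^bsub>M\<^esub> multi_power_smult R M J (u(j := u j + 1))))"

text \<open>The number \<open>c\<^sup>(\<^sup>j\<^sup>)(J\<^sub>1\<^sup>[\<^sup>d\<^sup>1\<^sup>], \<dots>, J\<^sub>s\<^sup>[\<^sup>d\<^sup>s\<^sup>]; M)\<close>, of interest for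
  \<open>1 \<le> multi_deg d \<le> D = dim M\<close> and \<open>d j > 0\<close>: the part of degree \<open>D - 1\<close> of the
  polynomial of \<open>dir_hilbert_fun\<close> is the sum of the monomials
  \<open>c(d) / ((D - multi_deg d)! (d\<^sub>j - 1)! (\<Prod>l\<noteq>j. d\<^sub>l!))
    * r ^ (D - multi_deg d) * u\<^sub>j ^ (d\<^sub>j - 1) * (\<Prod>l\<noteq>j. u\<^sub>l ^ d\<^sub>l)\<close>.\<close>

definition dir_mixed_mult ::
  "('a, 'r) ring_scheme \<Rightarrow> 'a set \<Rightarrow> ('a, 'b, 'm) module_scheme \<Rightarrow> ('s::finite \<Rightarrow> 'a set) \<Rightarrow>
    's \<Rightarrow> ('s \<Rightarrow> nat) \<Rightarrow> real"
  where "dir_mixed_mult R \<mm> M J j d =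
    (let D = the_enat (module_dim R M) in
      fact (D - multi_deg d) * fact (d j - 1) * (\<Prod>l\<in>UNIV - {j}. fact (d l)) *
      Poly_Mapping.lookup (hilbert_poly (dir_hilbert_fun R \<mm> M J j))
        (case_option (D - multi_deg d) (d(j := d j - 1))))"

end

theory Submission
  imports Defs "HOL-Computational_Algebra.Polynomial"
begin

text \<open>
  Write \<open>f(u)\<close> for the length of \<open>M/J\<^sup>u M\<close>. Some power \<open>\<mm>\<^sup>c\<close> lies in every \<open>J\<^sub>l\<close>, so as soon as
  \<open>r + 1 \<ge> c\<close> the summand \<open>\<mm>\<^bsup>r+1\<^esup>J\<^sup>u M\<close> is absorbed by \<open>J\<^bsup>u+e\<^esup>M = J\<^sub>j J\<^sup>u M\<close>, where \<open>e\<close> is the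
  \<open>j\<close>-th unit vector, and \<open>H\<^sup>(\<^sup>j\<^sup>)(r, u) = f(u + e) - f(u)\<close>. If the polynomial \<open>P\<close> agrees with \<open>f\<close>,
  then \<open>P(u + e) - P(u)\<close> agrees with \<open>H\<^sup>(\<^sup>j\<^sup>)\<close>. This polynomial does not involve \<open>r\<close>, hence the
  vanishing for \<open>|d| < D\<close>. If \<open>P\<close> has degree at most \<open>D = |d|\<close>, then the only monomial of \<open>P\<close> that
  contributes to \<open>u\<^sup>d / u\<^sub>j\<close> in the difference is \<open>u\<^sup>d\<close>, with the factor \<open>d\<^sub>j\<close>; this factor is
  exactly the quotient of the two normalisations (\<open>lookup_difference_mpol_top\<close>). So
  \<open>c\<^sup>(\<^sup>j\<^sup>)(d) = e(d)\<close>, and the symmetry in \<open>j\<close> is immediate.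

  The work lies in the existence of \<open>P\<close> and in the bound for its degree (\<open>samuel_polynomial\<close>).

  Existence. Let \<open>x\<^sub>0, \<dots>, x\<^bsub>n-1\<^esub>\<close> be generators of the ideals \<open>J\<^sub>l\<close>, each with the degree of its ideal.
  Then \<open>J\<^sup>u M\<close> is the sum of the \<open>x\<^sup>a M\<close> over the exponents \<open>a\<close> of degree \<open>u\<close>. Adding these summands
  to \<open>J\<^bsup>u+e\<^esup>M\<close> one at a time in lexicographic order splits the length of \<open>J\<^sup>u M / J\<^bsup>u+e\<^esup>M\<close> into
  the lengths of \<open>M/L\<^sub>a\<close>, where \<open>L\<^sub>a\<close> is the module of coefficients of \<open>x\<^sup>a\<close> that reduce to
  smaller exponents, as in the theory of Groebner bases. The family \<open>L\<close> increases with \<open>a\<close>, so the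
  ascending chain condition in \<open>M\<close> forces \<open>L\<^sub>a\<close> to depend only on \<open>min(a, t)\<close> for some \<open>t\<close>
  (\<open>monotone_family_threshold\<close>). Counting exponents then writes the length as a sum of products
  of functions of one variable that are eventually polynomial (\<open>sep_poly_rees_length\<close>). This
  class of functions is closed under summation, and so contains \<open>f\<close>.

  Degree. Prime avoidance gives \<open>D\<close> elements \<open>y\<close> of \<open>\<mm>\<close> such that \<open>\<mm>\<close> is the only prime that contains
  them and the annihilator of \<open>M\<close> (\<open>exists_parameters\<close>); hence \<open>M/(y)M\<close> has finite length. The same
  filtration bounds the length of \<open>M/(y)\<^sup>k M\<close> by a constant times \<open>k\<^sup>D\<close>. Since
  \<open>(y)\<^bsup>c|u|\<^esup>M \<subseteq> J\<^sup>u M\<close>, the function \<open>f\<close> grows at most like \<open>|u|\<^sup>D\<close>, and so does \<open>P\<close>.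
\<close>

section \<open>Sums of products of eventually polynomial functions\<close>

definition eventually_poly :: "(nat \<Rightarrow> real) \<Rightarrow> bool"
  where "eventually_poly p \<longleftrightarrow> (\<exists>q N. \<forall>m\<ge>N. p m = poly q (real m))"

lemma eventually_polyI: "(\<And>m. N \<le> m \<Longrightarrow> p m = poly q (real m)) \<Longrightarrow> eventually_poly p"
  unfolding eventually_poly_def by blast

text \<open>By the binomial theorem \<open>x\<^bsup>k+1\<^esup>\<close> has the difference \<open>(k + 1) x\<^sup>k\<close> up to lower powers of \<open>x\<close>,
  whose antidifferences are known by induction.\<close>

lemma power_antidifference:
  "\<exists>Q::real poly. \<forall>x. poly Q (x + 1) - poly Q x = x ^ k"
proof (induction k rule: less_induct)
  case (less k)
  then obtain Q :: "nat \<Rightarrow> real poly"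
    where Q: "\<And>i x. i < k \<Longrightarrow> poly (Q i) (x + 1) - poly (Q i) x = x ^ i"
    by metis
  define P where "P = smult (1 / real (Suc k))
    (monom 1 (Suc k) - (\<Sum>i<k. smult (real (Suc k choose i)) (Q i)))"
  have "poly P (x + 1) - poly P x = x ^ k" for x
  proof -
    have b: "(x + 1) ^ Suc k = (\<Sum>i<k. real (Suc k choose i) * x ^ i) + real (Suc k) * x ^ k + x ^ Suc k"
    proof -
      have "(x + 1) ^ Suc k = (\<Sum>i\<le>Suc k. real (Suc k choose i) * x ^ i)"
        by (subst binomial_ring) simp
      also have "\<dots> = (\<Sum>i<Suc (Suc k). real (Suc k choose i) * x ^ i)"
        by (simp only: lessThan_Suc_atMost)
      finally show ?thesis by (simp del: binomial_Suc_Suc)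
    qed
    have "real (Suc k) * (poly P (x + 1) - poly P x) = (x + 1) ^ Suc k - x ^ Suc k
       - ((\<Sum>i<k. real (Suc k choose i) * poly (Q i) (x + 1)) - (\<Sum>i<k. real (Suc k choose i) * poly (Q i) x))"
      by (simp add: P_def poly_sum poly_monom right_diff_distrib del: power_Suc of_nat_Suc)
    also have "(\<Sum>i<k. real (Suc k choose i) * poly (Q i) (x + 1)) - (\<Sum>i<k. real (Suc k choose i) * poly (Q i) x)
       = (\<Sum>i<k. real (Suc k choose i) * x ^ i)"
      by (simp add: sum_subtractf [symmetric] right_diff_distrib [symmetric] Q)
    finally have "real (Suc k) * (poly P (x + 1) - poly P x) = real (Suc k) * x ^ k"
      unfolding b by simp
    then show ?thesis by (metis mult_cancel_left of_nat_0_eq_iff nat.distinct(1))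
  qed
  then show ?case by blast
qed

lemma poly_antidifference:
  "\<exists>Q::real poly. \<forall>x. poly Q (x + 1) - poly Q x = poly q x"
proof -
  obtain Q :: "nat \<Rightarrow> real poly" where Q: "\<And>i x. poly (Q i) (x + 1) - poly (Q i) x = x ^ i"
    using power_antidifference by metis
  have "poly (\<Sum>i\<le>degree q. smult (coeff q i) (Q i)) (x + 1)
      - poly (\<Sum>i\<le>degree q. smult (coeff q i) (Q i)) x = poly q x" for x
    unfolding poly_altdef [of q] by (simp add: poly_sum sum_subtractf [symmetric] right_diff_distrib [symmetric] Q)
  then show ?thesis by blast
qed

lemma eventually_poly_const: "eventually_poly (\<lambda>_. c)"
  by (rule eventually_polyI [of 0 _ "[:c:]"]) simp

lemma eventually_poly_delta: "eventually_poly (\<lambda>m. if m = 0 then c else 0)"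
  by (rule eventually_polyI [of 1 _ 0]) simp

lemma eventually_poly_add:
  assumes "eventually_poly p" and "eventually_poly p'"
  shows "eventually_poly (\<lambda>m. p m + p' m)"
proof -
  obtain q N where q: "\<And>m. N \<le> m \<Longrightarrow> p m = poly q (real m)"
    using assms(1) unfolding eventually_poly_def by blast
  obtain q' N' where q': "\<And>m. N' \<le> m \<Longrightarrow> p' m = poly q' (real m)"
    using assms(2) unfolding eventually_poly_def by blast
  show ?thesis
    by (rule eventually_polyI [of "max N N'" _ "q + q'"]) (simp add: q q')
qed

text \<open>The irregular initial values only contribute a constant, so an antidifference of the polynomial
  gives the sum.\<close>

lemma eventually_poly_sum:
  assumes "eventually_poly p"
  shows "eventually_poly (\<lambda>m. \<Sum>v<m. p v)"
proof -
  obtain q N where q: "\<And>m. N \<le> m \<Longrightarrow> p m = poly q (real m)"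
    using assms unfolding eventually_poly_def by blast
  obtain Q where Q: "\<And>x. poly Q (x + 1) - poly Q x = poly q x"
    using poly_antidifference [of q] by blast
  show ?thesis
  proof (rule eventually_polyI)
    fix m assume "N \<le> m"
    then show "(\<Sum>v<m. p v) = poly (Q + [:(\<Sum>v<N. p v) - poly Q (real N):]) (real m)"
    proof (induction m rule: dec_induct)
      case base
      then show ?case by simp
    next
      case (step m)
      then show ?case using Q [of "real m"] q [of m] by (simp add: add.commute)
    qed
  qed
qed

lemma eventually_poly_shift:
  assumes "eventually_poly p"
  shows "eventually_poly (\<lambda>m. if k \<le> m then p (m - k) else c)"
proof -
  obtain q N where q: "\<And>m. N \<le> m \<Longrightarrow> p m = poly q (real m)"
    using assms unfolding eventually_poly_def by blast
  show ?thesis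
    by (rule eventually_polyI [of "N + k" _ "pcompose q [:- real k, 1:]"])
      (simp add: q poly_pcompose of_nat_diff)
qed

text \<open>Functions on \<open>\<nat>\<^sup>V\<close> that are finite sums of products of functions of the single coordinates. Each
  factor is polynomial only for large arguments, but the identity with the sum of products holds
  everywhere. This makes the class stable under summation from \<open>0\<close>, which visits arguments where
  one coordinate is small and the others are large.\<close>

inductive sep_poly :: "(('v::finite \<Rightarrow> nat) \<Rightarrow> real) \<Rightarrow> bool" where
  zero: "sep_poly (\<lambda>_. 0)"
| add_prod: "sep_poly h \<Longrightarrow> (\<And>l. eventually_poly (p l)) \<Longrightarrow> sep_poly (\<lambda>u. h u + (\<Prod>l\<in>UNIV. p l (u l)))"

lemma sep_poly_prod:
  assumes "\<And>l. eventually_poly (p l)"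
  shows "sep_poly (\<lambda>u. \<Prod>l\<in>UNIV. p l (u l))"
  using sep_poly.add_prod [OF sep_poly.zero, of p] assms by simp

lemma sep_poly_add:
  assumes "sep_poly h" and "sep_poly h'"
  shows "sep_poly (\<lambda>u. h u + h' u)"
  using assms(2,1)
proof induction
  case (add_prod g p)
  then show ?case
    using sep_poly.add_prod [of "\<lambda>u. h u + g u" p] by (simp add: add.assoc)
qed simp

lemma sep_poly_sum:
  assumes "finite K" and "\<And>k. k \<in> K \<Longrightarrow> sep_poly (h k)"
  shows "sep_poly (\<lambda>u. \<Sum>k\<in>K. h k u)"
  using assms by (induction K) (simp_all add: sep_poly.zero sep_poly_add)

lemma sep_poly_const: "sep_poly (\<lambda>_::'v::finite \<Rightarrow> nat. c)"
proof -
  obtain l0 :: 'v where True by blast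
  have "(\<Prod>l\<in>UNIV. if l = l0 then c else 1) = c" by simp
  then show ?thesis
    using sep_poly_prod [of "\<lambda>l _. if l = l0 then c else 1"] by (simp add: eventually_poly_const)
qed

lemma prod_fun_upd:
  fixes p :: "'v::finite \<Rightarrow> nat \<Rightarrow> real"
  shows "(\<Prod>i\<in>UNIV. p i ((u(l := v)) i)) = p l v * (\<Prod>i\<in>UNIV - {l}. p i (u i))"
  by (subst prod.remove [of UNIV l]) (auto intro!: prod.cong)

text \<open>A linear operation on functions of the coordinate \<open>l\<close> alone acts on each product through its
  \<open>l\<close>-th factor. The two instances of interest are shifts and partial sums.\<close>

lemma sep_poly_kernel_sum:
  fixes h :: "('v::finite \<Rightarrow> nat) \<Rightarrow> real"
  assumes K: "\<And>p. eventually_poly p \<Longrightarrow> eventually_poly (\<lambda>m. \<Sum>v\<le>m. if K m v then p v else 0)"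
    and h: "sep_poly h"
  shows "sep_poly (\<lambda>u. \<Sum>v\<le>u l. if K (u l) v then h (u(l := v)) else 0)"
  using h
proof induction
  case zero
  then show ?case by (simp add: sep_poly.zero)
next
  case (add_prod g p)
  define p' where "p' = p(l := (\<lambda>m. \<Sum>v\<le>m. if K m v then p l v else 0))"
  have "(\<Prod>i\<in>UNIV. p' i (u i)) = (\<Sum>v\<le>u l. if K (u l) v then \<Prod>i\<in>UNIV. p i ((u(l := v)) i) else 0)" for u
  proof -
    have "(\<Prod>i\<in>UNIV. p' i (u i)) = p' l (u l) * (\<Prod>i\<in>UNIV - {l}. p i (u i))"
      by (subst prod.remove [of UNIV l]) (auto intro!: prod.cong simp: p'_def)
    also have "\<dots> = (\<Sum>v\<le>u l. (if K (u l) v then p l v else 0) * (\<Prod>i\<in>UNIV - {l}. p i (u i)))"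
      by (simp add: p'_def sum_distrib_right)
    also have "\<dots> = (\<Sum>v\<le>u l. if K (u l) v then \<Prod>i\<in>UNIV. p i ((u(l := v)) i) else 0)"
      unfolding prod_fun_upd by (rule sum.cong) auto
    finally show ?thesis .
  qed
  moreover have "eventually_poly (p' i)" for i
    using add_prod K by (simp add: p'_def)
  then have "sep_poly (\<lambda>u. (\<Sum>v\<le>u l. if K (u l) v then g (u(l := v)) else 0) + (\<Prod>i\<in>UNIV. p' i (u i)))"
    using add_prod by (intro sep_poly.add_prod) auto
  moreover have "(\<Sum>v\<le>u l. if K (u l) v then g (u(l := v)) + (\<Prod>i\<in>UNIV. p i ((u(l := v)) i)) else 0) =
      (\<Sum>v\<le>u l. if K (u l) v then g (u(l := v)) else 0)
      + (\<Sum>v\<le>u l. if K (u l) v then \<Prod>i\<in>UNIV. p i ((u(l := v)) i) else 0)" for u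
    unfolding sum.distrib [symmetric] by (rule sum.cong) auto
  ultimately show ?case by simp
qed

lemma sep_poly_restrict:
  assumes "sep_poly h"
  shows "sep_poly (\<lambda>u. h (\<lambda>i. if i \<in> S then u i else 0))"
  using assms
proof induction
  case zero
  then show ?case by (simp add: sep_poly.zero)
next
  case (add_prod g p)
  have "sep_poly (\<lambda>u. g (\<lambda>i. if i \<in> S then u i else 0)
      + (\<Prod>l\<in>UNIV. (if l \<in> S then p l else (\<lambda>_. p l 0)) (u l)))"
    using add_prod by (intro sep_poly.add_prod) (auto simp: eventually_poly_const)
  moreover have "(\<Prod>l\<in>UNIV. (if l \<in> S then p l else (\<lambda>_. p l 0)) (u l))
      = (\<Prod>l\<in>UNIV. p l (if l \<in> S then u l else 0))" for u
    by (rule prod.cong) auto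
  ultimately show ?case by simp
qed

text \<open>Telescoping along a path that raises the coordinates one after the other, starting at the
  origin.\<close>

lemma sep_poly_of_differences:
  fixes f :: "('v::finite \<Rightarrow> nat) \<Rightarrow> real"
  assumes "\<And>l. sep_poly (\<lambda>u. f (u(l := u l + 1)) - f u)"
  shows "sep_poly f"
proof -
  \<comment> \<open>\<open>S\<close> collects the coordinates that the path has already raised to their final value.\<close>
  have "sep_poly (\<lambda>u. f (\<lambda>i. if i \<in> S then u i else 0))" if "finite S" for S
    using that
  proof induction
    case empty
    then show ?case by (simp add: sep_poly_const)
  next
    case (insert l S)
    let ?r = "\<lambda>u i. if i \<in> insert l S then u i else 0"
    let ?d = "\<lambda>u. f (u(l := u l + 1)) - f u"
    have d: "sep_poly (\<lambda>u. ?d (?r u))"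
      by (rule sep_poly_restrict) (rule assms)
    have "sep_poly (\<lambda>u. \<Sum>v\<le>u l. if v < u l then ?d (?r (u(l := v))) else 0)"
    proof (rule sep_poly_kernel_sum [OF _ d])
      fix p assume p: "eventually_poly p"
      have "(\<Sum>v\<le>m. if v < m then p v else 0) = (\<Sum>v<m. p v)" for m :: nat
        by (rule sum.mono_neutral_cong_right) auto
      then show "eventually_poly (\<lambda>m. \<Sum>v\<le>m. if v < m then p v else 0)"
        using eventually_poly_sum [OF p] by simp
    qed
    moreover have "f (?r u) = f (\<lambda>i. if i \<in> S then u i else 0)
        + (\<Sum>v\<le>u l. if v < u l then ?d (?r (u(l := v))) else 0)" for u
    proof -
      have "f (?r (u(l := m))) = f (\<lambda>i. if i \<in> S then u i else 0) + (\<Sum>v<m. ?d (?r (u(l := v))))" for m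
      proof (induction m)
        case 0
        have "?r (u(l := 0)) = (\<lambda>i. if i \<in> S then u i else 0)" using insert by auto
        then show ?case by simp
      next
        case (Suc m)
        have "(?r (u(l := m)))(l := ?r (u(l := m)) l + 1) = ?r (u(l := Suc m))" by auto
        then have "f (?r (u(l := Suc m))) = f (?r (u(l := m))) + ?d (?r (u(l := m)))" by (simp only:)
        then show ?case using Suc by (simp only: sum.lessThan_Suc add.assoc)
      qed
      from this [of "u l"] have "f (?r u) = f (\<lambda>i. if i \<in> S then u i else 0) + (\<Sum>v<u l. ?d (?r (u(l := v))))"
        by (simp only: fun_upd_triv)
      also have "(\<Sum>v<u l. ?d (?r (u(l := v)))) = (\<Sum>v\<le>u l. if v < u l then ?d (?r (u(l := v))) else 0)"
        by (rule sum.mono_neutral_cong_left) auto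
      finally show ?thesis .
    qed
    ultimately show ?case using sep_poly_add [OF insert.IH] by simp
  qed
  from this [of UNIV] show ?thesis by simp
qed

text \<open>The exponent vectors \<open>a\<close> of the monomials of degree \<open>u\<close> in \<open>n\<close> variables, where the \<open>i\<close>-th variable
  has the unit vector of \<open>dir i\<close> as its degree. Extending \<open>a\<close> by \<open>0\<close> beyond \<open>n\<close> makes it a unique
  function on the natural numbers.\<close>

definition exponents :: "(nat \<Rightarrow> 'v) \<Rightarrow> nat \<Rightarrow> ('v \<Rightarrow> nat) \<Rightarrow> (nat \<Rightarrow> nat) set"
  where "exponents dir n u = {a. (\<forall>i\<ge>n. a i = 0) \<and> (\<forall>l. (\<Sum>i | i < n \<and> dir i = l. a i) = u l)}"

lemma exponents_0: "exponents dir 0 u = (if \<forall>l. u l = 0 then {\<lambda>_. 0} else {})"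
  by (auto simp: exponents_def)

text \<open>The last exponent takes what the other variables leave of the coordinate \<open>dir n\<close> of the degree.\<close>

lemma exponents_Suc:
  "exponents dir (Suc n) u =
    (\<Union>v\<in>{..u (dir n)}. (\<lambda>a. a(n := u (dir n) - v)) ` exponents dir n (u(dir n := v)))"
proof -
  have s: "(\<Sum>i | i < Suc n \<and> dir i = l. a i) = (\<Sum>i | i < n \<and> dir i = l. a i) + (if dir n = l then a n else 0)"
    for a :: "nat \<Rightarrow> nat" and l
  proof -
    have "{i. i < Suc n \<and> dir i = l} = (if dir n = l then insert n {i. i < n \<and> dir i = l} else {i. i < n \<and> dir i = l})"
      by (auto simp: less_Suc_eq)
    then show ?thesis by simp
  qed
  have u: "(\<Sum>i | i < n \<and> dir i = l. (a(n := k)) i) = (\<Sum>i | i < n \<and> dir i = l. a i)"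
    for a :: "nat \<Rightarrow> nat" and l k
    by (rule sum.cong) auto
  show ?thesis (is "?L = ?R")
  proof (rule Set.set_eqI, rule iffI)
    fix a assume a: "a \<in> ?L"
    let ?v = "\<Sum>i | i < n \<and> dir i = dir n. a i"
    have v: "?v + a n = u (dir n)"
      using a s [of a "dir n"] unfolding exponents_def by auto
    have "a(n := 0) \<in> exponents dir n (u(dir n := ?v))"
      using a unfolding exponents_def mem_Collect_eq s u by (auto dest: spec split: if_splits simp: fun_upd_def)
    moreover have "u (dir n) - ?v = a n" using v by linarith
    then have "a = (a(n := 0))(n := u (dir n) - ?v)" by simp
    ultimately show "a \<in> ?R" using v by (auto intro!: bexI [of _ ?v] image_eqI [of _ _ "a(n := 0)"])
  next
    fix a assume "a \<in> ?R"
    then obtain v b where v: "v \<le> u (dir n)" and b: "b \<in> exponents dir n (u(dir n := v))"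
      and a: "a = b(n := u (dir n) - v)" by blast
    show "a \<in> ?L"
      using b v unfolding a exponents_def mem_Collect_eq s u by auto
  qed
qed

lemma finite_exponents: "finite (exponents dir n u)"
  by (induction n arbitrary: u) (auto simp: exponents_0 exponents_Suc)

lemma sum_exponents_Suc:
  fixes g :: "(nat \<Rightarrow> nat) \<Rightarrow> 'c::comm_monoid_add"
  shows "(\<Sum>a\<in>exponents dir (Suc n) u. g a) =
    (\<Sum>v\<le>u (dir n). \<Sum>a\<in>exponents dir n (u(dir n := v)). g (a(n := u (dir n) - v)))"
proof -
  let ?l = "dir n"
  have "(\<Sum>a\<in>exponents dir (Suc n) u. g a) =
      (\<Sum>v\<le>u ?l. \<Sum>a\<in>(\<lambda>a. a(n := u ?l - v)) ` exponents dir n (u(?l := v)). g a)"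
    unfolding exponents_Suc
  proof (rule sum.UNION_disjoint)
    show "\<forall>v\<in>{..u ?l}. \<forall>w\<in>{..u ?l}. v \<noteq> w \<longrightarrow>
      (\<lambda>a. a(n := u ?l - v)) ` exponents dir n (u(?l := v)) \<inter>
      (\<lambda>a. a(n := u ?l - w)) ` exponents dir n (u(?l := w)) = {}"
      by (auto dest!: fun_cong [of _ _ n])
  qed (auto simp: finite_exponents)
  also have "\<dots> = (\<Sum>v\<le>u ?l. \<Sum>a\<in>exponents dir n (u(?l := v)). g (a(n := u ?l - v)))"
  proof (rule sum.cong [OF refl])
    fix v
    have "inj_on (\<lambda>a. a(n := u ?l - v)) (exponents dir n (u(?l := v)))"
    proof (rule inj_onI)
      fix a b assume a: "a \<in> exponents dir n (u(?l := v))" and b: "b \<in> exponents dir n (u(?l := v))"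
        and e: "a(n := u ?l - v) = b(n := u ?l - v)"
      have "a n = 0" "b n = 0" using a b by (auto simp: exponents_def)
      then show "a = b" using e by (metis fun_upd_triv fun_upd_upd)
    qed
    then show "(\<Sum>a\<in>(\<lambda>a. a(n := u ?l - v)) ` exponents dir n (u(?l := v)). g a) =
        (\<Sum>a\<in>exponents dir n (u(?l := v)). g (a(n := u ?l - v)))"
      by (simp add: sum.reindex)
  qed
  finally show ?thesis .
qed

text \<open>Induction over the number of variables: the last exponent \<open>k\<close> is summed over \<open>k < t\<close>, where each
  value contributes a shift, and over \<open>k \<ge> t\<close>, where \<open>g\<close> does not see \<open>k\<close> and a partial sum arises.\<close>

lemma sep_poly_sum_exponents:
  fixes dir :: "nat \<Rightarrow> 'v::finite" and g :: "(nat \<Rightarrow> nat) \<Rightarrow> real"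
  assumes "\<And>a. g a = g (\<lambda>i. min (a i) t)"
  shows "sep_poly (\<lambda>u. \<Sum>a\<in>exponents dir n u. g a)"
  using assms
proof (induction n arbitrary: g)
  case 0
  have e: "(\<Sum>a\<in>exponents dir 0 u. g a) = g (\<lambda>_. 0) * (\<Prod>l\<in>UNIV. if u l = 0 then 1 else 0)" for u
    by (auto simp: exponents_0)
  obtain l0 :: 'v where True by blast
  have "sep_poly (\<lambda>u::'v \<Rightarrow> nat. \<Prod>l\<in>UNIV. (if u l = 0 then if l = l0 then g (\<lambda>_. 0) else 1 else 0))"
    by (rule sep_poly_prod [where p = "\<lambda>l m. if m = 0 then if l = l0 then g (\<lambda>_. 0) else 1 else 0"])
      (rule eventually_poly_delta)
  moreover have "(\<Prod>l\<in>UNIV. (if u l = 0 then if l = l0 then g (\<lambda>_. 0) else 1 else 0))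
      = g (\<lambda>_. 0) * (\<Prod>l\<in>UNIV. if u l = 0 then 1 else 0)" for u :: "'v \<Rightarrow> nat"
  proof (cases "\<forall>l. u l = 0")
    case True
    then show ?thesis by simp
  next
    case False
    then obtain l where "u l \<noteq> 0" by blast
    then have "(\<Prod>l\<in>UNIV. (if u l = 0 then if l = l0 then g (\<lambda>_. 0) else 1 else 0)) = 0"
      "(\<Prod>l\<in>UNIV. if u l = 0 then 1 else 0 :: real) = 0"
      by (auto simp: prod_zero_iff intro!: exI [of _ l] split del: if_split)
    then show ?thesis by (simp only: mult_zero_right)
  qed
  ultimately show ?case unfolding e by simp
next
  case (Suc n)
  let ?l = "dir n"
  define G where "G k u = (\<Sum>a\<in>exponents dir n u. g (a(n := k)))" for k u
  have G: "sep_poly (G k)" for k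
    unfolding G_def
  proof (rule Suc.IH)
    fix a :: "nat \<Rightarrow> nat"
    have "g (a(n := k)) = g (\<lambda>i. min ((a(n := k)) i) t)" by (rule Suc.prems)
    also have "(\<lambda>i. min ((a(n := k)) i) t) = (\<lambda>i. min (((\<lambda>i. min (a i) t)(n := k)) i) t)" by auto
    also have "g \<dots> = g ((\<lambda>i. min (a i) t)(n := k))" by (rule Suc.prems [symmetric])
    finally show "g (a(n := k)) = g ((\<lambda>i. min (a i) t)(n := k))" .
  qed
  have large: "g (a(n := k)) = g (a(n := t))" if "t \<le> k" for a k
  proof -
    have "g (a(n := k)) = g (\<lambda>i. min ((a(n := k)) i) t)" by (rule Suc.prems)
    also have "(\<lambda>i. min ((a(n := k)) i) t) = (\<lambda>i. min ((a(n := t)) i) t)" using that by auto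
    also have "g \<dots> = g (a(n := t))" by (rule Suc.prems [symmetric])
    finally show ?thesis .
  qed
  have 1: "sep_poly (\<lambda>u. \<Sum>v\<le>u ?l. if u ?l - v = k then G k (u(?l := v)) else 0)" for k
  proof (rule sep_poly_kernel_sum [OF _ G])
    fix p assume p: "eventually_poly p"
    have "(\<Sum>v\<le>m. if m - v = k then p v else 0) = (if k \<le> m then p (m - k) else 0)" for m
    proof -
      have "(\<Sum>v\<le>m. if m - v = k then p v else 0) = (\<Sum>v\<in>{v. v \<le> m \<and> m - v = k}. p v)"
        by (rule sum.mono_neutral_cong_right) auto
      also have "{v. v \<le> m \<and> m - v = k} = (if k \<le> m then {m - k} else {})" by auto
      finally show ?thesis by simp
    qed
    then show "eventually_poly (\<lambda>m. \<Sum>v\<le>m. if m - v = k then p v else 0)"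
      using eventually_poly_shift [OF p, of k 0] by simp
  qed
  have 2: "sep_poly (\<lambda>u. \<Sum>v\<le>u ?l. if t \<le> u ?l - v then G t (u(?l := v)) else 0)"
  proof (rule sep_poly_kernel_sum [OF _ G])
    fix p assume p: "eventually_poly p"
    have "(\<Sum>v\<le>m. if t \<le> m - v then p v else 0) = (if t \<le> m then \<Sum>v<m - t. p v else 0)
        + (if t \<le> m then p (m - t) else 0)" for m
    proof (cases "t \<le> m")
      case True
      have "(\<Sum>v\<le>m. if t \<le> m - v then p v else 0) = (\<Sum>v\<le>m - t. p v)"
        using True by (intro sum.mono_neutral_cong_right) auto
      also have "\<dots> = (\<Sum>v<m - t. p v) + p (m - t)"
        by (simp add: lessThan_Suc_atMost [symmetric])
      finally show ?thesis using True by simp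
    next
      case False
      then have "(if t \<le> m - v then p v else 0) = 0" for v by simp
      then show ?thesis using False by simp
    qed
    moreover have "eventually_poly (\<lambda>m. if t \<le> m then \<Sum>v<m - t. p v else 0)"
      by (rule eventually_poly_shift [OF eventually_poly_sum [OF p]])
    moreover have "eventually_poly (\<lambda>m. if t \<le> m then p (m - t) else 0)"
      by (rule eventually_poly_shift [OF p])
    ultimately show "eventually_poly (\<lambda>m. \<Sum>v\<le>m. if t \<le> m - v then p v else 0)"
      using eventually_poly_add by simp
  qed
  have "(\<Sum>a\<in>exponents dir (Suc n) u. g a) =
      (\<Sum>k<t. \<Sum>v\<le>u ?l. if u ?l - v = k then G k (u(?l := v)) else 0)
      + (\<Sum>v\<le>u ?l. if t \<le> u ?l - v then G t (u(?l := v)) else 0)" for u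
  proof -
    have "(\<Sum>a\<in>exponents dir n (u(?l := v)). g (a(n := u ?l - v))) =
        (\<Sum>k<t. if u ?l - v = k then G k (u(?l := v)) else 0)
        + (if t \<le> u ?l - v then G t (u(?l := v)) else 0)" for v
    proof (cases "t \<le> u ?l - v")
      case True
      then have "g (a(n := u ?l - v)) = g (a(n := t))" for a by (rule large)
      then show ?thesis using True by (simp add: G_def)
    next
      case False
      then show ?thesis by (simp add: G_def)
    qed
    then show ?thesis
      unfolding sum_exponents_Suc by (subst sum.swap) (simp add: sum.distrib)
  qed
  moreover have "sep_poly (\<lambda>u. (\<Sum>k<t. \<Sum>v\<le>u ?l. if u ?l - v = k then G k (u(?l := v)) else 0)
      + (\<Sum>v\<le>u ?l. if t \<le> u ?l - v then G t (u(?l := v)) else 0))"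
    by (intro sep_poly_add sep_poly_sum 1 2) simp
  ultimately show ?case by simp
qed

section \<open>Polynomials in several variables\<close>

lemma mpol_eval_superset:
  assumes "finite S" and "Poly_Mapping.keys p \<subseteq> S"
  shows "mpol_eval p x = (\<Sum>a\<in>S. Poly_Mapping.lookup p a * (\<Prod>v\<in>UNIV. x v ^ a v))"
  unfolding mpol_eval_def using assms
  by (intro sum.mono_neutral_left) (auto simp: Poly_Mapping.in_keys_iff)

lemma mpol_eval_add: "mpol_eval (p + q) x = mpol_eval p x + mpol_eval q x"
proof -
  have "Poly_Mapping.keys (p + q) \<subseteq> Poly_Mapping.keys p \<union> Poly_Mapping.keys q"
    by (rule Poly_Mapping.keys_add)
  then show ?thesis
    by (simp add: mpol_eval_superset [of "Poly_Mapping.keys p \<union> Poly_Mapping.keys q"]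
        lookup_add distrib_right sum.distrib)
qed

lemma mpol_eval_zero: "mpol_eval 0 x = 0"
  by (simp add: mpol_eval_def)

lemma mpol_eval_sum: "mpol_eval (\<Sum>k\<in>K. p k) x = (\<Sum>k\<in>K. mpol_eval (p k) x)"
  by (induction K rule: infinite_finite_induct) (simp_all add: mpol_eval_zero mpol_eval_add)

lemma mpol_eval_single: "mpol_eval (Poly_Mapping.single a c) x = c * (\<Prod>v\<in>UNIV. x v ^ a v)"
  by (subst mpol_eval_superset [of "{a}"]) auto

lemma mpol_eval_diff: "mpol_eval (p - q) x = mpol_eval p x - mpol_eval q x"
proof -
  have "mpol_eval (p - q) x + mpol_eval q x = mpol_eval p x"
    by (simp add: mpol_eval_add [symmetric])
  then show ?thesis by simp
qed

text \<open>Expanding the product of the sums of monomials.\<close>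

lemma ex_mpol_prod: "\<exists>p. \<forall>x. mpol_eval p x = (\<Prod>v\<in>UNIV. poly (q v) (x v))"
proof -
  let ?A = "PiE UNIV (\<lambda>v. {..degree (q v)})"
  have "mpol_eval (\<Sum>a\<in>?A. Poly_Mapping.single a (\<Prod>v\<in>UNIV. coeff (q v) (a v))) x
      = (\<Prod>v\<in>UNIV. poly (q v) (x v))" for x
    unfolding mpol_eval_sum mpol_eval_single poly_altdef
    by (subst prod.distrib [symmetric], subst prod_sum_PiE) auto
  then show ?thesis by blast
qed

lemma sep_poly_imp_mpol:
  assumes "sep_poly h"
  shows "\<exists>p N. \<forall>u. (\<forall>v. N \<le> u v) \<longrightarrow> h u = mpol_eval p (\<lambda>v. real (u v))"
  using assms
proof induction
  case zero
  then show ?case using mpol_eval_zero by metis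
next
  case (add_prod h p)
  obtain P N where P: "\<And>u. (\<And>v. N \<le> u v) \<Longrightarrow> h u = mpol_eval P (\<lambda>v. real (u v))"
    using add_prod by blast
  have "\<forall>l. \<exists>q N. \<forall>m\<ge>N. p l m = poly q (real m)"
    using add_prod unfolding eventually_poly_def by blast
  then obtain q N' where q: "\<And>l m. N' l \<le> m \<Longrightarrow> p l m = poly (q l) (real m)"
    by metis
  obtain Q where Q: "\<And>x. mpol_eval Q x = (\<Prod>v\<in>UNIV. poly (q v) (x v))"
    using ex_mpol_prod [of q] by blast
  have "h u + (\<Prod>l\<in>UNIV. p l (u l)) = mpol_eval (P + Q) (\<lambda>v. real (u v))"
    if "\<forall>v. max N (Max (range N')) \<le> u v" for u
  proof -
    have "N' l \<le> u l" for l
      using that by (meson Max_ge finite finite_imageI le_trans max.bounded_iff rangeI)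
    then show ?thesis using that by (simp add: mpol_eval_add P Q q)
  qed
  then show ?case by blast
qed

lemma digits_unique:
  fixes a b :: "nat \<Rightarrow> nat"
  assumes "\<And>i. i < n \<Longrightarrow> a i < B" and "\<And>i. i < n \<Longrightarrow> b i < B"
    and "(\<Sum>i<n. a i * B ^ i) = (\<Sum>i<n. b i * B ^ i)" and "i < n"
  shows "a i = b i"
  using assms
proof (induction n arbitrary: a b i)
  case (Suc n)
  have e: "(\<Sum>i<Suc n. a i * B ^ i) = a 0 + B * (\<Sum>i<n. a (Suc i) * B ^ i)" for a :: "nat \<Rightarrow> nat"
    unfolding sum.lessThan_Suc_shift by (simp add: sum_distrib_left mult.left_commute)
  have "a 0 = (a 0 + B * (\<Sum>i<n. a (Suc i) * B ^ i)) mod B" using Suc.prems(1) [of 0] by simp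
  also have "\<dots> = (b 0 + B * (\<Sum>i<n. b (Suc i) * B ^ i)) mod B" using Suc.prems(3) unfolding e by simp
  also have "\<dots> = b 0" using Suc.prems(2) [of 0] by simp
  finally have 0: "a 0 = b 0" .
  moreover have "B > 0" using Suc.prems(1) [of 0] by simp
  ultimately have "(\<Sum>i<n. a (Suc i) * B ^ i) = (\<Sum>i<n. b (Suc i) * B ^ i)"
    using Suc.prems(3) unfolding e by simp
  then have "a (Suc i) = b (Suc i)" if "i < n" for i
    using Suc.IH [of "\<lambda>i. a (Suc i)" "\<lambda>i. b (Suc i)" i] Suc.prems that by simp
  then show ?case using 0 Suc.prems(4) by (cases i) auto
qed simp

lemma real_poly_zero_if_eventually_zero:
  fixes q :: "real poly"
  assumes "\<And>m. N \<le> m \<Longrightarrow> poly q (real m) = 0"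
  shows "q = 0"
proof (rule ccontr)
  assume "q \<noteq> 0"
  then have "finite {x. poly q x = 0}" by (rule poly_roots_finite)
  moreover have "real ` {N..} \<subseteq> {x. poly q x = 0}" using assms by auto
  ultimately have "finite (real ` {N..})" by (rule rev_finite_subset)
  then show False by (simp add: finite_image_iff inj_on_def infinite_Ici)
qed

text \<open>Kronecker substitution: on the curve \<open>u\<^sub>v = T\<close> to the power \<open>B\<^bsup>i(v)\<^esup>\<close>, with \<open>B\<close> larger than all exponents,
  distinct monomials become distinct powers of \<open>T\<close>, so that the coefficients of \<open>p\<close> are those of a
  polynomial in one variable with infinitely many zeros.\<close>

lemma mpol_zero_if_eventually_zero:
  fixes p :: "'v::finite mpol"
  assumes zero: "\<And>u. (\<And>v. N \<le> u v) \<Longrightarrow> mpol_eval p (\<lambda>v. real (u v)) = 0"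
  shows "p = 0"
proof -
  let ?K = "Poly_Mapping.keys p"
  obtain ix :: "nat \<Rightarrow> 'v" where ix: "bij_betw ix {..<card (UNIV :: 'v set)} UNIV"
    using ex_bij_betw_nat_finite [of "UNIV :: 'v set"] by (auto simp: atLeast0LessThan)
  define B where "B = Suc (Max (insert 0 ((\<lambda>(a, v). a v) ` (?K \<times> UNIV))))"
  have B: "a v < B" if "a \<in> ?K" for a v
    unfolding B_def using that by (auto simp: less_Suc_eq_le intro!: Max_ge image_eqI [of _ _ "(a, v)"])
  \<comment> \<open>The exponent of \<open>T\<close> in the image of the monomial \<open>a\<close>: its entries are the digits in base \<open>B\<close>.\<close>
  define E where "E a = (\<Sum>i<card (UNIV :: 'v set). a (ix i) * B ^ i)" for a
  have inj: "inj_on E ?K"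
  proof (rule inj_onI)
    fix a b assume ab: "a \<in> ?K" "b \<in> ?K" "E a = E b"
    have "a (ix i) = b (ix i)" if "i < card (UNIV :: 'v set)" for i
      by (rule digits_unique [where n = "card (UNIV :: 'v set)" and B = B]) (use ab B that in \<open>auto simp: E_def\<close>)
    moreover have "\<exists>i<card (UNIV :: 'v set). ix i = v" for v
      using ix by (metis UNIV_I bij_betw_def imageE lessThan_iff)
    ultimately show "a = b" by (metis ext)
  qed
  define q where "q = (\<Sum>a\<in>?K. monom (Poly_Mapping.lookup p a) (E a))"
  have "poly q (real t) = 0" if t: "max 1 N \<le> t" for t
  proof -
    define u where "u v = t ^ (B ^ (inv_into {..<card (UNIV :: 'v set)} ix v))" for v
    have "u v \<ge> t" for v
      unfolding u_def using t by (intro self_le_power) (auto simp: B_def)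
    then have "0 = mpol_eval p (\<lambda>v. real (u v))"
      using t by (intro zero [symmetric]) (meson le_trans max.bounded_iff)
    also have "\<dots> = poly q (real t)"
      unfolding mpol_eval_def q_def poly_sum poly_monom
    proof (intro sum.cong refl arg_cong2 [where f = "(*)"])
      fix a
      have "(\<Prod>v\<in>UNIV. real (u v) ^ a v) = (\<Prod>i<card (UNIV :: 'v set). real (u (ix i)) ^ a (ix i))"
        by (rule prod.reindex_bij_betw [OF ix, symmetric])
      also have "\<dots> = (\<Prod>i<card (UNIV :: 'v set). real t ^ (a (ix i) * B ^ i))"
      proof (rule prod.cong [OF refl])
        fix i assume "i \<in> {..<card (UNIV :: 'v set)}"
        then have "inv_into {..<card (UNIV :: 'v set)} ix (ix i) = i"
          using ix by (simp add: bij_betw_def)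
        then show "real (u (ix i)) ^ a (ix i) = real t ^ (a (ix i) * B ^ i)"
          by (simp add: u_def power_mult [symmetric] mult.commute)
      qed
      also have "\<dots> = real t ^ E a" by (simp add: E_def power_sum)
      finally show "(\<Prod>v\<in>UNIV. real (u v) ^ a v) = real t ^ E a" .
    qed
    finally show ?thesis by simp
  qed
  then have "q = 0" by (rule real_poly_zero_if_eventually_zero)
  have "Poly_Mapping.lookup p a = 0" if "a \<in> ?K" for a
  proof -
    have "0 = coeff q (E a)" using \<open>q = 0\<close> by simp
    also have "\<dots> = (\<Sum>b\<in>?K. if a = b then Poly_Mapping.lookup p b else 0)"
      unfolding q_def coeff_sum using that inj by (intro sum.cong) (auto simp: inj_on_def)
    also have "\<dots> = Poly_Mapping.lookup p a" using that by simp
    finally show ?thesis by simp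
  qed
  then show ?thesis by (metis in_keys_iff poly_mapping_eqI lookup_zero)
qed

lemma hilbert_poly_eq:
  assumes "agrees_with f p"
  shows "hilbert_poly f = p"
  unfolding hilbert_poly_def
proof (rule the_equality)
  fix q assume "agrees_with f q"
  obtain N where N: "\<And>u. (\<And>v. N \<le> u v) \<Longrightarrow> \<exists>n. f u = enat n \<and> real n = mpol_eval p (\<lambda>v. real (u v))"
    using assms unfolding agrees_with_def by blast
  obtain N' where N': "\<And>u. (\<And>v. N' \<le> u v) \<Longrightarrow> \<exists>n. f u = enat n \<and> real n = mpol_eval q (\<lambda>v. real (u v))"
    using \<open>agrees_with f q\<close> unfolding agrees_with_def by blast
  have "q - p = 0"
  proof (rule mpol_zero_if_eventually_zero)
    fix u :: "'a \<Rightarrow> nat" assume u: "\<And>v. max N N' \<le> u v"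
    then show "mpol_eval (q - p) (\<lambda>v. real (u v)) = 0"
      using N [of u] N' [of u] by (auto simp: mpol_eval_diff)
  qed
  then show "q = p" by simp
qed (rule assms)

text \<open>Otherwise the leading term would dominate \<open>C t\<^sup>D\<close>, or make the values negative.\<close>

lemma degree_le_if_bounded:
  fixes q :: "real poly"
  assumes "\<And>t. N \<le> t \<Longrightarrow> 0 \<le> poly q (real t)" and "\<And>t. N \<le> t \<Longrightarrow> poly q (real t) \<le> C * real t ^ D"
  shows "degree q \<le> D"
proof (rule ccontr)
  assume "\<not> degree q \<le> D"
  then have d: "D < degree q" by simp
  have large: "\<exists>t\<ge>N. x \<le> real t" for x
    by (meson nat_le_linear order_trans of_nat_le_iff real_arch_simple)
  show False
  proof (cases "lead_coeff q > 0")
    case True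
    let ?r = "q - monom C D"
    have lt: "degree (monom C D) < degree q" using d degree_monom_le [of C D] by linarith
    have "degree ?r = degree q"
      using degree_add_eq_left [of "- monom C D" q] lt by simp
    then have "lead_coeff ?r = lead_coeff q"
      using lt d by (simp add: coeff_monom)
    then obtain x where x: "\<And>y. x \<le> y \<Longrightarrow> lead_coeff q \<le> poly ?r y"
      using poly_pinfty_gt_lc [of ?r] True by auto
    obtain t where "N \<le> t" "x \<le> real t" using large by blast
    then show False using x [of "real t"] assms(2) [of t] True by (simp add: poly_monom)
  next
    case False
    moreover have "q \<noteq> 0" using d by auto
    ultimately have l: "lead_coeff (- q) > 0" using leading_coeff_0_iff [of q] by (simp del: leading_coeff_0_iff)
    then obtain x where x: "\<And>y. x \<le> y \<Longrightarrow> lead_coeff (- q) \<le> poly (- q) y"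
      using poly_pinfty_gt_lc [of "- q"] by auto
    obtain t where "N \<le> t" "x \<le> real t" using large by blast
    then show False using x [of "real t"] assms(1) [of t] l by simp
  qed
qed

text \<open>On each ray \<open>t \<mapsto> t y\<close> with positive \<open>y\<close> the polynomial has one variable, whose coefficients are the
  values at \<open>y\<close> of the homogeneous parts of \<open>p\<close>. The part of a degree above \<open>D\<close> therefore vanishes at
  all positive integer points.\<close>

lemma mpol_degree_le_if_bounded:
  fixes p :: "'v::finite mpol"
  assumes "\<And>u. (\<And>v. N \<le> u v) \<Longrightarrow> 0 \<le> mpol_eval p (\<lambda>v. real (u v))"
    and "\<And>u. (\<And>v. N \<le> u v) \<Longrightarrow> mpol_eval p (\<lambda>v. real (u v)) \<le> C * real (multi_deg u) ^ D"
    and "a \<in> Poly_Mapping.keys p"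
  shows "multi_deg a \<le> D"
proof (rule ccontr)
  let ?K = "Poly_Mapping.keys p"
  assume "\<not> multi_deg a \<le> D"
  \<comment> \<open>The homogeneous part of \<open>p\<close> that contains the monomial \<open>a\<close>.\<close>
  define h where "h = (\<Sum>b\<in>{b\<in>?K. multi_deg b = multi_deg a}. Poly_Mapping.single b (Poly_Mapping.lookup p b))"
  have "h = 0"
  proof (rule mpol_zero_if_eventually_zero)
    fix y :: "'v \<Rightarrow> nat" assume y: "\<And>v. 1 \<le> y v"
    define q where "q = (\<Sum>b\<in>?K. monom (Poly_Mapping.lookup p b * (\<Prod>v\<in>UNIV. real (y v) ^ b v)) (multi_deg b))"
    have q: "poly q (real t) = mpol_eval p (\<lambda>v. real (t * y v))" for t
      unfolding q_def poly_sum poly_monom mpol_eval_def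
      by (intro sum.cong refl) (simp add: power_mult_distrib prod.distrib multi_deg_def power_sum)
    have big: "N \<le> t * y v" if "N \<le> t" for t v
      using mult_le_mono [OF that y [of v]] by simp
    have "degree q \<le> D"
    proof (rule degree_le_if_bounded)
      fix t assume t: "N \<le> t"
      show "0 \<le> poly q (real t)" unfolding q by (rule assms(1)) (rule big [OF t])
      have "poly q (real t) \<le> C * real (multi_deg (\<lambda>v. t * y v)) ^ D"
        unfolding q by (rule assms(2)) (rule big [OF t])
      also have "multi_deg (\<lambda>v. t * y v) = t * multi_deg y"
        by (simp add: multi_deg_def sum_distrib_left)
      finally show "poly q (real t) \<le> (C * real (multi_deg y) ^ D) * real t ^ D"
        by (simp add: power_mult_distrib mult.commute mult.left_commute)
    qed
    then have "coeff q (multi_deg a) = 0"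
      using \<open>\<not> multi_deg a \<le> D\<close> by (intro coeff_eq_0) linarith
    also have "coeff q (multi_deg a) = mpol_eval h (\<lambda>v. real (y v))"
      unfolding q_def h_def coeff_sum mpol_eval_sum mpol_eval_single
      by (rule sum.mono_neutral_cong_right) auto
    finally show "mpol_eval h (\<lambda>v. real (y v)) = 0" .
  qed
  then have "0 = Poly_Mapping.lookup h a" by simp
  also have "\<dots> = (\<Sum>b\<in>{b\<in>?K. multi_deg b = multi_deg a}. if b = a then Poly_Mapping.lookup p b else 0)"
    unfolding h_def lookup_sum by (intro sum.cong) (auto simp: lookup_single when_def)
  also have "\<dots> = Poly_Mapping.lookup p a" using assms(3) by simp
  finally show False using assms(3) by (simp add: in_keys_iff)
qed

text \<open>The polynomial \<open>p(u + e\<^sub>j) - p(u)\<close>, expanded into monomials. The additional variable \<open>None\<close>, which is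
  \<open>r\<close> in the directional Hilbert function, has exponent \<open>0\<close> throughout.\<close>

definition difference_mpol :: "'s::finite \<Rightarrow> 's mpol \<Rightarrow> 's option mpol"
  where "difference_mpol j p = (\<Sum>a\<in>Poly_Mapping.keys p. \<Sum>i<a j.
    Poly_Mapping.single (case_option 0 (a(j := i))) (Poly_Mapping.lookup p a * real (a j choose i)))"

lemma prod_option:
  fixes f :: "'s::finite option \<Rightarrow> real"
  shows "(\<Prod>v\<in>UNIV. f v) = f None * (\<Prod>l\<in>UNIV. f (Some l))"
  unfolding UNIV_option_conv by (subst prod.insert) (auto simp: prod.reindex)

lemma mpol_eval_difference_mpol:
  "mpol_eval (difference_mpol j p) x =
    mpol_eval p ((\<lambda>l. x (Some l))(j := x (Some j) + 1)) - mpol_eval p (\<lambda>l. x (Some l))"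
proof -
  let ?y = "\<lambda>l. x (Some l)"
  have "(\<Sum>i<a j. real (a j choose i) * (\<Prod>v\<in>UNIV. x v ^ (case_option 0 (a(j := i)) v)))
      = (\<Prod>l\<in>UNIV. (?y(j := x (Some j) + 1)) l ^ a l) - (\<Prod>l\<in>UNIV. ?y l ^ a l)" for a
  proof -
    let ?r = "\<Prod>l\<in>UNIV - {j}. ?y l ^ a l"
    have 1: "(\<Prod>v\<in>UNIV. x v ^ (case_option 0 (a(j := i)) v)) = ?y j ^ i * ?r" for i
    proof -
      have "(\<Prod>l\<in>UNIV. ?y l ^ (a(j := i)) l) = ?y j ^ i * ?r"
        by (subst prod.remove [of UNIV j]) (auto intro!: prod.cong)
      then show ?thesis unfolding prod_option by simp
    qed
    have 2: "(\<Prod>l\<in>UNIV. (?y(j := x (Some j) + 1)) l ^ a l) = (?y j + 1) ^ a j * ?r"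
      by (subst prod.remove [of UNIV j]) (auto intro!: prod.cong)
    have 3: "(\<Prod>l\<in>UNIV. ?y l ^ a l) = ?y j ^ a j * ?r"
      by (subst prod.remove [of UNIV j]) auto
    have "(?y j + 1) ^ a j = (\<Sum>i\<le>a j. real (a j choose i) * ?y j ^ i)"
      by (subst binomial_ring) simp
    also have "\<dots> = (\<Sum>i<a j. real (a j choose i) * ?y j ^ i) + ?y j ^ a j"
      by (simp add: lessThan_Suc_atMost [symmetric])
    finally have 4: "(\<Sum>i<a j. real (a j choose i) * ?y j ^ i) = (?y j + 1) ^ a j - ?y j ^ a j" by simp
    have "(\<Sum>i<a j. real (a j choose i) * (?y j ^ i * ?r)) = (\<Sum>i<a j. real (a j choose i) * ?y j ^ i) * ?r"
      by (simp add: sum_distrib_right mult.assoc)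
    then show ?thesis unfolding 1 2 3 by (simp only: 4 left_diff_distrib)
  qed
  then show ?thesis
    unfolding difference_mpol_def mpol_eval_sum mpol_eval_single
    by (simp add: mpol_eval_def sum_subtractf [symmetric] right_diff_distrib [symmetric]
        sum_distrib_left [symmetric] mult.assoc)
qed

lemma lookup_difference_mpol:
  "Poly_Mapping.lookup (difference_mpol j p) (case_option k b) =
    (\<Sum>a\<in>Poly_Mapping.keys p. \<Sum>i<a j.
      if k = 0 \<and> a(j := i) = b then Poly_Mapping.lookup p a * real (a j choose i) else 0)"
proof -
  have "case_option 0 (a(j := i)) = case_option k b \<longleftrightarrow> k = 0 \<and> a(j := i) = b" for a i
    by (metis (no_types, opaque_lifting) ext option.case)
  then show ?thesis
    unfolding difference_mpol_def lookup_sum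
    by (intro sum.cong refl) (auto simp: lookup_single when_def)
qed

text \<open>Another monomial \<open>a\<close> that produced the same monomial would agree with \<open>d\<close> away from \<open>j\<close> and satisfy
  \<open>a\<^sub>j > d\<^sub>j\<close>; the bound on the degrees excludes it.\<close>

lemma lookup_difference_mpol_top:
  assumes deg: "\<And>a. a \<in> Poly_Mapping.keys p \<Longrightarrow> multi_deg a \<le> multi_deg d" and "d j > 0"
  shows "Poly_Mapping.lookup (difference_mpol j p) (case_option 0 (d(j := d j - 1)))
    = real (d j) * Poly_Mapping.lookup p d"
proof -
  have "(\<Sum>i<a j. if a(j := i) = d(j := d j - 1) then Poly_Mapping.lookup p a * real (a j choose i) else 0)
      = (if a = d then real (d j) * Poly_Mapping.lookup p d else 0)" if "a \<in> Poly_Mapping.keys p" for a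
  proof (cases "a = d")
    case True
    have "d(j := i) = d(j := d j - 1) \<longleftrightarrow> i = d j - 1" for i
      by (metis fun_upd_same)
    moreover have "d j choose (d j - 1) = d j"
      using \<open>d j > 0\<close> by (metis Suc_diff_1 binomial_Suc_n)
    ultimately show ?thesis using True \<open>d j > 0\<close> by simp
  next
    case False
    have "a(j := i) \<noteq> d(j := d j - 1)" if "i < a j" for i
    proof
      assume e: "a(j := i) = d(j := d j - 1)"
      then have i: "i = d j - 1" by (metis fun_upd_same)
      have o: "a l = d l" if "l \<noteq> j" for l using e that by (metis fun_upd_other)
      have "a j \<noteq> d j" using o False by (metis ext)
      then have "d j < a j" using i \<open>i < a j\<close> \<open>d j > 0\<close> by linarith
      moreover have "multi_deg a = a j + (\<Sum>l\<in>UNIV - {j}. d l)"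
        unfolding multi_deg_def using o by (subst sum.remove [of UNIV j]) auto
      moreover have "multi_deg d = d j + (\<Sum>l\<in>UNIV - {j}. d l)"
        unfolding multi_deg_def by (subst sum.remove [of UNIV j]) auto
      ultimately show False using deg [OF \<open>a \<in> Poly_Mapping.keys p\<close>] by linarith
    qed
    then show ?thesis using False by (intro trans [OF sum.neutral]) auto
  qed
  then show ?thesis
    unfolding lookup_difference_mpol by (simp add: in_keys_iff)
qed

section \<open>Monotone families and chains\<close>

abbreviation (in cring) (input) ideal_power :: "'a set \<Rightarrow> nat \<Rightarrow> 'a set" (infixr "\<up>" 75)
  where "I \<up> k \<equiv> I [^]\<^bsub>ideals_set R\<^esub> k"

text \<open>A form of Dickson's lemma. Along the diagonal the chain condition makes \<open>L\<close> constant from some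
  \<open>t\<^sub>0\<close> on, and then it is constant on all \<open>a\<close> with all coordinates in \<open>S\<close> at least \<open>t\<^sub>0\<close>. Any other \<open>a\<close>
  has one of finitely many coordinate values below \<open>t\<^sub>0\<close>, which can be frozen to reduce \<open>S\<close>.\<close>

lemma monotone_family_threshold:
  fixes L :: "('i \<Rightarrow> nat) \<Rightarrow> 'x set"
  assumes "finite S"
    and "\<And>a b. a \<le> b \<Longrightarrow> L a \<subseteq> L b"
    and "\<And>f::nat \<Rightarrow> 'i \<Rightarrow> nat. mono f \<Longrightarrow> \<exists>k0. \<forall>k\<ge>k0. L (f k) = L (f k0)"
    and "\<And>a. L (\<lambda>i. if i \<in> S then a i else 0) = L a"
  shows "\<exists>t. \<forall>a. L a = L (\<lambda>i. min (a i) t)"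
  using assms
proof (induction S arbitrary: L rule: finite_psubset_induct)
  case (psubset S)
  note mono = psubset.prems(1) and acc = psubset.prems(2) and dep = psubset.prems(3)
  have "mono (\<lambda>k::nat. \<lambda>_::'i. k)" by (auto simp: mono_def le_fun_def)
  from acc [OF this] obtain t0 where t0: "\<And>k. t0 \<le> k \<Longrightarrow> L (\<lambda>_. k) = L (\<lambda>_. t0)" by blast
  have "\<exists>t. \<forall>a. L (a(i := v)) = L ((\<lambda>i. min (a i) t)(i := v))" if "i \<in> S" for i v
  proof (rule psubset.IH)
    show "S - {i} \<subset> S" using that by blast
    show "L (a(i := v)) \<subseteq> L (b(i := v))" if "a \<le> b" for a b
      by (rule mono) (use that in \<open>auto simp: le_fun_def\<close>)
    show "\<exists>k0. \<forall>k\<ge>k0. L ((f k)(i := v)) = L ((f k0)(i := v))" if "mono f" for f :: "nat \<Rightarrow> 'i \<Rightarrow> nat"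
      by (rule acc) (use that in \<open>simp add: monotone_def le_fun_def\<close>)
    show "L ((\<lambda>j. if j \<in> S - {i} then a j else 0)(i := v)) = L (a(i := v))" for a
    proof -
      have "(\<lambda>k. if k \<in> S then ((\<lambda>j. if j \<in> S - {i} then a j else 0)(i := v)) k else 0)
          = (\<lambda>k. if k \<in> S then (a(i := v)) k else 0)" by auto
      from arg_cong [OF this, of L] show ?thesis unfolding dep .
    qed
  qed
  then obtain t where t: "\<And>i v a. i \<in> S \<Longrightarrow> L (a(i := v)) = L ((\<lambda>j. min (a j) (t i v))(i := v))"
    by metis
  \<comment> \<open>One threshold for the diagonal and for all the finitely many frozen coordinates.\<close>
  define T where "T = Max (insert t0 ((\<lambda>(i, v). t i v) ` (S \<times> {..<t0})))"
  have T0: "t0 \<le> T" and T: "\<And>i v. i \<in> S \<Longrightarrow> v < t0 \<Longrightarrow> t i v \<le> T"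
    unfolding T_def using \<open>finite S\<close> by (auto intro!: Max_ge image_eqI [of _ _ "(i, v)" for i v])
  have "L a = L (\<lambda>i. min (a i) T)" for a
  proof
    show "L (\<lambda>i. min (a i) T) \<subseteq> L a" by (rule mono) (auto simp: le_fun_def)
    show "L a \<subseteq> L (\<lambda>i. min (a i) T)"
    proof (cases "\<exists>i\<in>S. a i < t0")
      case True
      then obtain i where i: "i \<in> S" "a i < t0" by blast
      have "L a = L ((\<lambda>j. min (a j) (t i (a i)))(i := a i))"
        using t [OF i(1), of a "a i"] by simp
      also have "\<dots> \<subseteq> L (\<lambda>i. min (a i) T)"
        using i T0 T [OF i] by (intro mono) (auto simp: le_fun_def)
      finally show ?thesis .
    next
      case False
      define k where "k = Max (insert t0 (a ` S))"
      have "L a = L (\<lambda>i. if i \<in> S then a i else 0)" by (simp add: dep)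
      also have "\<dots> \<subseteq> L (\<lambda>_. k)"
        using \<open>finite S\<close> by (intro mono) (auto simp: le_fun_def k_def)
      also have "L (\<lambda>_. k) = L (\<lambda>_. t0)"
        using \<open>finite S\<close> by (intro t0) (simp add: k_def)
      also have "\<dots> = L (\<lambda>i. if i \<in> S then t0 else 0)" by (simp add: dep)
      also have "\<dots> \<subseteq> L (\<lambda>i. min (a i) T)"
        using False T0 by (intro mono) (auto simp: le_fun_def not_less)
      finally show ?thesis .
    qed
  qed
  then show ?case by blast
qed

text \<open>Chains can be shortened, so the set of lengths of chains is an initial segment, and its supremum
  is a maximum unless it is infinite.\<close>

lemma enat_le_chain_sup_iff:
  assumes "P X"
  shows "enat n \<le> chain_sup P \<longleftrightarrow> (\<exists>C. (\<forall>i\<le>n. P (C i)) \<and> (\<forall>i<n. C i \<subset> C (Suc i)))"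
    (is "_ \<longleftrightarrow> ?c n")
proof
  assume n: "enat n \<le> chain_sup P"
  show "?c n"
  proof (rule ccontr)
    assume no: "\<not> ?c n"
    have lt: "m < n" if m: "?c m" for m
    proof (rule ccontr)
      assume "\<not> m < n"
      obtain C where C: "\<forall>i\<le>m. P (C i)" "\<forall>i<m. C i \<subset> C (Suc i)" using m by blast
      have "?c n" using C \<open>\<not> m < n\<close> by (intro exI [of _ C]) auto
      then show False using no by blast
    qed
    have short: "m \<le> n - 1" if "?c m" for m using lt [OF that] by simp
    have le: "chain_sup P \<le> enat (n - 1)"
      unfolding chain_sup_def
    proof (rule Sup_least)
      fix x assume "x \<in> {enat n |n. ?c n}"
      then obtain m where "x = enat m" "?c m" by blast
      then show "x \<le> enat (n - 1)" using short [of m] by simp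
    qed
    have "?c 0" using assms by (intro exI [of _ "\<lambda>_. X"]) auto
    then have "n \<noteq> 0" using no by metis
    then have "enat (n - 1) < enat n" by simp
    then show False using n le by (meson leD order_trans)
  qed
next
  assume "?c n"
  then show "enat n \<le> chain_sup P" unfolding chain_sup_def by (intro Sup_upper) blast
qed

lemma enat_leI:
  assumes "\<And>n. enat n \<le> x \<Longrightarrow> enat n \<le> y"
  shows "x \<le> y"
proof (cases x)
  case (enat n)
  then show ?thesis using assms by simp
next
  case infinity
  have "y = \<infinity>"
  proof (rule ccontr)
    assume "y \<noteq> \<infinity>"
    then obtain m where "y = enat m" by auto
    then show False using assms [of "Suc m"] infinity by simp
  qed
  then show ?thesis by simp
qed

lemma chain_sup_leI:
  assumes "\<And>n C. (\<And>i. i \<le> n \<Longrightarrow> P (C i)) \<Longrightarrow> (\<And>i. i < n \<Longrightarrow> C i \<subset> C (Suc i)) \<Longrightarrow> enat n \<le> x"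
  shows "chain_sup P \<le> x"
  unfolding chain_sup_def using assms by (intro Sup_least) auto

lemma chain_sup_mono_map:
  assumes "\<And>N. P N \<Longrightarrow> Q (f N)" and "\<And>N N'. P N \<Longrightarrow> P N' \<Longrightarrow> N \<subset> N' \<Longrightarrow> f N \<subset> f N'"
  shows "chain_sup P \<le> chain_sup Q"
proof (rule chain_sup_leI)
  fix n C assume C: "\<And>i. i \<le> n \<Longrightarrow> P (C i)" "\<And>i. i < n \<Longrightarrow> C i \<subset> C (Suc i)"
  have "Q (f (C 0))" using C assms by simp
  then show "enat n \<le> chain_sup Q"
    unfolding enat_le_chain_sup_iff [of Q "f (C 0)", OF \<open>Q (f (C 0))\<close>]
    using C assms by (intro exI [of _ "\<lambda>i. f (C i)"]) auto
qed

section \<open>Submodules and lengths\<close>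

context module
begin

abbreviation (input) module_add (infixl "\<oplus>\<^sub>M" 65) where "x \<oplus>\<^sub>M y \<equiv> x \<oplus>\<^bsub>M\<^esub> y"
abbreviation (input) module_diff (infixl "\<ominus>\<^sub>M" 65) where "x \<ominus>\<^sub>M y \<equiv> x \<ominus>\<^bsub>M\<^esub> y"
abbreviation (input) module_neg ("\<ominus>\<^sub>M _" [81] 80) where "\<ominus>\<^sub>M x \<equiv> \<ominus>\<^bsub>M\<^esub> x"
abbreviation (input) module_zero ("\<zero>\<^sub>M") where "\<zero>\<^sub>M \<equiv> \<zero>\<^bsub>M\<^esub>"
abbreviation (input) module_smult (infixl "\<odot>\<^sub>M" 70) where "a \<odot>\<^sub>M x \<equiv> a \<odot>\<^bsub>M\<^esub> x"
abbreviation (input) module_sum (infixl "<+>\<^sub>M" 60) where "A <+>\<^sub>M B \<equiv> A <+>\<^bsub>M\<^esub> B"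

lemma submodule_abelian_subgroup: "submodule N R M \<Longrightarrow> abelian_subgroup N M"
  by (intro abelian_subgroupI3 additive_subgroup.intro submodule.axioms(1) M.abelian_group_axioms)

lemma submodule_subset: "submodule N R M \<Longrightarrow> N \<subseteq> carrier M"
  using submoduleE(1) .

lemma submodule_zero: "submodule N R M \<Longrightarrow> \<zero>\<^sub>M \<in> N"
  using subgroup.one_closed [OF submodule.axioms(1)] by simp

lemma submodule_minus:
  assumes "submodule N R M" "x \<in> N" "y \<in> N"
  shows "x \<ominus>\<^sub>M y \<in> N"
  using assms submoduleE(3,5) [OF assms(1)] by (simp add: a_minus_def)

lemma submodule_criterion:
  assumes N: "N \<subseteq> carrier M" and "\<zero>\<^sub>M \<in> N"
    and closed: "\<And>a x y. a \<in> carrier R \<Longrightarrow> x \<in> N \<Longrightarrow> y \<in> N \<Longrightarrow> a \<odot>\<^sub>M x \<oplus>\<^sub>M y \<in> N"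
  shows "submodule N R M"
proof (rule submoduleI)
  have smult: "a \<odot>\<^sub>M x \<in> N" if "a \<in> carrier R" "x \<in> N" for a x
    using closed [OF that assms(2)] that N by auto
  show "\<ominus>\<^sub>M x \<in> N" if "x \<in> N" for x
    using smult [of "\<ominus> \<one>" x] that N by (auto simp: smult_l_minus)
  show "x \<oplus>\<^sub>M y \<in> N" if "x \<in> N" "y \<in> N" for x y
    using closed [of \<one> x y] that N by auto
  show "a \<odot>\<^sub>M x \<in> N" if "a \<in> carrier R" "x \<in> N" for a x
    using that by (rule smult)
qed fact+

lemma submodule_closed:
  assumes N: "submodule N R M" and "a \<in> carrier R" "x \<in> N" "y \<in> N"
  shows "a \<odot>\<^sub>M x \<oplus>\<^sub>M y \<in> N"
  using assms submoduleE(4,5) [OF N] by blast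

lemma submodule_Inter:
  assumes "\<And>N. N \<in> A \<Longrightarrow> submodule N R M" and "A \<noteq> {}"
  shows "submodule (\<Inter>A) R M"
proof (rule submodule_criterion)
  show "\<Inter>A \<subseteq> carrier M" using assms submodule_subset by blast
  show "\<zero>\<^sub>M \<in> \<Inter>A" using assms(1) submodule_zero by auto
  show "a \<odot>\<^sub>M x \<oplus>\<^sub>M y \<in> \<Inter>A" if "a \<in> carrier R" "x \<in> \<Inter>A" "y \<in> \<Inter>A" for a x y
    using that assms(1) submodule_closed by auto
qed

lemma submodule_Int:
  assumes "submodule A R M" "submodule B R M"
  shows "submodule (A \<inter> B) R M"
  using submodule_Inter [of "{A, B}"] assms by auto

lemma submodule_module_span:
  assumes "S \<subseteq> carrier M"
  shows "submodule (module_span R M S) R M"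
  unfolding module_span_def using assms carrier_is_submodule by (intro submodule_Inter) auto

lemma module_span_self: "S \<subseteq> module_span R M S"
  unfolding module_span_def by blast

lemma module_span_least:
  assumes "submodule N R M" "S \<subseteq> N"
  shows "module_span R M S \<subseteq> N"
  unfolding module_span_def using assms by blast

lemma mem_set_add_iff: "x \<in> A <+>\<^sub>M B \<longleftrightarrow> (\<exists>a\<in>A. \<exists>b\<in>B. x = a \<oplus>\<^sub>M b)"
  unfolding set_add_def' by auto

lemma mem_set_addI: "a \<in> A \<Longrightarrow> b \<in> B \<Longrightarrow> a \<oplus>\<^sub>M b \<in> A <+>\<^sub>M B"
  unfolding set_add_def' by blast

lemma mem_set_addE:
  assumes "x \<in> A <+>\<^sub>M B"
  obtains a b where "a \<in> A" "b \<in> B" "x = a \<oplus>\<^sub>M b"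
  using assms unfolding mem_set_add_iff by blast

lemma submodule_mem_carrier: "submodule N R M \<Longrightarrow> x \<in> N \<Longrightarrow> x \<in> carrier M"
  using submodule_subset by blast

lemma set_add_upper:
  assumes A: "submodule A R M" and B: "submodule B R M"
  shows "A \<subseteq> A <+>\<^sub>M B" and "B \<subseteq> A <+>\<^sub>M B"
proof -
  show "A \<subseteq> A <+>\<^sub>M B"
  proof
    fix x assume x: "x \<in> A"
    have "x \<oplus>\<^sub>M \<zero>\<^sub>M \<in> A <+>\<^sub>M B" using x submodule_zero [OF B] by (rule mem_set_addI)
    then show "x \<in> A <+>\<^sub>M B" using submodule_mem_carrier [OF A x] by simp
  qed
  show "B \<subseteq> A <+>\<^sub>M B"
  proof
    fix x assume x: "x \<in> B"
    have "\<zero>\<^sub>M \<oplus>\<^sub>M x \<in> A <+>\<^sub>M B" using submodule_zero [OF A] x by (rule mem_set_addI)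
    then show "x \<in> A <+>\<^sub>M B" using submodule_mem_carrier [OF B x] by simp
  qed
qed

lemma submodule_set_add:
  assumes A: "submodule A R M" and B: "submodule B R M"
  shows "submodule (A <+>\<^sub>M B) R M"
proof (rule submodule_criterion)
  note cA = submodule_mem_carrier [OF A] and cB = submodule_mem_carrier [OF B]
  show "A <+>\<^sub>M B \<subseteq> carrier M"
  proof
    fix x assume "x \<in> A <+>\<^sub>M B"
    then show "x \<in> carrier M" by (rule mem_set_addE) (simp add: cA cB)
  qed
  show "\<zero>\<^sub>M \<in> A <+>\<^sub>M B"
    using set_add_upper(1) [OF A B] submodule_zero [OF A] by blast
  fix r x y assume r: "r \<in> carrier R" and x: "x \<in> A <+>\<^sub>M B" and y: "y \<in> A <+>\<^sub>M B"
  obtain a b where 1: "a \<in> A" "b \<in> B" "x = a \<oplus>\<^sub>M b" using x by (rule mem_set_addE)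
  obtain c d where 2: "c \<in> A" "d \<in> B" "y = c \<oplus>\<^sub>M d" using y by (rule mem_set_addE)
  have "a \<in> carrier M" "b \<in> carrier M" "c \<in> carrier M" "d \<in> carrier M" using 1 2 cA cB by auto
  then have "r \<odot>\<^sub>M x \<oplus>\<^sub>M y = (r \<odot>\<^sub>M a \<oplus>\<^sub>M c) \<oplus>\<^sub>M (r \<odot>\<^sub>M b \<oplus>\<^sub>M d)"
    using 1 2 r by (simp add: smult_r_distr M.a_ac)
  then show "r \<odot>\<^sub>M x \<oplus>\<^sub>M y \<in> A <+>\<^sub>M B"
    using 1 2 r submodule_closed [OF A] submodule_closed [OF B] by (simp add: mem_set_addI)
qed

lemma set_add_mono: "A \<subseteq> A' \<Longrightarrow> B \<subseteq> B' \<Longrightarrow> A <+>\<^sub>M B \<subseteq> A' <+>\<^sub>M B'"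
  unfolding subset_iff mem_set_add_iff by blast

lemma set_add_least:
  assumes C: "submodule C R M" and "A \<subseteq> C" "B \<subseteq> C"
  shows "A <+>\<^sub>M B \<subseteq> C"
  using assms submoduleE(5) [OF C] by (auto simp: mem_set_add_iff subset_eq)

lemma module_span_Un:
  assumes S: "S \<subseteq> carrier M" and T: "T \<subseteq> carrier M"
  shows "module_span R M (S \<union> T) = module_span R M S <+>\<^sub>M module_span R M T"
proof
  note s = submodule_module_span [OF S] submodule_module_span [OF T]
  show "module_span R M (S \<union> T) \<subseteq> module_span R M S <+>\<^sub>M module_span R M T"
    using set_add_upper [OF s] module_span_self [of S] module_span_self [of T]
    by (intro module_span_least submodule_set_add s) auto
  show "module_span R M S <+>\<^sub>M module_span R M T \<subseteq> module_span R M (S \<union> T)"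
    using S T module_span_self [of "S \<union> T"]
    by (intro set_add_least submodule_module_span module_span_least) auto
qed

lemma module_span_mono: "S \<subseteq> T \<Longrightarrow> module_span R M S \<subseteq> module_span R M T"
  unfolding module_span_def by blast

lemma submodule_scaled:
  assumes r: "r \<in> carrier R" and N: "submodule N R M"
  shows "submodule ((\<lambda>m. r \<odot>\<^sub>M m) ` N) R M"
proof (rule submodule_criterion)
  let ?S = "(\<lambda>m. r \<odot>\<^sub>M m) ` N"
  show "?S \<subseteq> carrier M" using r submodule_subset [OF N] by auto
  show "\<zero>\<^sub>M \<in> ?S"
    using r submodule_zero [OF N] by (metis image_eqI smult_r_null)
  fix t x y assume t: "t \<in> carrier R" and "x \<in> ?S" "y \<in> ?S"
  then obtain a b where ab: "a \<in> N" "b \<in> N" "x = r \<odot>\<^sub>M a" "y = r \<odot>\<^sub>M b" by blast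
  have c: "a \<in> carrier M" "b \<in> carrier M" using ab submodule_mem_carrier [OF N] by auto
  have "t \<odot>\<^sub>M x \<oplus>\<^sub>M y = r \<odot>\<^sub>M (t \<odot>\<^sub>M a \<oplus>\<^sub>M b)"
    using ab c r t smult_assoc1 [of t r a] smult_assoc1 [of r t a] R.m_comm [of t r] by (simp add: smult_r_distr)
  then show "t \<odot>\<^sub>M x \<oplus>\<^sub>M y \<in> ?S" using submodule_closed [OF N t ab(1,2)] by blast
qed

lemma submodule_colon_elements:
  assumes r: "r \<in> carrier R" and W: "submodule W R M" and N: "submodule N R M"
  shows "submodule {m \<in> N. r \<odot>\<^sub>M m \<in> W} R M"
proof (rule submodule_criterion)
  let ?S = "{m \<in> N. r \<odot>\<^sub>M m \<in> W}"
  show "?S \<subseteq> carrier M" using submodule_subset [OF N] by auto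
  show "\<zero>\<^sub>M \<in> ?S" using r submodule_zero [OF N] submodule_zero [OF W] by simp
  fix t x y assume t: "t \<in> carrier R" and x: "x \<in> ?S" and y: "y \<in> ?S"
  have c: "x \<in> carrier M" "y \<in> carrier M" using x y submodule_mem_carrier [OF N] by auto
  have "r \<odot>\<^sub>M (t \<odot>\<^sub>M x \<oplus>\<^sub>M y) = t \<odot>\<^sub>M (r \<odot>\<^sub>M x) \<oplus>\<^sub>M r \<odot>\<^sub>M y"
    using c r t smult_assoc1 [of t r x] smult_assoc1 [of r t x] R.m_comm [of t r] by (simp add: smult_r_distr)
  then show "t \<odot>\<^sub>M x \<oplus>\<^sub>M y \<in> ?S" using x y t submodule_closed [OF N] submodule_closed [OF W] by simp
qed

text \<open>The inclusion \<open>I N \<subseteq> W\<close> can thus be tested on generators of the ideal \<open>I\<close>.\<close>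

lemma ideal_colon:
  assumes W: "submodule W R M" and N: "N \<subseteq> carrier M"
  shows "ideal {r \<in> carrier R. \<forall>m\<in>N. r \<odot>\<^sub>M m \<in> W} R" (is "ideal ?I R")
proof (rule idealI)
  show "ring R" by (rule R.ring_axioms)
  show "subgroup ?I (add_monoid R)"
  proof (rule R.add.subgroupI)
    show "?I \<noteq> {}" using N submodule_zero [OF W] by (auto intro!: exI [of _ \<zero>] simp: subset_eq)
    show "\<ominus> a \<in> ?I" if "a \<in> ?I" for a
      using that N submoduleE(3) [OF W] by (auto simp: smult_l_minus subset_eq)
    show "a \<oplus> b \<in> ?I" if "a \<in> ?I" "b \<in> ?I" for a b
      using that N submoduleE(5) [OF W] by (auto simp: smult_l_distr subset_eq)
  qed auto
  show *: "x \<otimes> a \<in> ?I" if "a \<in> ?I" "x \<in> carrier R" for a x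
    using that N submoduleE(4) [OF W] by (auto simp: smult_assoc1 subset_eq)
  show "a \<otimes> x \<in> ?I" if "a \<in> ?I" "x \<in> carrier R" for a x
    using * [OF that] that by (simp add: R.m_comm)
qed

text \<open>The length of \<open>A/B\<close>, read off from the submodules of \<open>M\<close> between \<open>B\<close> and \<open>A\<close>, so that lengths of
  different subquotients of \<open>M\<close> are compared without forming quotient modules.\<close>

definition seg_length :: "'c set \<Rightarrow> 'c set \<Rightarrow> enat"
  where "seg_length A B = chain_sup (\<lambda>N. submodule N R M \<and> B \<subseteq> N \<and> N \<subseteq> A)"

lemma enat_le_seg_length_iff:
  assumes "submodule B R M" and "B \<subseteq> A"
  shows "enat n \<le> seg_length A B \<longleftrightarrow>
    (\<exists>C. (\<forall>i\<le>n. submodule (C i) R M \<and> B \<subseteq> C i \<and> C i \<subseteq> A) \<and> (\<forall>i<n. C i \<subset> C (Suc i)))"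
  unfolding seg_length_def by (rule enat_le_chain_sup_iff [of _ B]) (use assms in auto)

lemma seg_chainE:
  assumes "enat n \<le> seg_length A B" "submodule B R M" "B \<subseteq> A"
  obtains C where "\<And>i. i \<le> n \<Longrightarrow> submodule (C i) R M" "\<And>i. i \<le> n \<Longrightarrow> B \<subseteq> C i"
    "\<And>i. i \<le> n \<Longrightarrow> C i \<subseteq> A" "\<And>i. i < n \<Longrightarrow> C i \<subset> C (Suc i)"
  using assms(1) unfolding enat_le_seg_length_iff [OF assms(2,3)] by metis

lemma seg_chainI:
  assumes "submodule B R M" "B \<subseteq> A"
    and "\<And>i. i \<le> n \<Longrightarrow> submodule (C i) R M" "\<And>i. i \<le> n \<Longrightarrow> B \<subseteq> C i"
    "\<And>i. i \<le> n \<Longrightarrow> C i \<subseteq> A" "\<And>i. i < n \<Longrightarrow> C i \<subset> C (Suc i)"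
  shows "enat n \<le> seg_length A B"
  unfolding enat_le_seg_length_iff [OF assms(1,2)] using assms(3-6) by blast

lemma seg_length_mono:
  assumes "B' \<subseteq> B" "A \<subseteq> A'"
  shows "seg_length A B \<le> seg_length A' B'"
  unfolding seg_length_def
  by (rule chain_sup_mono_map [of _ _ "\<lambda>N. N"]) (use assms in auto)

lemma seg_length_strict:
  assumes "submodule B R M" "submodule A' R M" "B \<subseteq> A" "A \<subset> A'"
  shows "seg_length A B + 1 \<le> seg_length A' B"
proof (rule enat_leI)
  fix n assume n: "enat n \<le> seg_length A B + 1"
  show "enat n \<le> seg_length A' B"
  proof (cases n)
    case 0
    then show ?thesis by (simp add: zero_enat_def [symmetric])
  next
    case (Suc k)
    have "enat k + 1 \<le> seg_length A B + 1" using n Suc by (simp add: one_enat_def)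
    then have "enat k \<le> seg_length A B" by simp
    then obtain C where C: "\<And>i. i \<le> k \<Longrightarrow> submodule (C i) R M" "\<And>i. i \<le> k \<Longrightarrow> B \<subseteq> C i"
        "\<And>i. i \<le> k \<Longrightarrow> C i \<subseteq> A" "\<And>i. i < k \<Longrightarrow> C i \<subset> C (Suc i)"
      using assms(1,3) by (metis seg_chainE)
    show ?thesis
    proof (rule seg_chainI [of _ _ _ "C(n := A')"])
      show "B \<subseteq> A'" using assms by auto
      show "submodule ((C(n := A')) i) R M" if "i \<le> n" for i using C(1) [of i] assms Suc that by auto
      show "B \<subseteq> (C(n := A')) i" if "i \<le> n" for i using C(2) [of i] \<open>B \<subseteq> A'\<close> Suc that by auto
      show "(C(n := A')) i \<subseteq> A'" if "i \<le> n" for i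
        using C(3) [of i] \<open>A \<subset> A'\<close> Suc that by (cases "i = n") auto
      fix i assume "i < n"
      show "(C(n := A')) i \<subset> (C(n := A')) (Suc i)"
      proof (cases "Suc i = n")
        case True
        then show ?thesis using C(3) [of i] Suc assms by auto
      next
        case False
        then show ?thesis using C(4) [of i] Suc \<open>i < n\<close> by auto
      qed
    qed (rule assms)
  qed
qed

text \<open>At a strict inclusion \<open>E \<subset> F\<close> in a chain, one of the inclusions \<open>E \<inter> B \<subseteq> F \<inter> B\<close> and
  \<open>E + B \<subseteq> F + B\<close> is strict, by the modular law. A chain from \<open>C\<close> to \<open>A\<close> thus distributes its
  steps over the two segments.\<close>

lemma seg_length_add_le:
  assumes A: "submodule A R M" and B: "submodule B R M" and C: "submodule C R M"
    and "C \<subseteq> B" "B \<subseteq> A"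
  shows "seg_length A C \<le> seg_length A B + seg_length B C"
proof (rule enat_leI)
  fix n assume "enat n \<le> seg_length A C"
  moreover have "C \<subseteq> A" using assms by blast
  ultimately obtain E where E: "\<And>i. i \<le> n \<Longrightarrow> submodule (E i) R M" "\<And>i. i \<le> n \<Longrightarrow> C \<subseteq> E i"
      "\<And>i. i \<le> n \<Longrightarrow> E i \<subseteq> A" "\<And>i. i < n \<Longrightarrow> E i \<subset> E (Suc i)"
    using C by (metis seg_chainE)
  have "enat i \<le> seg_length (E i <+>\<^sub>M B) B + seg_length (E i \<inter> B) C" if "i \<le> n" for i
    using that
  proof (induction i)
    case 0
    then show ?case by (simp add: zero_enat_def [symmetric])
  next
    case (Suc i)
    let ?E = "E i" and ?F = "E (Suc i)"
    have e: "submodule ?E R M" "submodule ?F R M" "?E \<subset> ?F" "C \<subseteq> ?E"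
      using E Suc.prems by simp_all
    have 1: "?E \<inter> B \<subseteq> ?F \<inter> B" using e(3) by blast
    have 2: "?E <+>\<^sub>M B \<subseteq> ?F <+>\<^sub>M B"
      using e(3) by (intro set_add_mono) auto
    note sub = submodule_set_add [OF e(1) B] submodule_set_add [OF e(2) B]
      submodule_Int [OF e(1) B] submodule_Int [OF e(2) B] set_add_upper(2) [OF e(1) B]
    have "?E \<inter> B \<subset> ?F \<inter> B \<or> ?E <+>\<^sub>M B \<subset> ?F <+>\<^sub>M B"
    proof (rule ccontr)
      assume "\<not> ?thesis"
      then have eq: "?E \<inter> B = ?F \<inter> B" "?E <+>\<^sub>M B = ?F <+>\<^sub>M B" using 1 2 by auto
      obtain x where x: "x \<in> ?F" "x \<notin> ?E" using e by blast
      have "x \<in> ?E <+>\<^sub>M B" using x eq set_add_upper(1) [OF e(2) B] by blast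
      then obtain y b where yb: "y \<in> ?E" "b \<in> B" "x = y \<oplus>\<^sub>M b" by (rule mem_set_addE)
      have c: "y \<in> carrier M" "b \<in> carrier M" using yb submodule_subset [OF e(1)] submodule_subset [OF B] by auto
      have "b = x \<ominus>\<^sub>M y" using c yb(3) M.add.m_comm [of y b] by (simp add: a_minus_def M.a_assoc M.r_neg)
      then have "b \<in> ?F" using x yb e submodule_minus by blast
      then have "b \<in> ?E" using yb eq by blast
      then show False using x yb submoduleE(5) [OF e(1)] by blast
    qed
    then have "seg_length (?E <+>\<^sub>M B) B + seg_length (?E \<inter> B) C + 1
        \<le> seg_length (?F <+>\<^sub>M B) B + seg_length (?F \<inter> B) C"
    proof
      assume "?E \<inter> B \<subset> ?F \<inter> B"
      then have "seg_length (?E \<inter> B) C + 1 \<le> seg_length (?F \<inter> B) C"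
        using e assms sub by (intro seg_length_strict) auto
      moreover have "seg_length (?E <+>\<^sub>M B) B \<le> seg_length (?F <+>\<^sub>M B) B"
        using 2 by (intro seg_length_mono) auto
      ultimately show ?thesis by (simp add: add.assoc add_mono)
    next
      assume "?E <+>\<^sub>M B \<subset> ?F <+>\<^sub>M B"
      then have "seg_length (?E <+>\<^sub>M B) B + 1 \<le> seg_length (?F <+>\<^sub>M B) B"
        using B sub by (intro seg_length_strict) auto
      moreover have "seg_length (?E \<inter> B) C \<le> seg_length (?F \<inter> B) C"
        using 1 by (intro seg_length_mono) auto
      ultimately have "(seg_length (?E <+>\<^sub>M B) B + 1) + seg_length (?E \<inter> B) C
        \<le> seg_length (?F <+>\<^sub>M B) B + seg_length (?F \<inter> B) C" by (rule add_mono)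
      then show ?thesis by (simp add: ac_simps)
    qed
    moreover have "enat i + 1 \<le> seg_length (?E <+>\<^sub>M B) B + seg_length (?E \<inter> B) C + 1"
      using Suc by (intro add_mono) auto
    ultimately have "enat i + 1 \<le> seg_length (?F <+>\<^sub>M B) B + seg_length (?F \<inter> B) C" by (rule order_trans [rotated])
    then show ?case by (simp add: one_enat_def)
  qed
  from this [of n] have "enat n \<le> seg_length (E n <+>\<^sub>M B) B + seg_length (E n \<inter> B) C" by simp
  also have "\<dots> \<le> seg_length A B + seg_length B C"
    using E(3) [of n] A B assms by (intro add_mono seg_length_mono set_add_least) auto
  finally show "enat n \<le> seg_length A B + seg_length B C" .
qed

text \<open>Chains in the two segments can be concatenated.\<close>

lemma seg_length_add_ge:
  assumes A: "submodule A R M" and B: "submodule B R M" and C: "submodule C R M"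
    and "C \<subseteq> B" "B \<subseteq> A"
  shows "seg_length A B + seg_length B C \<le> seg_length A C"
proof (rule enat_leI)
  fix n assume n: "enat n \<le> seg_length A B + seg_length B C"
  have "\<exists>i k. n = k + i \<and> enat i \<le> seg_length A B \<and> enat k \<le> seg_length B C"
  proof (cases "seg_length A B")
    case (enat a)
    show ?thesis
    proof (cases "n \<le> a")
      case True
      then show ?thesis using enat by (intro exI [of _ n] exI [of _ 0]) (auto simp: zero_enat_def [symmetric])
    next
      case False
      have "enat (n - a) \<le> seg_length B C"
        using n False unfolding enat by (cases "seg_length B C") auto
      then show ?thesis using enat False by (intro exI [of _ a] exI [of _ "n - a"]) auto
    qed
  next
    case infinity
    then show ?thesis by (intro exI [of _ n] exI [of _ 0]) (auto simp: zero_enat_def [symmetric])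
  qed
  then obtain i k where ik: "n = k + i" "enat i \<le> seg_length A B" "enat k \<le> seg_length B C" by blast
  obtain E where E: "\<And>m. m \<le> i \<Longrightarrow> submodule (E m) R M" "\<And>m. m \<le> i \<Longrightarrow> B \<subseteq> E m"
      "\<And>m. m \<le> i \<Longrightarrow> E m \<subseteq> A" "\<And>m. m < i \<Longrightarrow> E m \<subset> E (Suc m)"
    using ik(2) B \<open>B \<subseteq> A\<close> by (metis seg_chainE)
  obtain F where F: "\<And>m. m \<le> k \<Longrightarrow> submodule (F m) R M" "\<And>m. m \<le> k \<Longrightarrow> C \<subseteq> F m"
      "\<And>m. m \<le> k \<Longrightarrow> F m \<subseteq> B" "\<And>m. m < k \<Longrightarrow> F m \<subset> F (Suc m)"
    using ik(3) C \<open>C \<subseteq> B\<close> by (metis seg_chainE)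
  \<comment> \<open>The last member of the lower chain replaces the first member of the upper one, which contains it.\<close>
  define G where "G m = (if m \<le> k then F m else E (m - k))" for m
  have "G m \<subset> G (Suc m)" if m: "m < n" for m
  proof -
    consider "m < k" | "m = k" | "k < m" by linarith
    then show ?thesis
    proof cases
      case 1
      then show ?thesis using F by (simp add: G_def)
    next
      case 2
      then have "F k \<subseteq> E 0" "E 0 \<subset> E 1" using F(3) [of k] E(2) [of 0] E(4) [of 0] ik(1) m by auto
      then show ?thesis using 2 by (simp add: G_def)
    next
      case 3
      then have "Suc m - k = Suc (m - k)" "m - k < i" using m ik(1) by auto
      then show ?thesis using 3 E(4) by (simp add: G_def)
    qed
  qed
  moreover have "submodule (G m) R M \<and> C \<subseteq> G m \<and> G m \<subseteq> A" if "m \<le> n" for m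
  proof (cases "m \<le> k")
    case True
    then show ?thesis using F(1-3) [of m] \<open>B \<subseteq> A\<close> by (auto simp: G_def)
  next
    case False
    then have "m - k \<le> i" using that ik(1) by simp
    then show ?thesis using False E(1-3) [of "m - k"] \<open>C \<subseteq> B\<close> by (auto simp: G_def)
  qed
  moreover have "C \<subseteq> A" using assms by blast
  ultimately show "enat n \<le> seg_length A C"
    using C by (intro seg_chainI [of _ _ _ G]) auto
qed

lemma seg_length_add:
  assumes "submodule A R M" and "submodule B R M" and "submodule C R M" and "C \<subseteq> B" "B \<subseteq> A"
  shows "seg_length A C = seg_length A B + seg_length B C"
  using seg_length_add_le [OF assms] seg_length_add_ge [OF assms] by (rule antisym)

text \<open>Multiplication by \<open>r\<close> induces an isomorphism of \<open>M/L\<close> onto \<open>(W + r M)/W\<close>, where \<open>L\<close> consists of the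
  \<open>m\<close> with \<open>r m \<in> W\<close>; preimages and images translate chains strictly.\<close>

lemma seg_length_scaled:
  assumes r: "r \<in> carrier R" and W: "submodule W R M"
  shows "seg_length (W <+>\<^sub>M (\<lambda>m. r \<odot>\<^sub>M m) ` carrier M) W
    = seg_length (carrier M) {m \<in> carrier M. r \<odot>\<^sub>M m \<in> W}" (is "seg_length ?A W = seg_length _ ?L")
proof (rule antisym)
  note sW = submodule_subset [OF W]
  show "seg_length ?A W \<le> seg_length (carrier M) ?L"
    unfolding seg_length_def
  proof (rule chain_sup_mono_map [of _ _ "\<lambda>Y. {m \<in> carrier M. r \<odot>\<^sub>M m \<in> Y}"])
    fix Y assume Y: "submodule Y R M \<and> W \<subseteq> Y \<and> Y \<subseteq> ?A"
    then show "submodule {m \<in> carrier M. r \<odot>\<^sub>M m \<in> Y} R M \<and> ?L \<subseteq> {m \<in> carrier M. r \<odot>\<^sub>M m \<in> Y}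
        \<and> {m \<in> carrier M. r \<odot>\<^sub>M m \<in> Y} \<subseteq> carrier M"
      using r carrier_is_submodule by (auto intro: submodule_colon_elements)
    fix Y' assume Y': "submodule Y' R M \<and> W \<subseteq> Y' \<and> Y' \<subseteq> ?A" and "Y \<subset> Y'"
    then obtain y where y: "y \<in> Y'" "y \<notin> Y" by blast
    then have "y \<in> ?A" using Y' by blast
    then obtain w m where wm: "w \<in> W" "m \<in> carrier M" "y = w \<oplus>\<^sub>M r \<odot>\<^sub>M m"
      unfolding mem_set_add_iff by blast
    have "w \<in> carrier M" using wm sW by blast
    then have "r \<odot>\<^sub>M m = y \<ominus>\<^sub>M w"
      using wm(2,3) r M.add.m_comm [of w "r \<odot>\<^sub>M m"] by (simp add: a_minus_def M.a_assoc M.r_neg)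
    then have "r \<odot>\<^sub>M m \<in> Y'" using y(1) wm(1) Y' submodule_minus [of Y' y w] by auto
    moreover have "r \<odot>\<^sub>M m \<notin> Y" using y(2) wm(1,3) Y submoduleE(5) [of Y w "r \<odot>\<^sub>M m"] by auto
    ultimately show "{m \<in> carrier M. r \<odot>\<^sub>M m \<in> Y} \<subset> {m \<in> carrier M. r \<odot>\<^sub>M m \<in> Y'}"
      using wm \<open>Y \<subset> Y'\<close> by blast
  qed
  show "seg_length (carrier M) ?L \<le> seg_length ?A W"
    unfolding seg_length_def
  proof (rule chain_sup_mono_map [of _ _ "\<lambda>N. W <+>\<^sub>M (\<lambda>m. r \<odot>\<^sub>M m) ` N"])
    fix N assume N: "submodule N R M \<and> ?L \<subseteq> N \<and> N \<subseteq> carrier M"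
    then have s: "submodule ((\<lambda>m. r \<odot>\<^sub>M m) ` N) R M" using r submodule_scaled by blast
    then show "submodule (W <+>\<^sub>M (\<lambda>m. r \<odot>\<^sub>M m) ` N) R M \<and> W \<subseteq> W <+>\<^sub>M (\<lambda>m. r \<odot>\<^sub>M m) ` N
        \<and> W <+>\<^sub>M (\<lambda>m. r \<odot>\<^sub>M m) ` N \<subseteq> ?A"
      using N submodule_set_add [OF W s] set_add_upper [OF W s]
      by (intro conjI set_add_mono order_refl image_mono) blast+
    fix N' assume N': "submodule N' R M \<and> ?L \<subseteq> N' \<and> N' \<subseteq> carrier M" and "N \<subset> N'"
    then obtain m where m: "m \<in> N'" "m \<notin> N" "m \<in> carrier M" by blast
    have s': "submodule ((\<lambda>m. r \<odot>\<^sub>M m) ` N') R M" using N' r submodule_scaled by blast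
    have "r \<odot>\<^sub>M m \<in> W <+>\<^sub>M (\<lambda>m. r \<odot>\<^sub>M m) ` N'"
      using m set_add_upper(2) [OF W s'] by blast
    moreover have "r \<odot>\<^sub>M m \<notin> W <+>\<^sub>M (\<lambda>m. r \<odot>\<^sub>M m) ` N"
    proof
      assume "r \<odot>\<^sub>M m \<in> W <+>\<^sub>M (\<lambda>m. r \<odot>\<^sub>M m) ` N"
      then obtain w n where wn: "w \<in> W" "n \<in> N" "r \<odot>\<^sub>M m = w \<oplus>\<^sub>M r \<odot>\<^sub>M n"
        unfolding mem_set_add_iff by blast
      have c: "w \<in> carrier M" "n \<in> carrier M" using wn sW N by auto
      have "r \<odot>\<^sub>M (m \<ominus>\<^sub>M n) = w"
        using c m r wn(3)
        by (simp add: a_minus_def smult_r_distr smult_r_minus M.a_assoc M.r_neg)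
      then have "m \<ominus>\<^sub>M n \<in> ?L" using wn(1) c m(3) by simp
      then have "m \<ominus>\<^sub>M n \<in> N" using N by blast
      then have "(m \<ominus>\<^sub>M n) \<oplus>\<^sub>M n \<in> N" using wn(2) N submoduleE(5) [of N] by simp
      then show False using m c by (simp add: a_minus_def M.a_assoc M.l_neg)
    qed
    ultimately show "W <+>\<^sub>M (\<lambda>m. r \<odot>\<^sub>M m) ` N \<subset> W <+>\<^sub>M (\<lambda>m. r \<odot>\<^sub>M m) ` N'"
      using set_add_mono [of W W "(\<lambda>m. r \<odot>\<^sub>M m) ` N" "(\<lambda>m. r \<odot>\<^sub>M m) ` N'"] \<open>N \<subset> N'\<close> by blast
  qed
qed

end

section \<open>The length of a quotient module\<close>

text \<open>The correspondence of the submodules of \<open>M/B\<close> with those of \<open>M\<close> above \<open>B\<close>.\<close>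

lemma (in module) module_length_quot_module:
  assumes B: "submodule B R M"
  shows "module_length R (quot_module M B) = seg_length (carrier M) B"
proof -
  interpret B: abelian_subgroup B M by (rule submodule_abelian_subgroup [OF B])
  let ?Q = "quot_module M B" and ?h = "\<lambda>x. B +>\<^bsub>M\<^esub> x"
  have "group (add_monoid ?Q) \<longleftrightarrow> group (M A_Mod B)"
    by (simp add: quot_module_def A_FactGroup_def' group_def group_axioms_def monoid_def Units_def)
  moreover have "hom (add_monoid M) (add_monoid ?Q) = hom (add_monoid M) (M A_Mod B)"
    by (simp add: quot_module_def A_FactGroup_def' hom_def)
  ultimately have hom: "group_hom (add_monoid M) (add_monoid ?Q) ?h"
    unfolding group_hom_def group_hom_axioms_def
    using B.a_r_coset_hom_A_Mod B.a_factorgroup_is_group M.a_group by blast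
  have carr: "carrier ?Q = ?h ` carrier M" by (auto simp: quot_module_def A_RCOSETS_def')
  have coset_mem: "x \<in> ?h y \<longleftrightarrow> x \<ominus>\<^sub>M y \<in> B" if "x \<in> carrier M" "y \<in> carrier M" for x y
    using B.a_rcos_module [OF that(2,1)] by (simp add: a_minus_def)
  have coset_eq: "?h x = ?h y \<longleftrightarrow> x \<ominus>\<^sub>M y \<in> B" if "x \<in> carrier M" "y \<in> carrier M" for x y
  proof
    assume "?h x = ?h y"
    then have "x \<in> ?h y" using B.a_rcos_self that by blast
    then show "x \<ominus>\<^sub>M y \<in> B" using coset_mem that by blast
  next
    assume "x \<ominus>\<^sub>M y \<in> B"
    then have "x \<in> ?h y" using coset_mem that by blast
    then show "?h x = ?h y" using M.a_repr_independence [of x B y] that B.a_subgroup by simp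
  qed
  have smult: "a \<odot>\<^bsub>?Q\<^esub> ?h x = ?h (a \<odot>\<^sub>M x)" if a: "a \<in> carrier R" and x: "x \<in> carrier M" for a x
  proof -
    have const: "?h (a \<odot>\<^sub>M y) = ?h (a \<odot>\<^sub>M x)" if y: "y \<in> ?h x" for y
    proof -
      have yc: "y \<in> carrier M" using y x B.a_elemrcos_carrier by blast
      have "y \<ominus>\<^sub>M x \<in> B" using y x yc coset_mem by blast
      then have "a \<odot>\<^sub>M (y \<ominus>\<^sub>M x) \<in> B" by (rule submoduleE(4) [OF B a])
      then have "a \<odot>\<^sub>M y \<ominus>\<^sub>M a \<odot>\<^sub>M x \<in> B"
        using a x yc by (simp add: a_minus_def smult_r_distr smult_r_minus)
      then show ?thesis using a x yc by (simp add: coset_eq)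
    qed
    have eq: "(\<Union>y\<in>?h x. ?h (a \<odot>\<^sub>M y)) = ?h (a \<odot>\<^sub>M x)"
    proof
      show "(\<Union>y\<in>?h x. ?h (a \<odot>\<^sub>M y)) \<subseteq> ?h (a \<odot>\<^sub>M x)"
        by (rule UN_least) (simp only: const order_refl)
      show "?h (a \<odot>\<^sub>M x) \<subseteq> (\<Union>y\<in>?h x. ?h (a \<odot>\<^sub>M y))"
        by (rule UN_upper) (rule B.a_rcos_self [OF x])
    qed
    have "a \<odot>\<^bsub>?Q\<^esub> ?h x = (\<Union>y\<in>?h x. ?h (a \<odot>\<^sub>M y))" by (simp add: quot_module_def)
    then show ?thesis unfolding eq .
  qed
  show ?thesis
  proof (rule antisym)
    show "module_length R ?Q \<le> seg_length (carrier M) B"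
      unfolding module_length_def seg_length_def
    proof (rule chain_sup_mono_map [of _ _ "\<lambda>Y. {x \<in> carrier M. ?h x \<in> Y}"])
      fix Y assume Y: "submodule Y R ?Q"
      interpret h: group_hom "add_monoid M" "add_monoid ?Q" ?h by (rule hom)
      interpret Y: subgroup Y "add_monoid ?Q" using Y by (rule submodule.axioms)
      have "submodule {x \<in> carrier M. ?h x \<in> Y} R M"
      proof (rule submoduleI)
        show "\<zero>\<^sub>M \<in> {x \<in> carrier M. ?h x \<in> Y}" using Y.one_closed h.hom_one by simp
        show "\<ominus>\<^sub>M a \<in> {x \<in> carrier M. ?h x \<in> Y}" if "a \<in> {x \<in> carrier M. ?h x \<in> Y}" for a
          using that Y.m_inv_closed [of "?h a"] h.hom_inv [of a] by (simp add: a_inv_def)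
        show "a \<oplus>\<^sub>M b \<in> {x \<in> carrier M. ?h x \<in> Y}"
          if "a \<in> {x \<in> carrier M. ?h x \<in> Y}" "b \<in> {x \<in> carrier M. ?h x \<in> Y}" for a b
          using that Y.m_closed [of "?h a" "?h b"] h.hom_mult [of a b] by simp
        show "a \<odot>\<^sub>M x \<in> {x \<in> carrier M. ?h x \<in> Y}"
          if "a \<in> carrier R" "x \<in> {x \<in> carrier M. ?h x \<in> Y}" for a x
          using that submodule.smult_closed [OF Y, of a "?h x"] by (simp add: smult)
      qed auto
      moreover have "?h b = ?h \<zero>\<^sub>M" if "b \<in> B" for b
        using that B.a_subset by (subst coset_eq) (auto simp: a_minus_def)
      then have "B \<subseteq> {x \<in> carrier M. ?h x \<in> Y}"
        using B.a_subset Y.one_closed h.hom_one by auto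
      ultimately show "submodule {x \<in> carrier M. ?h x \<in> Y} R M \<and> B \<subseteq> {x \<in> carrier M. ?h x \<in> Y} \<and>
          {x \<in> carrier M. ?h x \<in> Y} \<subseteq> carrier M" by blast
      fix Y' assume Y': "submodule Y' R ?Q" "Y \<subset> Y'"
      then obtain y where y: "y \<in> Y'" "y \<notin> Y" by blast
      moreover have "y \<in> carrier ?Q" using y Y' subgroup.subset [OF submodule.axioms(1) [OF Y'(1)]] by auto
      ultimately obtain x where "x \<in> carrier M" "y = ?h x" unfolding carr by blast
      then show "{x \<in> carrier M. ?h x \<in> Y} \<subset> {x \<in> carrier M. ?h x \<in> Y'}" using y Y' by blast
    qed
    show "seg_length (carrier M) B \<le> module_length R ?Q"
      unfolding module_length_def seg_length_def
    proof (rule chain_sup_mono_map [of _ _ "\<lambda>N. ?h ` N"])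
      fix N assume N: "submodule N R M \<and> B \<subseteq> N \<and> N \<subseteq> carrier M"
      show "submodule (?h ` N) R ?Q"
      proof (intro submodule.intro submodule_axioms.intro)
        show "subgroup (?h ` N) (add_monoid ?Q)"
          using N group_hom.subgroup_img_is_subgroup [OF hom] submodule.axioms(1) by blast
        show "a \<odot>\<^bsub>?Q\<^esub> x \<in> ?h ` N" if "a \<in> carrier R" "x \<in> ?h ` N" for a x
          using that N submoduleE(4) [of N] smult submodule_mem_carrier by fastforce
      qed
      fix N' assume N': "submodule N' R M \<and> B \<subseteq> N' \<and> N' \<subseteq> carrier M" "N \<subset> N'"
      then obtain x where x: "x \<in> N'" "x \<notin> N" "x \<in> carrier M" by blast
      have "?h x \<notin> ?h ` N"
      proof
        assume "?h x \<in> ?h ` N"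
        then obtain y where y: "y \<in> N" "?h x = ?h y" by blast
        have yc: "y \<in> carrier M" using y N by blast
        then have "x \<ominus>\<^sub>M y \<in> B" using y(2) coset_eq [OF x(3)] by simp
        then have "(x \<ominus>\<^sub>M y) \<oplus>\<^sub>M y \<in> N" using y(1) N submoduleE(5) [of N] by blast
        then show False using x yc by (simp add: a_minus_def M.a_assoc M.l_neg)
      qed
      then show "?h ` N \<subset> ?h ` N'" using x N' by blast
    qed
  qed
qed

lemma (in module) submodule_carrier_update_iff:
  assumes A: "submodule A R M"
  shows "submodule N R (M\<lparr>carrier := A\<rparr>) \<longleftrightarrow> submodule N R M \<and> N \<subseteq> A"
proof -
  interpret A: module R "M\<lparr>carrier := A\<rparr>" by (rule submodule.submodule_is_module [OF A module_axioms])
  show ?thesis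
  proof
    assume N: "submodule N R (M\<lparr>carrier := A\<rparr>)"
    then have "N \<subseteq> A" using A.submodule_subset by fastforce
    moreover have "submodule N R M"
      using \<open>N \<subseteq> A\<close> submodule_subset [OF A] A.submodule_zero [OF N] A.submodule_closed [OF N]
      by (intro submodule_criterion) auto
    ultimately show "submodule N R M \<and> N \<subseteq> A" by blast
  next
    assume N: "submodule N R M \<and> N \<subseteq> A"
    then show "submodule N R (M\<lparr>carrier := A\<rparr>)"
      using submodule_zero [of N] submodule_closed [of N]
      by (intro A.submodule_criterion) auto
  qed
qed

lemma (in module) quot_length_eq_seg_length:
  assumes A: "submodule A R M" and B: "submodule B R M" and "B \<subseteq> A"
  shows "quot_length R M A B = seg_length A B"
proof -
  interpret A: module R "M\<lparr>carrier := A\<rparr>" by (rule submodule.submodule_is_module [OF A module_axioms])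
  have "submodule B R (M\<lparr>carrier := A\<rparr>)" using assms by (simp add: submodule_carrier_update_iff)
  then have "quot_length R M A B = A.seg_length (carrier (M\<lparr>carrier := A\<rparr>)) B"
    unfolding quot_length_def by (rule A.module_length_quot_module)
  also have "\<dots> = seg_length A B"
    unfolding A.seg_length_def seg_length_def submodule_carrier_update_iff [OF A]
    by (rule arg_cong [of _ _ chain_sup]) auto
  finally show ?thesis .
qed

section \<open>Ascending chain conditions and modules of finite length\<close>

lemma acc_maximal:
  assumes acc: "\<And>f::nat \<Rightarrow> 'x set. (\<And>k. Q (f k)) \<Longrightarrow> mono f \<Longrightarrow> \<exists>k0. \<forall>k\<ge>k0. f k = f k0"
    and PQ: "\<And>X. P X \<Longrightarrow> Q X" and "P X"
  shows "\<exists>V. P V \<and> (\<forall>V'. P V' \<longrightarrow> V \<subseteq> V' \<longrightarrow> V' = V)"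
proof (rule ccontr)
  assume "\<not> ?thesis"
  then have ex: "\<And>V. P V \<Longrightarrow> \<exists>V'. P V' \<and> V \<subset> V'" by blast
  have "\<exists>f. \<forall>n::nat. P (f n) \<and> f n \<subset> f (Suc n)"
    by (rule dependent_nat_choice) (use \<open>P X\<close> ex in blast)+
  then obtain f where f: "\<And>n::nat. P (f n)" "\<And>n. f n \<subset> f (Suc n)" by blast
  have "mono f" using f(2) by (intro mono_iff_le_Suc [THEN iffD2]) blast
  with acc [of f, OF PQ [OF f(1)]] obtain k0 where k0: "\<And>k. k \<ge> k0 \<Longrightarrow> f k = f k0" by blast
  have "f (Suc k0) = f k0" by (rule k0) simp
  then show False using f(2) [of k0] by blast
qed

lemma (in noetherian_ring) ideal_acc:
  fixes f :: "nat \<Rightarrow> 'a set"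
  assumes "\<And>k. ideal (f k) R" and "mono f"
  shows "\<exists>k0. \<forall>k\<ge>k0. f k = f k0"
proof -
  have "subset.chain {I. ideal I R} (range f)"
    unfolding subset_chain_def
  proof (intro conjI ballI)
    show "range f \<subseteq> {I. ideal I R}" using assms(1) by blast
    fix A B assume "A \<in> range f" "B \<in> range f"
    then obtain i k where ik: "A = f i" "B = f k" by blast
    show "A \<subseteq> B \<or> B \<subseteq> A"
      using nat_le_linear [of i k] monoD [OF \<open>mono f\<close>] unfolding ik by blast
  qed
  then have "\<Union>(range f) \<in> range f" by (intro ideal_chain_is_trivial) auto
  then obtain k0 where k0: "\<Union>(range f) = f k0" by blast
  have "f k = f k0" if "k0 \<le> k" for k
    using monoD [OF \<open>mono f\<close> that] k0 by blast
  then show ?thesis by blast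
qed

lemma (in noetherian_ring) ideal_induct_noetherian:
  assumes I: "ideal I R"
    and step: "\<And>I. ideal I R \<Longrightarrow> (\<And>I'. ideal I' R \<Longrightarrow> I \<subset> I' \<Longrightarrow> P I') \<Longrightarrow> P I"
  shows "P I"
proof (rule ccontr)
  assume "\<not> P I"
  then have "\<exists>V. (ideal V R \<and> \<not> P V) \<and> (\<forall>V'. ideal V' R \<and> \<not> P V' \<longrightarrow> V \<subseteq> V' \<longrightarrow> V' = V)"
    using I by (intro acc_maximal [where Q = "\<lambda>I. ideal I R"] ideal_acc) simp_all
  then obtain V where V: "ideal V R" "\<not> P V" "\<And>V'. ideal V' R \<Longrightarrow> \<not> P V' \<Longrightarrow> V \<subseteq> V' \<Longrightarrow> V' = V"
    by blast
  have "P V" by (rule step [OF V(1)]) (use V(3) in blast)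
  then show False using V(2) by blast
qed

context noetherian_local_ring
begin

lemma maximal_is_ideal: "ideal \<mm> R"
  using maximal by (rule maximalideal.axioms(1))

lemma proper_ideal_subset_maximal:
  assumes "ideal I R" "I \<noteq> carrier R"
  shows "I \<subseteq> \<mm>"
proof -
  have "I \<noteq> carrier R \<longrightarrow> I \<subseteq> \<mm>"
  proof (rule ideal_induct_noetherian [OF assms(1)], rule impI)
    fix I assume 1: "ideal I R" "\<And>I'. ideal I' R \<Longrightarrow> I \<subset> I' \<Longrightarrow> I' \<noteq> carrier R \<longrightarrow> I' \<subseteq> \<mm>"
      and 2: "I \<noteq> carrier R"
    show "I \<subseteq> \<mm>"
    proof (cases "\<exists>I'. ideal I' R \<and> I \<subset> I' \<and> I' \<noteq> carrier R")
      case True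
      then show ?thesis using 1 by blast
    next
      case False
      have "maximalideal I R"
        using 1 2 False by (intro maximalidealI) blast+
      then show ?thesis using unique_maximal by blast
    qed
  qed
  then show ?thesis using assms by blast
qed

lemma not_in_maximal_imp_unit:
  assumes r: "r \<in> carrier R" "r \<notin> \<mm>"
  shows "\<exists>s\<in>carrier R. s \<otimes> r = \<one>"
proof -
  have "PIdl r = carrier R"
    using proper_ideal_subset_maximal [OF cgenideal_ideal [OF r(1)]] cgenideal_self [OF r(1)] r(2) by blast
  then have "\<one> \<in> PIdl r" by simp
  then show ?thesis unfolding cgenideal_def by auto
qed

end

context module
begin

definition acc_submodules :: bool
  where "acc_submodules \<longleftrightarrow> (\<forall>f::nat \<Rightarrow> 'c set. (\<forall>k. submodule (f k) R M) \<longrightarrow> mono f \<longrightarrow>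
    (\<exists>k0. \<forall>k\<ge>k0. f k = f k0))"

lemma submodule_cyclic:
  assumes x: "x \<in> carrier M"
  shows "submodule ((\<lambda>r. r \<odot>\<^sub>M x) ` carrier R) R M"
proof (rule submodule_criterion)
  let ?N = "(\<lambda>r. r \<odot>\<^sub>M x) ` carrier R"
  show "?N \<subseteq> carrier M" using x by auto
  show "\<zero>\<^sub>M \<in> ?N" using x by (intro image_eqI [of _ _ \<zero>]) simp_all
  fix a y z assume a: "a \<in> carrier R" and "y \<in> ?N" "z \<in> ?N"
  then obtain r s where "r \<in> carrier R" "y = r \<odot>\<^sub>M x" "s \<in> carrier R" "z = s \<odot>\<^sub>M x" by blast
  then show "a \<odot>\<^sub>M y \<oplus>\<^sub>M z \<in> ?N"
    using a x by (intro image_eqI [of _ _ "a \<otimes> r \<oplus> s"]) (simp_all add: smult_l_distr smult_assoc1)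
qed

lemma mem_module_span_insertE:
  assumes x: "x \<in> carrier M" and S: "S \<subseteq> carrier M" and y: "y \<in> module_span R M (insert x S)"
  obtains s r where "s \<in> module_span R M S" "r \<in> carrier R" "y = s \<oplus>\<^sub>M r \<odot>\<^sub>M x"
proof -
  have "x \<in> (\<lambda>r. r \<odot>\<^sub>M x) ` carrier R" using x by (intro image_eqI [of _ _ \<one>]) simp_all
  then have "module_span R M {x} \<subseteq> (\<lambda>r. r \<odot>\<^sub>M x) ` carrier R"
    by (intro module_span_least submodule_cyclic x) blast
  moreover have "y \<in> module_span R M S <+>\<^sub>M module_span R M {x}"
    using y module_span_Un [OF S, of "{x}"] x by simp
  ultimately show ?thesis using that unfolding mem_set_add_iff by blast
qed

text \<open>The step towards the ascending chain condition in a finitely generated module. When a generator \<open>x\<close> is added, two comparable submodules agree on the larger span if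
  they agree on the span of \<open>S\<close> and have the same ideal of possible coefficients of \<open>x\<close>.\<close>

lemma acc_Int_module_span:
  fixes f :: "nat \<Rightarrow> 'c set"
  assumes noeth: "noetherian_ring R" and "finite S" and "S \<subseteq> carrier M"
    and f: "\<And>k. submodule (f k) R M" and "mono f"
  shows "\<exists>k0. \<forall>k\<ge>k0. f k \<inter> module_span R M S = f k0 \<inter> module_span R M S"
  using assms(2,3)
proof (induction S)
  case empty
  have "module_span R M {} \<subseteq> f k" for k using f by (intro module_span_least) auto
  then show ?case by blast
next
  case (insert x S)
  then have x: "x \<in> carrier M" and S: "S \<subseteq> carrier M" by auto
  note sS = submodule_module_span [OF S]
  \<comment> \<open>The coefficients of \<open>x\<close> in the elements of \<open>f k\<close> within the larger span.\<close>
  define I where "I k = {r \<in> carrier R. \<forall>m\<in>{x}. r \<odot>\<^sub>M m \<in> module_span R M S <+>\<^sub>M f k}" for k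
  have "ideal (I k) R" for k
    unfolding I_def using x by (intro ideal_colon submodule_set_add sS f) auto
  moreover have "mono I"
  proof (rule monoI)
    fix k l :: nat assume "k \<le> l"
    then have "module_span R M S <+>\<^sub>M f k \<subseteq> module_span R M S <+>\<^sub>M f l"
      by (intro set_add_mono order_refl monoD [OF \<open>mono f\<close>])
    then show "I k \<subseteq> I l" unfolding I_def by blast
  qed
  ultimately obtain k1 where k1: "\<And>k. k1 \<le> k \<Longrightarrow> I k = I k1"
    using noetherian_ring.ideal_acc [OF noeth] by metis
  obtain k2 where k2: "\<And>k. k2 \<le> k \<Longrightarrow> f k \<inter> module_span R M S = f k2 \<inter> module_span R M S"
    using insert S by metis
  define k0 where "k0 = max k1 k2"
  have "f k \<inter> module_span R M (insert x S) \<subseteq> f k0" if k: "k0 \<le> k" for k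
  proof
    fix y assume y: "y \<in> f k \<inter> module_span R M (insert x S)"
    obtain s r where sr: "s \<in> module_span R M S" "r \<in> carrier R" "y = s \<oplus>\<^sub>M r \<odot>\<^sub>M x"
      using mem_module_span_insertE [OF x S] y by blast
    have c: "s \<in> carrier M" "y \<in> carrier M"
      using submodule_mem_carrier [OF sS sr(1)] submodule_mem_carrier [OF f, of y] y by auto
    have rx: "r \<odot>\<^sub>M x \<in> carrier M" using sr x by simp
    have "\<ominus>\<^sub>M s \<oplus>\<^sub>M y = r \<odot>\<^sub>M x"
      using c rx sr(3) by (simp add: M.r_neg1)
    moreover have "\<ominus>\<^sub>M s \<oplus>\<^sub>M y \<in> module_span R M S <+>\<^sub>M f k"
      using sr y submoduleE(3) [OF sS] by (intro mem_set_addI) auto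
    ultimately have "r \<in> I k" using sr by (simp add: I_def)
    then have "r \<in> I k0" using k1 [of k] k1 [of k0] k by (simp add: k0_def)
    then have "r \<odot>\<^sub>M x \<in> module_span R M S <+>\<^sub>M f k0" by (simp add: I_def)
    then obtain s' z where z: "s' \<in> module_span R M S" "z \<in> f k0" "r \<odot>\<^sub>M x = s' \<oplus>\<^sub>M z"
      unfolding mem_set_add_iff by blast
    have c': "s' \<in> carrier M" "z \<in> carrier M"
      using submodule_mem_carrier [OF sS z(1)] submodule_mem_carrier [OF f z(2)] by auto
    have e: "y = (s \<oplus>\<^sub>M s') \<oplus>\<^sub>M z" using sr(3) z(3) c c' by (simp add: M.a_assoc)
    have s: "s \<oplus>\<^sub>M s' \<in> module_span R M S" using sr z submoduleE(5) [OF sS] by blast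
    have "z \<in> f k" using z(2) monoD [OF \<open>mono f\<close> k] by blast
    then have "y \<ominus>\<^sub>M z \<in> f k" using y submodule_minus [OF f] by blast
    moreover have "y \<ominus>\<^sub>M z = s \<oplus>\<^sub>M s'"
      using e c c' by (simp add: a_minus_def M.a_assoc M.r_neg)
    ultimately have "s \<oplus>\<^sub>M s' \<in> f k \<inter> module_span R M S" using s by simp
    moreover have "f k \<inter> module_span R M S = f k0 \<inter> module_span R M S"
      using k2 [of k] k2 [of k0] k by (simp add: k0_def)
    ultimately have "s \<oplus>\<^sub>M s' \<in> f k0" by blast
    then show "y \<in> f k0" unfolding e using z(2) submoduleE(5) [OF f] by blast
  qed
  moreover have "f k0 \<subseteq> f k" if "k0 \<le> k" for k using monoD [OF \<open>mono f\<close> that] .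
  ultimately show ?case by (intro exI [of _ k0]) blast
qed

lemma acc_submodules_fin_gen:
  assumes "noetherian_ring R" and "fin_gen_module R M"
  shows acc_submodules
  unfolding acc_submodules_def
proof (intro allI impI)
  fix f :: "nat \<Rightarrow> 'c set" assume f: "\<forall>k. submodule (f k) R M" "mono f"
  obtain S where S: "S \<subseteq> carrier M" "finite S" "module_span R M S = carrier M"
    using assms(2) unfolding fin_gen_module_def by blast
  have "f k \<inter> module_span R M S = f k" for k using f submodule_subset S(3) by blast
  then show "\<exists>k0. \<forall>k\<ge>k0. f k = f k0"
    using acc_Int_module_span [OF assms(1) S(2,1), of f] f by simp
qed

lemma seg_length_self:
  "seg_length W W = 0"
proof -
  have "seg_length W W \<le> 0"
    unfolding seg_length_def
  proof (rule chain_sup_leI)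
    fix n C assume "\<And>i. i \<le> n \<Longrightarrow> submodule (C i) R M \<and> W \<subseteq> C i \<and> C i \<subseteq> W"
      and s: "\<And>i. i < n \<Longrightarrow> C i \<subset> C (Suc i)"
    then have "C i = W" if "i \<le> n" for i using that by blast
    then show "enat n \<le> 0" using s [of 0] by (cases n) (auto simp: zero_enat_def)
  qed
  then show ?thesis by simp
qed

text \<open>The quotient is generated by one element and killed by \<open>\<mm>\<close>. If a submodule contains \<open>v + r x\<close> outside of
  \<open>V\<close>, then \<open>r\<close> is a unit and the submodule contains \<open>x\<close>.\<close>

lemma seg_length_cyclic_extension_le_1:
  assumes loc: "noetherian_local_ring R \<mm>" and V: "submodule V R M" and x: "x \<in> carrier M"
    and mx: "\<And>b. b \<in> \<mm> \<Longrightarrow> b \<odot>\<^sub>M x \<in> V"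
  shows "seg_length (V <+>\<^sub>M (\<lambda>r. r \<odot>\<^sub>M x) ` carrier R) V \<le> 1"
proof (rule ccontr)
  let ?C = "(\<lambda>r. r \<odot>\<^sub>M x) ` carrier R"
  note sc = submodule_cyclic [OF x]
  assume "\<not> ?thesis"
  then have "enat 2 \<le> seg_length (V <+>\<^sub>M ?C) V"
    by (cases "seg_length (V <+>\<^sub>M ?C) V") (auto simp: one_enat_def)
  then obtain C where C: "\<And>i. i \<le> 2 \<Longrightarrow> submodule (C i) R M" "\<And>i. i \<le> 2 \<Longrightarrow> V \<subseteq> C i"
      "\<And>i. i \<le> 2 \<Longrightarrow> C i \<subseteq> V <+>\<^sub>M ?C" "\<And>i. i < 2 \<Longrightarrow> C i \<subset> C (Suc i)"
    using V set_add_upper(1) [OF V sc] by (metis seg_chainE)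
  have C1: "submodule (C 1) R M" "V \<subseteq> C 1" "C 1 \<subseteq> V <+>\<^sub>M ?C" using C(1-3) [of 1] by auto
  have "C 0 \<subset> C 1" using C(4) [of 0] by simp
  then obtain z where z: "z \<in> C 1" "z \<notin> V" using C(2) [of 0] by auto
  then obtain v r where vr: "v \<in> V" "r \<in> carrier R" "z = v \<oplus>\<^sub>M r \<odot>\<^sub>M x"
    using C1(3) unfolding subset_iff mem_set_add_iff by blast
  have c: "v \<in> carrier M" "z \<in> carrier M"
    using submodule_mem_carrier [OF V vr(1)] submodule_mem_carrier [OF C1(1) z(1)] by auto
  have rx: "r \<odot>\<^sub>M x \<in> carrier M" using vr x by simp
  have "r \<notin> \<mm>" using z(2) vr mx submoduleE(5) [OF V] by blast
  then obtain s where s: "s \<in> carrier R" "s \<otimes> r = \<one>"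
    using noetherian_local_ring.not_in_maximal_imp_unit [OF loc] vr(2) by blast
  have "\<ominus>\<^sub>M v \<oplus>\<^sub>M z = r \<odot>\<^sub>M x" using c rx vr(3) by (simp add: M.r_neg1)
  moreover have "v \<in> C 1" using vr(1) C1(2) by blast
  then have "\<ominus>\<^sub>M v \<oplus>\<^sub>M z \<in> C 1" using submoduleE(3,5) [OF C1(1)] z(1) by blast
  ultimately have "r \<odot>\<^sub>M x \<in> C 1" by simp
  then have "s \<odot>\<^sub>M (r \<odot>\<^sub>M x) \<in> C 1" using submoduleE(4) [OF C1(1) s(1)] by blast
  then have "x \<in> C 1" using s vr(2) x by (simp add: smult_assoc1 [symmetric])
  then have "?C \<subseteq> C 1" using submoduleE(4) [OF C1(1)] by blast
  then have "V <+>\<^sub>M ?C \<subseteq> C 1" using C1 by (intro set_add_least) auto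
  moreover have "C 1 \<subset> C 2" using C(4) [of 1] by (simp add: numeral_2_eq_2)
  ultimately show False using C(3) [of 2] by auto
qed

text \<open>Take a maximal \<open>V\<close> such that \<open>V/W\<close> has finite length. If \<open>V\<close> were not \<open>M\<close>, then the last
  nonzero \<open>\<mm>\<^sup>i y\<close> modulo \<open>V\<close>, for some \<open>y\<close>, would contain an element that is killed by \<open>\<mm>\<close> modulo \<open>V\<close>,
  and \<open>V\<close> could be enlarged by it.\<close>

lemma seg_length_finite:
  assumes loc: "noetherian_local_ring R \<mm>" and acc: acc_submodules and W: "submodule W R M"
    and k: "\<And>a m. a \<in> \<mm> \<up> k \<Longrightarrow> m \<in> carrier M \<Longrightarrow> a \<odot>\<^sub>M m \<in> W"
  shows "seg_length (carrier M) W \<noteq> \<infinity>"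
proof -
  interpret loc: noetherian_local_ring R \<mm> by (rule loc)
  interpret IS: comm_monoid "ideals_set R" by (rule R.ideals_set_is_comm_monoid)
  have mc: "\<mm> \<in> carrier (ideals_set R)" using loc.maximal_is_ideal by (simp add: ideals_set_def)
  define P where "P V \<longleftrightarrow> submodule V R M \<and> W \<subseteq> V \<and> seg_length V W \<noteq> \<infinity>" for V
  have "P W" using W by (simp add: P_def seg_length_self)
  have "\<exists>V. P V \<and> (\<forall>V'. P V' \<longrightarrow> V \<subseteq> V' \<longrightarrow> V' = V)"
  proof (rule acc_maximal [where Q = "\<lambda>V. submodule V R M"])
    show "\<exists>k0. \<forall>k\<ge>k0. f k = f k0" if "\<And>k. submodule (f k) R M" "mono f" for f :: "nat \<Rightarrow> 'c set"
      using acc that unfolding acc_submodules_def by blast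
    show "P W" by fact
  qed (simp add: P_def)
  then obtain V where V: "P V" and max: "\<And>V'. P V' \<Longrightarrow> V \<subseteq> V' \<Longrightarrow> V' = V" by blast
  then have sV: "submodule V R M" and WV: "W \<subseteq> V" and fV: "seg_length V W \<noteq> \<infinity>" by (auto simp: P_def)
  have "V = carrier M"
  proof (rule ccontr)
    assume "V \<noteq> carrier M"
    then obtain y where y: "y \<in> carrier M" "y \<notin> V" using submodule_subset [OF sV] by blast
    \<comment> \<open>Whether \<open>\<mm>\<^sup>i\<close> takes \<open>y\<close> into \<open>V\<close>. This fails for \<open>0\<close> and holds for \<open>k\<close>, so it starts to hold somewhere.\<close>
    define K where "K i \<longleftrightarrow> (\<forall>a\<in>\<mm> \<up> i. a \<odot>\<^sub>M y \<in> V)" for i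
    have "K k" using k y WV by (auto simp: K_def)
    have "\<not> K 0" using y by (auto simp: K_def ideals_set_def intro!: bexI [of _ \<one>])
    have "\<exists>i. \<not> K i \<and> K (Suc i)"
    proof (rule ccontr)
      assume no: "\<nexists>i. \<not> K i \<and> K (Suc i)"
      have "\<not> K n" for n by (induction n) (use no \<open>\<not> K 0\<close> in blast)+
      then show False using \<open>K k\<close> by blast
    qed
    then obtain i where i: "\<not> K i" "K (Suc i)" by blast
    then obtain a where a: "a \<in> \<mm> \<up> i" "a \<odot>\<^sub>M y \<notin> V" by (auto simp: K_def)
    have "ideal (\<mm> \<up> i) R"
      using IS.nat_pow_closed [OF mc, of i] by (simp add: ideals_set_def)
    then have ac: "a \<in> carrier R" using a(1) by (rule ideal.Icarr)
    let ?x = "a \<odot>\<^sub>M y"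
    have x: "?x \<in> carrier M" using ac y by simp
    have mx: "b \<odot>\<^sub>M ?x \<in> V" if b: "b \<in> \<mm>" for b
    proof -
      have bc: "b \<in> carrier R" using loc.maximal_is_ideal b by (rule ideal.Icarr)
      have "a \<otimes> b \<in> (\<mm> \<up> i) \<otimes>\<^bsub>ideals_set R\<^esub> \<mm>"
        using a(1) b by (simp add: ideals_set_def ideal_prod.prod)
      then have "a \<otimes> b \<in> \<mm> \<up> Suc i" by simp
      then have "(a \<otimes> b) \<odot>\<^sub>M y \<in> V" using i(2) by (simp add: K_def)
      then show ?thesis using ac bc y by (simp add: smult_assoc1 [symmetric] R.m_comm)
    qed
    let ?V = "V <+>\<^sub>M (\<lambda>r. r \<odot>\<^sub>M ?x) ` carrier R"
    note sc = submodule_cyclic [OF x]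
    have sV': "submodule ?V R M" and VV: "V \<subseteq> ?V"
      using submodule_set_add [OF sV sc] set_add_upper(1) [OF sV sc] by auto
    have "seg_length ?V V \<le> 1" by (rule seg_length_cyclic_extension_le_1 [OF loc sV x mx])
    then have "seg_length ?V V \<noteq> \<infinity>" by (cases "seg_length ?V V") (auto simp: one_enat_def)
    then have "P ?V"
      using seg_length_add [OF sV' sV W WV VV] fV sV' VV WV by (auto simp: P_def plus_eq_infty_iff_enat)
    then have "?V = V" using VV by (rule max)
    moreover have "?x \<in> (\<lambda>r. r \<odot>\<^sub>M ?x) ` carrier R"
      using x by (intro image_eqI [of _ _ \<one>]) simp_all
    then have "?x \<in> ?V" using set_add_upper(2) [OF sV sc] by blast
    ultimately show False using a(2) by simp
  qed
  then show ?thesis using fV by simp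
qed

end

section \<open>Lengths of graded pieces of Rees modules\<close>

text \<open>The comparison at the first difference is a total order on all functions on the natural numbers,
  and it is compatible with addition, as a term order has to be.\<close>

definition lex_less :: "(nat \<Rightarrow> nat) \<Rightarrow> (nat \<Rightarrow> nat) \<Rightarrow> bool"
  where "lex_less a b \<longleftrightarrow> (\<exists>k. a k < b k \<and> (\<forall>i<k. a i = b i))"

lemma linorder_lex_less: "class.linorder (\<lambda>a b. a = b \<or> lex_less a b) lex_less"
proof
  have asym: "\<not> lex_less b a" if ab: "lex_less a b" for a b
  proof
    assume "lex_less b a"
    then obtain l where l: "b l < a l" "\<forall>i<l. b i = a i" unfolding lex_less_def by blast
    obtain k where k: "a k < b k" "\<forall>i<k. a i = b i" using ab unfolding lex_less_def by blast
    show False using k l by (metis linorder_cases less_asym less_irrefl)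
  qed
  have trans: "lex_less a c" if ab: "lex_less a b" and bc: "lex_less b c" for a b c
  proof -
    obtain k where k: "a k < b k" "\<forall>i<k. a i = b i" using ab unfolding lex_less_def by blast
    obtain l where l: "b l < c l" "\<forall>i<l. b i = c i" using bc unfolding lex_less_def by blast
    have "a (min k l) < c (min k l)" using k l by (cases k l rule: linorder_cases) auto
    then show ?thesis unfolding lex_less_def using k l by (intro exI [of _ "min k l"]) auto
  qed
  fix a b c :: "nat \<Rightarrow> nat"
  show "lex_less a b \<longleftrightarrow> (a = b \<or> lex_less a b) \<and> \<not> (b = a \<or> lex_less b a)"
    using asym [of a b] asym [of a a] by blast
  show "a = a \<or> lex_less a a" by simp
  show "a = c \<or> lex_less a c" if "a = b \<or> lex_less a b" "b = c \<or> lex_less b c"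
    using that trans by blast
  show "a = b" if "a = b \<or> lex_less a b" "b = a \<or> lex_less b a"
    using that asym by blast
  show "(a = b \<or> lex_less a b) \<or> (b = a \<or> lex_less b a)"
  proof (cases "a = b")
    case False
    then obtain m where m: "a m \<noteq> b m" by (auto simp: fun_eq_iff)
    define k where "k = (LEAST k. a k \<noteq> b k)"
    have k: "a k \<noteq> b k" unfolding k_def using m by (rule LeastI)
    have "a i = b i" if "i < k" for i using that not_less_Least [of i "\<lambda>k. a k \<noteq> b k"] unfolding k_def by blast
    moreover have "a k < b k \<or> b k < a k" using k by linarith
    ultimately have "lex_less a b \<or> lex_less b a" unfolding lex_less_def by auto
    then show ?thesis by blast
  qed simp
qed

lemma lex_less_add: "lex_less a b \<Longrightarrow> lex_less (\<lambda>i. a i + c i) (\<lambda>i. b i + c i)"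
  unfolding lex_less_def by auto

lemma lex_less_imp_neq: "lex_less a b \<Longrightarrow> a \<noteq> b"
  unfolding lex_less_def by auto

lemma exponents_add:
  assumes "a \<in> exponents dir n u" "c \<in> exponents dir n w"
  shows "(\<lambda>i. a i + c i) \<in> exponents dir n (\<lambda>l. u l + w l)"
  using assms by (simp add: exponents_def sum.distrib)

context cring
begin

definition power_prod :: "(nat \<Rightarrow> 'a) \<Rightarrow> nat \<Rightarrow> (nat \<Rightarrow> nat) \<Rightarrow> 'a"
  where "power_prod x n a = (\<Otimes>i\<in>{..<n}. x i [^] a i)"

lemma power_prod_closed:
  "x \<in> {..<n} \<rightarrow> carrier R \<Longrightarrow> power_prod x n a \<in> carrier R"
  unfolding power_prod_def by (intro finprod_closed) auto

lemma power_prod_add: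
  assumes "x \<in> {..<n} \<rightarrow> carrier R"
  shows "power_prod x n (\<lambda>i. a i + b i) = power_prod x n a \<otimes> power_prod x n b"
proof -
  have "x i \<in> carrier R" if "i < n" for i using assms that by auto
  then have "power_prod x n (\<lambda>i. a i + b i) = (\<Otimes>i\<in>{..<n}. x i [^] a i \<otimes> x i [^] b i)"
    unfolding power_prod_def by (intro finprod_cong') (auto simp: nat_pow_mult)
  also have "\<dots> = power_prod x n a \<otimes> power_prod x n b"
    unfolding power_prod_def using assms by (intro finprod_multf) auto
  finally show ?thesis .
qed

lemma power_prod_cong:
  assumes "x \<in> {..<n} \<rightarrow> carrier R" "\<And>i. i < n \<Longrightarrow> a i = b i"
  shows "power_prod x n a = power_prod x n b"
  unfolding power_prod_def using assms by (intro finprod_cong') auto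

lemma power_prod_single:
  assumes "x \<in> {..<n} \<rightarrow> carrier R" and "i < n"
  shows "power_prod x n (\<lambda>j. if j = i then 1 else 0) = x i"
proof -
  have "x i \<in> carrier R" if "i < n" for i using assms that by auto
  then have "power_prod x n (\<lambda>j. if j = i then 1 else 0) = (\<Otimes>j\<in>{..<n}. if i = j then x j else \<one>)"
    unfolding power_prod_def by (intro finprod_cong') auto
  also have "\<dots> = x i"
    using assms by (intro finprod_singleton) auto
  finally show ?thesis .
qed

lemma power_prod_zero: "power_prod x n (\<lambda>_. 0) = \<one>"
  unfolding power_prod_def by simp

end

lemma the_enat_sum:
  assumes "finite A" and "(\<Sum>a\<in>A. f a) \<noteq> (\<infinity>::enat)"
  shows "real (the_enat (\<Sum>a\<in>A. f a)) = (\<Sum>a\<in>A. real (the_enat (f a)))"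
  using assms
proof (induction A)
  case empty
  then show ?case by (simp add: zero_enat_def)
next
  case (insert a A)
  then obtain m k where "f a = enat m" "(\<Sum>a\<in>A. f a) = enat k"
    by (metis enat.exhaust plus_eq_infty_iff_enat sum.insert)
  then show ?case using insert by simp
qed

context module
begin

definition monomial_span :: "(nat \<Rightarrow> 'a) \<Rightarrow> nat \<Rightarrow> (nat \<Rightarrow> nat) set \<Rightarrow> 'c set"
  where "monomial_span x n T = module_span R M {R.power_prod x n b \<odot>\<^sub>M m |b m. b \<in> T \<and> m \<in> carrier M}"

lemma submodule_monomial_span:
  assumes "x \<in> {..<n} \<rightarrow> carrier R"
  shows "submodule (monomial_span x n T) R M"
  unfolding monomial_span_def using R.power_prod_closed [OF assms]
  by (intro submodule_module_span) auto

lemma monomial_span_mem: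
  "b \<in> T \<Longrightarrow> m \<in> carrier M \<Longrightarrow> R.power_prod x n b \<odot>\<^sub>M m \<in> monomial_span x n T"
  unfolding monomial_span_def by (rule subsetD [OF module_span_self]) blast

lemma monomial_span_least:
  assumes "submodule V R M" "\<And>b m. b \<in> T \<Longrightarrow> m \<in> carrier M \<Longrightarrow> R.power_prod x n b \<odot>\<^sub>M m \<in> V"
  shows "monomial_span x n T \<subseteq> V"
  unfolding monomial_span_def using assms by (intro module_span_least) auto

lemma monomial_span_mono: "S \<subseteq> T \<Longrightarrow> monomial_span x n S \<subseteq> monomial_span x n T"
  unfolding monomial_span_def by (intro module_span_mono) blast

lemma set_add_monomial_span_insert:
  assumes x: "x \<in> {..<n} \<rightarrow> carrier R" and W: "submodule W R M"
  shows "W <+>\<^sub>M monomial_span x n (insert a T) =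
    (W <+>\<^sub>M monomial_span x n T) <+>\<^sub>M (\<lambda>m. R.power_prod x n a \<odot>\<^sub>M m) ` carrier M"
    (is "_ <+>\<^sub>M ?V' = (_ <+>\<^sub>M ?V) <+>\<^sub>M ?X")
proof
  have sV: "submodule ?V R M" and sV': "submodule ?V' R M"
    using submodule_monomial_span [OF x] by auto
  have sX: "submodule ?X R M"
    using R.power_prod_closed [OF x] carrier_is_submodule by (rule submodule_scaled)
  note s1 = submodule_set_add [OF W sV]
  note s2 = submodule_set_add [OF s1 sX]
  have "?V' \<subseteq> (W <+>\<^sub>M ?V) <+>\<^sub>M ?X"
  proof (rule monomial_span_least [OF s2])
    fix b m assume b: "b \<in> insert a T" and m: "m \<in> carrier M"
    show "R.power_prod x n b \<odot>\<^sub>M m \<in> (W <+>\<^sub>M ?V) <+>\<^sub>M ?X"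
    proof (cases "b = a")
      case True
      then show ?thesis using m set_add_upper(2) [OF s1 sX] by blast
    next
      case False
      then have "R.power_prod x n b \<odot>\<^sub>M m \<in> ?V" using b m by (intro monomial_span_mem) auto
      then show ?thesis using set_add_upper(2) [OF W sV] set_add_upper(1) [OF s1 sX] by blast
    qed
  qed
  moreover have "W \<subseteq> (W <+>\<^sub>M ?V) <+>\<^sub>M ?X"
    using set_add_upper(1) [OF W sV] set_add_upper(1) [OF s1 sX] by blast
  ultimately show "W <+>\<^sub>M ?V' \<subseteq> (W <+>\<^sub>M ?V) <+>\<^sub>M ?X"
    by (intro set_add_least s2)
  have "?V \<subseteq> ?V'" by (intro monomial_span_mono) blast
  moreover have "?X \<subseteq> ?V'" using monomial_span_mem [of a "insert a T"] by blast
  ultimately show "(W <+>\<^sub>M ?V) <+>\<^sub>M ?X \<subseteq> W <+>\<^sub>M ?V'"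
    using set_add_upper [OF W sV'] by (intro set_add_least submodule_set_add W sV' set_add_mono) auto
qed

text \<open>The submodules \<open>x\<^sup>a M\<close> are added to \<open>W\<close> in increasing order of \<open>a\<close>. Each step is of the form treated
  in \<open>seg_length_scaled\<close>.\<close>

lemma seg_length_monomial_filtration:
  assumes x: "x \<in> {..<n} \<rightarrow> carrier R" and W: "submodule W R M" and "finite T"
  shows "seg_length (W <+>\<^sub>M monomial_span x n T) W =
    (\<Sum>a\<in>T. seg_length (carrier M) {m \<in> carrier M.
      R.power_prod x n a \<odot>\<^sub>M m \<in> W <+>\<^sub>M monomial_span x n {b \<in> T. lex_less b a}})"
proof -
  interpret lex: linorder "\<lambda>a b. a = b \<or> lex_less a b" lex_less by (rule linorder_lex_less)
  show ?thesis
    using \<open>finite T\<close>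
  proof (induction T rule: lex.finite_linorder_max_induct)
    case empty
    have "W <+>\<^sub>M monomial_span x n {} = W"
      using set_add_upper(1) [OF W submodule_monomial_span [OF x]] monomial_span_least [OF W, of "{}"] W
      by (intro equalityI set_add_least) auto
    moreover have "seg_length W W = 0"
      by (rule seg_length_self)
    ultimately show ?case by simp
  next
    case (insert a T)
    let ?U = "W <+>\<^sub>M monomial_span x n T"
    let ?A = "W <+>\<^sub>M monomial_span x n (insert a T)"
    let ?L = "\<lambda>T a. {m \<in> carrier M. R.power_prod x n a \<odot>\<^sub>M m \<in> W <+>\<^sub>M monomial_span x n {b \<in> T. lex_less b a}}"
    have sU: "submodule ?U R M" and sA: "submodule ?A R M"
      using W submodule_monomial_span [OF x] submodule_set_add by auto
    have "W \<subseteq> ?U" using set_add_upper(1) [OF W submodule_monomial_span [OF x]] .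
    have "?U \<subseteq> ?A" by (intro set_add_mono monomial_span_mono) auto
    have a: "a \<notin> T" using insert lex_less_imp_neq by blast
    have "seg_length ?A W = seg_length ?A ?U + seg_length ?U W"
      by (rule seg_length_add [OF sA sU W]) fact+
    also have "seg_length ?A ?U = seg_length (carrier M) {m \<in> carrier M. R.power_prod x n a \<odot>\<^sub>M m \<in> ?U}"
      unfolding set_add_monomial_span_insert [OF x W]
      using R.power_prod_closed [OF x] sU by (rule seg_length_scaled)
    also have "{b \<in> insert a T. lex_less b a} = T"
      using insert lex_less_imp_neq by blast
    then have "{m \<in> carrier M. R.power_prod x n a \<odot>\<^sub>M m \<in> ?U} = ?L (insert a T) a" by simp
    also have "seg_length ?U W = (\<Sum>b\<in>T. seg_length (carrier M) (?L T b))" by (rule insert.IH)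
    also have "\<dots> = (\<Sum>b\<in>T. seg_length (carrier M) (?L (insert a T) b))"
    proof (rule sum.cong [OF refl])
      fix b assume "b \<in> T"
      then have "lex_less b a" using insert by blast
      then have "\<not> lex_less a b" by (rule lex.less_not_sym)
      then have "{c \<in> insert a T. lex_less c b} = {c \<in> T. lex_less c b}" by blast
      then show "seg_length (carrier M) (?L T b) = seg_length (carrier M) (?L (insert a T) b)" by simp
    qed
    finally show ?case using a insert by simp
  qed
qed

text \<open>The submodule \<open>L\<^sub>a\<close> of the coefficients \<open>m\<close> such that \<open>x\<^sup>a m\<close> lies in \<open>W\<close>, in the degree of \<open>a\<close>, up to
  terms with smaller exponents of the same degree: the coefficients of initial terms in the theory
  of Groebner bases. Entries of \<open>a\<close> from \<open>n\<close> on are ignored, so that \<open>L\<close> is a family indexed by all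
  functions.\<close>

definition initial_submodule where
  "initial_submodule x n dir W a = {m \<in> carrier M. R.power_prod x n a \<odot>\<^sub>M m \<in>
    W (\<lambda>l. \<Sum>i | i < n \<and> dir i = l. a i) <+>\<^sub>M
    monomial_span x n {b \<in> exponents dir n (\<lambda>l. \<Sum>i | i < n \<and> dir i = l. a i).
      lex_less b (\<lambda>i. if i < n then a i else 0)}}"

lemma initial_submodule_submodule:
  assumes x: "x \<in> {..<n} \<rightarrow> carrier R" and W: "\<And>u. submodule (W u) R M"
  shows "submodule (initial_submodule x n dir W a) R M"
  unfolding initial_submodule_def
  by (intro submodule_colon_elements submodule_set_add carrier_is_submodule W
      submodule_monomial_span R.power_prod_closed x)

lemma initial_submodule_restrict:
  assumes x: "x \<in> {..<n} \<rightarrow> carrier R"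
  shows "initial_submodule x n dir W (\<lambda>i. if i \<in> {..<n} then a i else 0) = initial_submodule x n dir W a"
proof -
  have "R.power_prod x n (\<lambda>i. if i \<in> {..<n} then a i else 0) = R.power_prod x n a"
    by (intro R.power_prod_cong x) auto
  moreover have "(\<lambda>l. \<Sum>i | i < n \<and> dir i = l. if i \<in> {..<n} then a i else 0)
      = (\<lambda>l. \<Sum>i | i < n \<and> dir i = l. a i)"
    by (intro ext sum.cong) auto
  moreover have "(\<lambda>i. if i < n then if i \<in> {..<n} then a i else 0 else 0) = (\<lambda>i. if i < n then a i else 0)"
    by auto
  ultimately show ?thesis unfolding initial_submodule_def by simp
qed

text \<open>Multiplication by \<open>x\<^sup>c\<close> with \<open>c = b - a\<close> preserves \<open>W\<close> and the order of the exponents.\<close>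

lemma initial_submodule_mono:
  assumes x: "x \<in> {..<n} \<rightarrow> carrier R" and W: "\<And>u. submodule (W u) R M"
    and stable: "\<And>u w c y. c \<in> exponents dir n w \<Longrightarrow> y \<in> W u \<Longrightarrow>
      R.power_prod x n c \<odot>\<^sub>M y \<in> W (\<lambda>l. u l + w l)"
    and ab: "a \<le> b"
  shows "initial_submodule x n dir W a \<subseteq> initial_submodule x n dir W b"
proof
  let ?d = "\<lambda>a l. \<Sum>i | i < n \<and> dir i = l. a i"
  let ?r = "\<lambda>a i. if i < n then a i else 0"
  let ?T = "\<lambda>a. {b \<in> exponents dir n (?d a). lex_less b (?r a)}"
  fix m assume m: "m \<in> initial_submodule x n dir W a"
  define c where "c i = (if i < n then b i - a i else 0)" for i
  have b: "b i = a i + c i" if "i < n" for i using ab that by (simp add: c_def le_fun_def)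
  have c: "c \<in> exponents dir n (?d c)" by (simp add: exponents_def c_def)
  have db: "?d b = (\<lambda>l. ?d a l + ?d c l)"
    unfolding sum.distrib [symmetric] using b by (intro ext sum.cong) auto
  have rb: "?r b = (\<lambda>i. ?r a i + c i)" using b by (auto simp: c_def)
  have pc: "R.power_prod x n c \<in> carrier R" and pa: "R.power_prod x n a \<in> carrier R" for a
    using R.power_prod_closed [OF x] by auto
  have pb: "R.power_prod x n b = R.power_prod x n c \<otimes> R.power_prod x n a"
    using R.power_prod_add [OF x, of a c] R.power_prod_cong [OF x, of b "\<lambda>i. a i + c i"] b
      R.m_comm [OF pc pa] by simp
  have mM: "m \<in> carrier M"
    and "R.power_prod x n a \<odot>\<^sub>M m \<in> W (?d a) <+>\<^sub>M monomial_span x n (?T a)"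
    using m by (auto simp: initial_submodule_def)
  then obtain y z where y: "y \<in> W (?d a)" and z: "z \<in> monomial_span x n (?T a)"
    and e: "R.power_prod x n a \<odot>\<^sub>M m = y \<oplus>\<^sub>M z"
    unfolding mem_set_add_iff by blast
  have sT: "submodule (monomial_span x n (?T a)) R M" for a by (intro submodule_monomial_span x)
  have yz: "y \<in> carrier M" "z \<in> carrier M"
    using submodule_mem_carrier [OF W y] submodule_mem_carrier [OF sT z] by auto
  have "R.power_prod x n b \<odot>\<^sub>M m = R.power_prod x n c \<odot>\<^sub>M (R.power_prod x n a \<odot>\<^sub>M m)"
    unfolding pb using pc pa mM by (rule smult_assoc1)
  also have "\<dots> = R.power_prod x n c \<odot>\<^sub>M y \<oplus>\<^sub>M R.power_prod x n c \<odot>\<^sub>M z"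
    unfolding e using pc yz by (rule smult_r_distr)
  also have "\<dots> \<in> W (?d b) <+>\<^sub>M monomial_span x n (?T b)"
  proof (rule mem_set_addI)
    show "R.power_prod x n c \<odot>\<^sub>M y \<in> W (?d b)"
      unfolding db by (rule stable [OF c y])
    have "monomial_span x n (?T a) \<subseteq> {z \<in> carrier M. R.power_prod x n c \<odot>\<^sub>M z \<in> monomial_span x n (?T b)}"
    proof (rule monomial_span_least)
      show "submodule {z \<in> carrier M. R.power_prod x n c \<odot>\<^sub>M z \<in> monomial_span x n (?T b)} R M"
        using pc sT carrier_is_submodule by (rule submodule_colon_elements)
      fix f p assume f: "f \<in> ?T a" and p: "p \<in> carrier M"
      have "R.power_prod x n c \<odot>\<^sub>M (R.power_prod x n f \<odot>\<^sub>M p)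
          = R.power_prod x n (\<lambda>i. f i + c i) \<odot>\<^sub>M p"
        using R.power_prod_add [OF x, of f c] R.m_comm [OF pc pa] smult_assoc1 [OF pc pa p] by simp
      moreover have "(\<lambda>i. f i + c i) \<in> ?T b"
        using f exponents_add [OF _ c] lex_less_add unfolding db rb by blast
      ultimately show "R.power_prod x n f \<odot>\<^sub>M p \<in>
          {z \<in> carrier M. R.power_prod x n c \<odot>\<^sub>M z \<in> monomial_span x n (?T b)}"
        using monomial_span_mem [of "\<lambda>i. f i + c i" "?T b" p x n] pa p by simp
    qed
    then show "R.power_prod x n c \<odot>\<^sub>M z \<in> monomial_span x n (?T b)" using z by blast
  qed
  finally show "m \<in> initial_submodule x n dir W b" using mM by (simp add: initial_submodule_def)
qed

lemma seg_length_eq_sum_initial: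
  assumes x: "x \<in> {..<n} \<rightarrow> carrier R" and W: "\<And>u. submodule (W u) R M"
    and WX: "\<And>u. W u \<subseteq> monomial_span x n (exponents dir n u)"
  shows "seg_length (monomial_span x n (exponents dir n u)) (W u) =
    (\<Sum>a\<in>exponents dir n u. seg_length (carrier M) (initial_submodule x n dir W a))"
proof -
  have "W u <+>\<^sub>M monomial_span x n (exponents dir n u) = monomial_span x n (exponents dir n u)"
    using set_add_upper(2) [OF W submodule_monomial_span [OF x]] WX
    by (intro equalityI set_add_least submodule_monomial_span x) auto
  then have "seg_length (monomial_span x n (exponents dir n u)) (W u) =
      (\<Sum>a\<in>exponents dir n u. seg_length (carrier M) {m \<in> carrier M. R.power_prod x n a \<odot>\<^sub>M m \<in>
        W u <+>\<^sub>M monomial_span x n {b \<in> exponents dir n u. lex_less b a}})"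
    using seg_length_monomial_filtration [OF x W [of u] finite_exponents [of dir n u]] by simp
  also have "\<dots> = (\<Sum>a\<in>exponents dir n u. seg_length (carrier M) (initial_submodule x n dir W a))"
  proof (rule sum.cong [OF refl])
    fix a assume "a \<in> exponents dir n u"
    then have "(\<lambda>l. \<Sum>i | i < n \<and> dir i = l. a i) = u" "(\<lambda>i. if i < n then a i else 0) = a"
      by (auto simp: exponents_def)
    then show "seg_length (carrier M) {m \<in> carrier M. R.power_prod x n a \<odot>\<^sub>M m \<in>
        W u <+>\<^sub>M monomial_span x n {b \<in> exponents dir n u. lex_less b a}}
      = seg_length (carrier M) (initial_submodule x n dir W a)"
      by (simp add: initial_submodule_def)
  qed
  finally show ?thesis .
qed

text \<open>The length in degree \<open>u\<close> is the sum of the lengths of \<open>M/L\<^sub>a\<close> over the exponents of degree \<open>u\<close>, and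
  \<open>L\<^sub>a\<close> depends on \<open>a\<close> only up to a threshold.\<close>

lemma sep_poly_rees_length:
  fixes dir :: "nat \<Rightarrow> 's::finite"
  assumes acc: acc_submodules and x: "x \<in> {..<n} \<rightarrow> carrier R" and W: "\<And>u. submodule (W u) R M"
    and stable: "\<And>u w c y. c \<in> exponents dir n w \<Longrightarrow> y \<in> W u \<Longrightarrow>
      R.power_prod x n c \<odot>\<^sub>M y \<in> W (\<lambda>l. u l + w l)"
    and WX: "\<And>u. W u \<subseteq> monomial_span x n (exponents dir n u)"
    and fin: "\<And>u. seg_length (monomial_span x n (exponents dir n u)) (W u) \<noteq> \<infinity>"
  shows "sep_poly (\<lambda>u. real (the_enat (seg_length (monomial_span x n (exponents dir n u)) (W u))))"
proof -
  let ?L = "initial_submodule x n dir W"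
  have mono: "?L a \<subseteq> ?L b" if "a \<le> b" for a b
    by (rule initial_submodule_mono [OF x W _ that]) (rule stable)
  have "\<exists>t. \<forall>a. ?L a = ?L (\<lambda>i. min (a i) t)"
  proof (rule monotone_family_threshold [of "{..<n}"])
    show "?L a \<subseteq> ?L b" if "a \<le> b" for a b using that by (rule mono)
    show "\<exists>k0. \<forall>k\<ge>k0. ?L (f k) = ?L (f k0)" if f: "mono f" for f :: "nat \<Rightarrow> nat \<Rightarrow> nat"
    proof -
      have "mono (\<lambda>k. ?L (f k))"
        by (rule monoI) (rule mono [OF monoD [OF f]])
      moreover have "\<forall>k. submodule (?L (f k)) R M" by (intro allI initial_submodule_submodule x W)
      ultimately show ?thesis using acc unfolding acc_submodules_def by (auto dest: spec [of _ "\<lambda>k. ?L (f k)"])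
    qed
    show "?L (\<lambda>i. if i \<in> {..<n} then a i else 0) = ?L a" for a by (rule initial_submodule_restrict [OF x])
  qed simp
  then obtain t where t: "\<And>a. ?L a = ?L (\<lambda>i. min (a i) t)" by blast
  have "sep_poly (\<lambda>u. \<Sum>a\<in>exponents dir n u. real (the_enat (seg_length (carrier M) (?L a))))"
    by (rule sep_poly_sum_exponents [of _ t]) (subst t, rule refl)
  moreover have "real (the_enat (seg_length (monomial_span x n (exponents dir n u)) (W u))) =
      (\<Sum>a\<in>exponents dir n u. real (the_enat (seg_length (carrier M) (?L a))))" for u
    using fin [of u] unfolding seg_length_eq_sum_initial [OF x W WX]
    by (intro the_enat_sum finite_exponents)
  ultimately show ?thesis by simp
qed

lemma rees_length_le:
  assumes x: "x \<in> {..<n} \<rightarrow> carrier R" and W: "\<And>u. submodule (W u) R M"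
    and WX: "\<And>u. W u \<subseteq> monomial_span x n (exponents dir n u)"
    and V: "V \<subseteq> carrier M" "\<And>a m. a \<in> exponents dir n u \<Longrightarrow> m \<in> V \<Longrightarrow> R.power_prod x n a \<odot>\<^sub>M m \<in> W u"
  shows "seg_length (monomial_span x n (exponents dir n u)) (W u) \<le>
    of_nat (card (exponents dir n u)) * seg_length (carrier M) V"
proof -
  have "V \<subseteq> initial_submodule x n dir W a" if a: "a \<in> exponents dir n u" for a
  proof
    fix m assume m: "m \<in> V"
    have "R.power_prod x n a \<odot>\<^sub>M m \<in> W u" using V(2) [OF a m] .
    moreover have "(\<lambda>l. \<Sum>i | i < n \<and> dir i = l. a i) = u" using a by (auto simp: exponents_def)
    ultimately show "m \<in> initial_submodule x n dir W a"
      unfolding initial_submodule_def using V(1) m set_add_upper(1) [OF W submodule_monomial_span [OF x]]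
      by auto
  qed
  then have "(\<Sum>a\<in>exponents dir n u. seg_length (carrier M) (initial_submodule x n dir W a))
      \<le> (\<Sum>a\<in>exponents dir n u. seg_length (carrier M) V)"
    by (intro sum_mono seg_length_mono) auto
  then show ?thesis unfolding seg_length_eq_sum_initial [OF x W WX] by simp
qed

end

section \<open>Prime ideals and systems of parameters\<close>

lemma (in ring) ideal_prod_mono:
  assumes "A \<subseteq> A'" "B \<subseteq> B'"
  shows "A \<cdot> B \<subseteq> A' \<cdot> B'"
proof
  fix x assume "x \<in> A \<cdot> B"
  then show "x \<in> A' \<cdot> B'"
    by induction (use assms in \<open>auto intro: ideal_prod.intros\<close>)
qed

lemma (in ring) ideal_prod_least:
  assumes I: "ideal I R" and "\<And>x y. x \<in> A \<Longrightarrow> y \<in> B \<Longrightarrow> x \<otimes> y \<in> I"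
  shows "A \<cdot> B \<subseteq> I"
proof
  fix x assume "x \<in> A \<cdot> B"
  then show "x \<in> I"
    by induction (use assms additive_subgroup.a_closed [OF ideal.axioms(1) [OF I]] in auto)
qed

lemma (in ring) ideal_add_cancel:
  assumes q: "ideal q R" and "y \<in> q" "x \<in> carrier R" "x \<oplus> y \<in> q"
  shows "x \<in> q"
proof -
  interpret q: ideal q R by (rule q)
  have "(x \<oplus> y) \<oplus> \<ominus> y \<in> q" by (rule q.a_closed [OF assms(4) q.a_inv_closed [OF assms(2)]])
  moreover have "(x \<oplus> y) \<oplus> \<ominus> y = x" using assms(3) q.Icarr [OF assms(2)] by (simp add: a_assoc r_neg)
  ultimately show ?thesis by simp
qed

context noetherian_local_ring
begin

lemma mem_add_principalE:
  assumes "x \<in> I <+>\<^bsub>R\<^esub> PIdl a"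
  obtains i r where "i \<in> I" "r \<in> carrier R" "x = i \<oplus> r \<otimes> a"
  using assms unfolding set_add_def' cgenideal_def by auto

text \<open>Noetherian induction: a proper ideal \<open>I\<close> that is not prime contains a product \<open>a b\<close> of elements outside
  of \<open>I\<close>, and then the product of \<open>I + (a)\<close> and \<open>I + (b)\<close>.\<close>

lemma ideal_prime_induct:
  assumes I: "ideal I R"
    and carrier: "P (carrier R)"
    and prime: "\<And>p. primeideal p R \<Longrightarrow> P p"
    and step: "\<And>I A B. ideal I R \<Longrightarrow> ideal A R \<Longrightarrow> ideal B R \<Longrightarrow> I \<subseteq> A \<Longrightarrow> I \<subseteq> B \<Longrightarrow> A \<cdot> B \<subseteq> I \<Longrightarrow>
      P A \<Longrightarrow> P B \<Longrightarrow> P I"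
  shows "P I"
  using I
proof (rule ideal_induct_noetherian)
  fix I assume I: "ideal I R" and IH: "\<And>I'. ideal I' R \<Longrightarrow> I \<subset> I' \<Longrightarrow> P I'"
  interpret I: ideal I R by (rule I)
  show "P I"
  proof (cases "primeideal I R \<or> carrier R = I")
    case True
    then show ?thesis using carrier prime by blast
  next
    case False
    then have np: "\<not> primeideal I R" and nc: "carrier R \<noteq> I" by auto
    obtain a b where ab: "a \<in> carrier R" "b \<in> carrier R" "a \<otimes> b \<in> I" "a \<notin> I" "b \<notin> I"
      using ideal.primeidealCD [OF I is_cring np] nc by blast
    have ext: "ideal (I <+>\<^bsub>R\<^esub> PIdl c) R" "I \<subset> I <+>\<^bsub>R\<^esub> PIdl c" if c: "c \<in> carrier R" "c \<notin> I" for c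
    proof -
      show "ideal (I <+>\<^bsub>R\<^esub> PIdl c) R" by (intro add_ideals I cgenideal_ideal c)
      have "I \<union> PIdl c \<subseteq> I <+>\<^bsub>R\<^esub> PIdl c"
        using union_genideal [OF I cgenideal_ideal [OF c(1)]]
          genideal_self [of "I \<union> PIdl c"] I.a_subset ideal.Icarr [OF cgenideal_ideal [OF c(1)]] by auto
      then show "I \<subset> I <+>\<^bsub>R\<^esub> PIdl c" using cgenideal_self [OF c(1)] c(2) by blast
    qed
    have "(I <+>\<^bsub>R\<^esub> PIdl a) \<cdot> (I <+>\<^bsub>R\<^esub> PIdl b) \<subseteq> I"
    proof (rule ideal_prod_least [OF I])
      fix x y assume x: "x \<in> I <+>\<^bsub>R\<^esub> PIdl a" and y: "y \<in> I <+>\<^bsub>R\<^esub> PIdl b"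
      obtain i r where i: "i \<in> I" "r \<in> carrier R" "x = i \<oplus> r \<otimes> a" using x by (rule mem_add_principalE)
      obtain j s where j: "j \<in> I" "s \<in> carrier R" "y = j \<oplus> s \<otimes> b" using y by (rule mem_add_principalE)
      have c: "i \<in> carrier R" "j \<in> carrier R" using i j I.Icarr by auto
      have "x \<otimes> y = i \<otimes> y \<oplus> ((r \<otimes> a) \<otimes> j \<oplus> (r \<otimes> s) \<otimes> (a \<otimes> b))"
        using c i j ab by (simp add: l_distr r_distr m_ac a_ac)
      moreover have "i \<otimes> y \<in> I" using i j c ab by (intro I.I_r_closed) auto
      moreover have "(r \<otimes> a) \<otimes> j \<in> I" using i j ab by (intro I.I_l_closed) auto
      moreover have "(r \<otimes> s) \<otimes> (a \<otimes> b) \<in> I" using i j ab by (intro I.I_l_closed [OF ab(3)]) auto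
      ultimately show "x \<otimes> y \<in> I" by (simp add: I.a_closed)
    qed
    then show ?thesis
      using ext [OF ab(1,4)] ext [OF ab(2,5)] IH
      by (intro step [OF I, of "I <+>\<^bsub>R\<^esub> PIdl a" "I <+>\<^bsub>R\<^esub> PIdl b"]) auto
  qed
qed

lemma primeideal_not_carrier:
  assumes "primeideal p R"
  shows "\<not> carrier R \<subseteq> p"
proof -
  have "p \<subseteq> carrier R" using ideal.Icarr [OF primeideal.axioms(1) [OF assms]] by (rule subsetI)
  then show ?thesis using primeideal.I_notcarr [OF assms] by auto
qed

lemma primeideal_subset_maximal: "primeideal p R \<Longrightarrow> p \<subseteq> \<mm>"
  using proper_ideal_subset_maximal [of p] primeideal.I_notcarr [of p R] primeideal.axioms(1) [of p R] by metis

text \<open>A prime that contains \<open>I \<supseteq> A B\<close> contains \<open>A\<close> or \<open>B\<close>, so the finite sets for \<open>A\<close> and \<open>B\<close> can be united.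
  This finite set plays the role of the set of minimal primes.\<close>

lemma finite_primes_below:
  assumes "ideal I R"
  shows "\<exists>F. finite F \<and> (\<forall>p\<in>F. primeideal p R \<and> I \<subseteq> p) \<and>
    (\<forall>p. primeideal p R \<longrightarrow> I \<subseteq> p \<longrightarrow> (\<exists>q\<in>F. q \<subseteq> p))" (is "?P I")
  using assms
proof (rule ideal_prime_induct)
  show "?P (carrier R)"
    using primeideal_not_carrier by (intro exI [of _ "{}"]) auto
next
  fix I assume "primeideal I R"
  then show "?P I"
    by (intro exI [of _ "{I}"]) auto
next
  fix I A B
  assume A: "ideal A R" and B: "ideal B R" and IA: "I \<subseteq> A" and IB: "I \<subseteq> B" and AB: "A \<cdot> B \<subseteq> I"
    and "?P A"
    and "?P B"
  then obtain F G where F: "finite F" "\<And>p. p \<in> F \<Longrightarrow> primeideal p R \<and> A \<subseteq> p"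
      "\<And>p. primeideal p R \<Longrightarrow> A \<subseteq> p \<Longrightarrow> \<exists>q\<in>F. q \<subseteq> p"
    and G: "finite G" "\<And>p. p \<in> G \<Longrightarrow> primeideal p R \<and> B \<subseteq> p"
      "\<And>p. primeideal p R \<Longrightarrow> B \<subseteq> p \<Longrightarrow> \<exists>q\<in>G. q \<subseteq> p" by metis
  have "\<exists>q\<in>F \<union> G. q \<subseteq> p" if p: "primeideal p R" "I \<subseteq> p" for p
  proof -
    have "A \<subseteq> p \<or> B \<subseteq> p" using primeideal_divides_ideal_prod [OF p(1) A B] AB p(2) by blast
    then show ?thesis using F(3) [OF p(1)] G(3) [OF p(1)] by blast
  qed
  moreover have "primeideal p R \<and> I \<subseteq> p" if "p \<in> F \<union> G" for p using that F(2) G(2) IA IB by blast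
  ultimately show "?P I"
    using F(1) G(1) by (intro exI [of _ "F \<union> G"]) auto
qed

lemma power_ideal: "ideal (\<mm> \<up> k) R"
proof -
  interpret IS: comm_monoid "ideals_set R" by (rule ideals_set_is_comm_monoid)
  show ?thesis using IS.nat_pow_closed [of \<mm> k] maximal_is_ideal by (simp add: ideals_set_def)
qed

lemma power_zero: "\<mm> \<up> 0 = carrier R"
  by (simp add: ideals_set_def)

lemma power_one: "\<mm> \<up> 1 = \<mm>"
proof -
  interpret IS: comm_monoid "ideals_set R" by (rule ideals_set_is_comm_monoid)
  show ?thesis using IS.nat_pow_eone [of \<mm>] maximal_is_ideal by (simp add: ideals_set_def)
qed

lemma power_add:
  "\<mm> \<up> (k + l) = (\<mm> \<up> k) \<cdot> (\<mm> \<up> l)"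
proof -
  interpret IS: comm_monoid "ideals_set R" by (rule ideals_set_is_comm_monoid)
  show ?thesis using IS.nat_pow_mult [of \<mm> k l, symmetric] maximal_is_ideal by (simp add: ideals_set_def)
qed

lemma power_antimono:
  assumes "k \<le> l"
  shows "\<mm> \<up> l \<subseteq> \<mm> \<up> k"
  using ideal_prod_inter [OF power_ideal [of k] power_ideal [of "l - k"]] power_add [of k "l - k"] assms by auto

lemma power_subset_if_primes:
  assumes I: "ideal I R" and prime: "\<And>p. primeideal p R \<Longrightarrow> I \<subseteq> p \<Longrightarrow> p = \<mm>"
  shows "\<exists>k::nat. \<mm> \<up> k \<subseteq> I"
proof -
  have "(\<forall>p. primeideal p R \<longrightarrow> I \<subseteq> p \<longrightarrow> p = \<mm>) \<longrightarrow> (\<exists>k::nat. \<mm> \<up> k \<subseteq> I)" (is "?P I")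
    using I
  proof (rule ideal_prime_induct)
    show "?P (carrier R)"
      using power_zero by (intro impI exI [of _ 0]) simp
  next
    fix I assume "primeideal I R"
    then show "?P I"
      using power_one by (intro impI exI [of _ 1]) auto
  next
    fix I A B
    assume IA: "I \<subseteq> A" and IB: "I \<subseteq> B" and AB: "A \<cdot> B \<subseteq> I"
      and 1: "?P A"
      and 2: "?P B"
    show "?P I"
    proof
      assume "\<forall>p. primeideal p R \<longrightarrow> I \<subseteq> p \<longrightarrow> p = \<mm>"
      then have "\<exists>k::nat. \<mm> \<up> k \<subseteq> A" "\<exists>k::nat. \<mm> \<up> k \<subseteq> B"
        using 1 2 IA IB by (meson order_trans)+
      then obtain k l :: nat where "\<mm> \<up> k \<subseteq> A" "\<mm> \<up> l \<subseteq> B" by blast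
      then have "\<mm> \<up> (k + l) \<subseteq> I"
        unfolding power_add using ideal_prod_mono AB by blast
      then show "\<exists>k::nat. \<mm> \<up> k \<subseteq> I" by blast
    qed
  qed
  then show ?thesis using prime by blast
qed

text \<open>A product of elements outside of \<open>p\<close>, one from \<open>I\<close> and one from each \<open>q\<close>.\<close>

lemma prime_separating:
  assumes p: "primeideal p R" and "finite F" and "\<And>q. q \<in> F \<Longrightarrow> ideal q R \<and> \<not> q \<subseteq> p"
    and I: "ideal I R" "\<not> I \<subseteq> p"
  shows "\<exists>y\<in>I. y \<notin> p \<and> (\<forall>q\<in>F. y \<in> q)"
  using assms(2,3)
proof (induction F)
  case empty
  then show ?case using I by blast
next
  case (insert q F)
  then obtain y where y: "y \<in> I" "y \<notin> p" "\<forall>q\<in>F. y \<in> q" by blast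
  obtain z where z: "z \<in> q" "z \<notin> p" and q: "ideal q R" using insert by blast
  have c: "y \<in> carrier R" "z \<in> carrier R"
    using ideal.Icarr [OF I(1) y(1)] ideal.Icarr [OF q z(1)] by auto
  have "y \<otimes> z \<notin> p" using primeideal.I_prime [OF p c] y z by blast
  moreover have "y \<otimes> z \<in> I" by (rule ideal.I_r_closed [OF I(1) y(1) c(2)])
  moreover have "y \<otimes> z \<in> q" by (rule ideal.I_l_closed [OF q z(1) c(1)])
  moreover have "y \<otimes> z \<in> q'" if "q' \<in> F" for q'
    using ideal.I_r_closed [of q' R y z] y(3) c(2) that insert.prems by blast
  ultimately show ?case by blast
qed

text \<open>Members of \<open>F\<close> below other members can be dropped. If then \<open>x\<close> avoids all members but \<open>p\<close>, it is
  corrected by adding an element that lies in all of them except for \<open>p\<close>.\<close>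

lemma prime_avoidance:
  assumes "finite F" and "\<And>p. p \<in> F \<Longrightarrow> primeideal p R \<and> \<not> I \<subseteq> p" and I: "ideal I R"
  shows "\<exists>x\<in>I. \<forall>p\<in>F. x \<notin> p"
  using assms(1,2)
proof (induction F rule: finite_psubset_induct)
  case (psubset F)
  have IH: "\<exists>x\<in>I. \<forall>q\<in>F - {p}. x \<notin> q" if "p \<in> F" for p
    by (rule psubset.IH) (use that psubset.prems in auto)
  consider "F = {}" | p q where "p \<in> F" "q \<in> F" "p \<noteq> q" "q \<subseteq> p"
    | p where "p \<in> F" "\<And>q. q \<in> F \<Longrightarrow> q \<noteq> p \<Longrightarrow> \<not> q \<subseteq> p" by blast
  then show ?case
  proof cases
    case 1
    then show ?thesis using additive_subgroup.zero_closed [OF ideal.axioms(1) [OF I]] by blast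
  next
    case 2
    then show ?thesis using IH [of q] by blast
  next
    case 3
    obtain x where x: "x \<in> I" "\<forall>q\<in>F - {p}. x \<notin> q" using IH [OF 3(1)] by blast
    show ?thesis
    proof (cases "x \<in> p")
      case False
      then show ?thesis using x by blast
    next
      case True
      have p: "primeideal p R" "\<not> I \<subseteq> p" using psubset.prems 3(1) by auto
      have "\<exists>y\<in>I. y \<notin> p \<and> (\<forall>q\<in>F - {p}. y \<in> q)"
      proof (rule prime_separating [OF p(1) _ _ I p(2)])
        show "finite (F - {p})" using psubset.hyps by simp
        show "ideal q R \<and> \<not> q \<subseteq> p" if "q \<in> F - {p}" for q
          using that psubset.prems [of q] 3(2) [of q] primeideal.axioms(1) by blast
      qed
      then obtain y where y: "y \<in> I" "y \<notin> p" "\<forall>q\<in>F - {p}. y \<in> q" by blast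
      have c: "x \<in> carrier R" "y \<in> carrier R" using ideal.Icarr [OF I] x y by auto
      have "x \<oplus> y \<in> I" using x y additive_subgroup.a_closed [OF ideal.axioms(1) [OF I]] by blast
      moreover have "x \<oplus> y \<notin> p"
      proof
        assume "x \<oplus> y \<in> p"
        then have "y \<oplus> x \<in> p" using a_comm [OF c] by simp
        then show False using ideal_add_cancel [OF primeideal.axioms(1) [OF p(1)] True c(2)] y(2) by blast
      qed
      moreover have "x \<oplus> y \<notin> q" if "q \<in> F - {p}" for q
      proof
        assume a: "x \<oplus> y \<in> q"
        have "ideal q R" using that psubset.prems [of q] primeideal.axioms(1) by blast
        then have "x \<in> q" using y(3) that a c(1) by (intro ideal_add_cancel [of q y x]) auto
        then show False using x(2) that by blast
      qed
      ultimately show ?thesis by blast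
    qed
  qed
qed

text \<open>The elements \<open>y\<close> are chosen such that a prime above \<open>I\<^sub>0\<close> and the first \<open>i\<close> of them is \<open>\<mm>\<close> or has a
  chain of \<open>i\<close> primes between \<open>I\<^sub>0\<close> and itself. Among these primes finitely many lie below
  all the others. The next element avoids those of them that differ from \<open>\<mm>\<close>, and this lengthens
  the chains by one. After \<open>D\<close> steps a prime other than \<open>\<mm>\<close> would lead, with
  \<open>\<mm>\<close> on top, to a chain that is too long.\<close>

lemma exists_parameters:
  assumes I0: "ideal I0 R"
    and dim: "\<And>C. (\<forall>i\<le>Suc D. primeideal (C i) R \<and> I0 \<subseteq> C i) \<Longrightarrow> (\<forall>i<Suc D. C i \<subset> C (Suc i)) \<Longrightarrow> False"
  shows "\<exists>y. (\<forall>i<D. y i \<in> \<mm>) \<and> (\<forall>p. primeideal p R \<longrightarrow> I0 \<subseteq> p \<longrightarrow> y ` {..<D} \<subseteq> p \<longrightarrow> p = \<mm>)"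
proof -
  have "\<exists>y. (\<forall>k<i. y k \<in> \<mm>) \<and> (\<forall>p. primeideal p R \<longrightarrow> I0 \<subseteq> p \<longrightarrow> y ` {..<i} \<subseteq> p \<longrightarrow> p \<noteq> \<mm> \<longrightarrow>
      (\<exists>C. (\<forall>k\<le>i. primeideal (C k) R \<and> I0 \<subseteq> C k) \<and> (\<forall>k<i. C k \<subset> C (Suc k)) \<and> C i = p))" for i :: nat
  proof (induction i)
    case 0
    then show ?case by auto
  next
    case (Suc i)
    then obtain y where ym: "\<And>k. k < i \<Longrightarrow> y k \<in> \<mm>"
      and y: "\<And>p. primeideal p R \<Longrightarrow> I0 \<subseteq> p \<Longrightarrow> y ` {..<i} \<subseteq> p \<Longrightarrow> p \<noteq> \<mm> \<Longrightarrow>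
      (\<exists>C. (\<forall>k\<le>i. primeideal (C k) R \<and> I0 \<subseteq> C k) \<and> (\<forall>k<i. C k \<subset> C (Suc k)) \<and> C i = p)" by blast
    let ?S = "I0 \<union> y ` {..<i}"
    have S: "?S \<subseteq> carrier R" using ideal.Icarr [OF I0] ideal.Icarr [OF maximal_is_ideal] ym by auto
    obtain F where F: "finite F" "\<And>p. p \<in> F \<Longrightarrow> primeideal p R \<and> Idl ?S \<subseteq> p"
      "\<And>p. primeideal p R \<Longrightarrow> Idl ?S \<subseteq> p \<Longrightarrow> \<exists>q\<in>F. q \<subseteq> p"
      using finite_primes_below [OF genideal_ideal [OF S]] by metis
    have "\<exists>x\<in>\<mm>. \<forall>p\<in>F - {\<mm>}. x \<notin> p"
    proof (rule prime_avoidance [OF _ _ maximal_is_ideal])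
      show "primeideal p R \<and> \<not> \<mm> \<subseteq> p" if "p \<in> F - {\<mm>}" for p
        using that F(2) [of p] primeideal_subset_maximal [of p] by blast
    qed (use F(1) in simp)
    then obtain x where x: "x \<in> \<mm>" "\<And>p. p \<in> F \<Longrightarrow> p \<noteq> \<mm> \<Longrightarrow> x \<notin> p" by blast
    show ?case
    proof (intro exI [of _ "y(i := x)"] conjI allI impI)
      show "(y(i := x)) k \<in> \<mm>" if "k < Suc i" for k using that ym x by (cases "k = i") auto
      fix p assume p: "primeideal p R" "I0 \<subseteq> p" "y(i := x) ` {..<Suc i} \<subseteq> p" "p \<noteq> \<mm>"
      have "y ` {..<i} \<subseteq> p"
      proof
        fix z assume "z \<in> y ` {..<i}"
        then have "z \<in> y(i := x) ` {..<Suc i}" by auto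
        then show "z \<in> p" using p(3) by blast
      qed
      moreover have xp: "x \<in> p" using p(3) by auto
      ultimately have "Idl ?S \<subseteq> p" using p by (intro genideal_minimal primeideal.axioms(1)) auto
      then obtain q where q: "q \<in> F" "q \<subseteq> p" using F(3) p(1) by blast
      have "q \<noteq> \<mm>" using q(2) p(4) primeideal_subset_maximal [OF p(1)] by blast
      then have "q \<subset> p" using x(2) [OF q(1)] xp q(2) by blast
      have "?S \<subseteq> q" using F(2) [OF q(1)] genideal_self [OF S] by blast
      then obtain C where C: "\<forall>k\<le>i. primeideal (C k) R \<and> I0 \<subseteq> C k" "\<forall>k<i. C k \<subset> C (Suc k)" "C i = q"
        using y [of q] F(2) [OF q(1)] \<open>q \<noteq> \<mm>\<close> by auto
      show "\<exists>C. (\<forall>k\<le>Suc i. primeideal (C k) R \<and> I0 \<subseteq> C k) \<and> (\<forall>k<Suc i. C k \<subset> C (Suc k)) \<and> C (Suc i) = p"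
        using C p(1,2) \<open>q \<subset> p\<close> by (intro exI [of _ "C(Suc i := p)"]) (auto simp: le_Suc_eq less_Suc_eq)
    qed
  qed
  from this [of D] obtain y where ym: "\<forall>k<D. y k \<in> \<mm>"
      and y: "\<And>p. primeideal p R \<Longrightarrow> I0 \<subseteq> p \<Longrightarrow> y ` {..<D} \<subseteq> p \<Longrightarrow> p \<noteq> \<mm> \<Longrightarrow>
      (\<exists>C. (\<forall>k\<le>D. primeideal (C k) R \<and> I0 \<subseteq> C k) \<and> (\<forall>k<D. C k \<subset> C (Suc k)) \<and> C D = p)" by blast
  have "p = \<mm>" if p: "primeideal p R" "I0 \<subseteq> p" "y ` {..<D} \<subseteq> p" for p
  proof (rule ccontr)
    assume ne: "p \<noteq> \<mm>"
    then obtain C where C: "\<forall>k\<le>D. primeideal (C k) R \<and> I0 \<subseteq> C k" "\<forall>k<D. C k \<subset> C (Suc k)" "C D = p"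
      using y [OF p] by blast
    have pm: "p \<subset> \<mm>" using primeideal_subset_maximal [OF p(1)] ne by blast
    show False
    proof (rule dim [of "C(Suc D := \<mm>)"])
      show "\<forall>i\<le>Suc D. primeideal ((C(Suc D := \<mm>)) i) R \<and> I0 \<subseteq> (C(Suc D := \<mm>)) i"
        using C(1) maximalideal_prime [OF maximal] p(2) pm by (auto simp: le_Suc_eq)
      show "\<forall>i<Suc D. (C(Suc D := \<mm>)) i \<subset> (C(Suc D := \<mm>)) (Suc i)"
        using C(2,3) pm by (auto simp: less_Suc_eq)
    qed
  qed
  then show ?thesis using ym by blast
qed

end

context cring
begin

lemma coset_mem_image_iff:
  assumes I: "ideal I R" and P: "ideal P R" "I \<subseteq> P" and x: "x \<in> carrier R"
  shows "I +> x \<in> (+>) I ` P \<longleftrightarrow> x \<in> P"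
proof
  assume "I +> x \<in> (+>) I ` P"
  then obtain y where y: "y \<in> P" "I +> x = I +> y" by blast
  have yc: "y \<in> carrier R" using P(1) y(1) by (rule ideal.Icarr)
  have "x \<ominus> y \<in> P" using quotient_eq_iff_same_a_r_cos [OF I x yc] y(2) P(2) by blast
  then have "(x \<ominus> y) \<oplus> y \<in> P" using y(1) additive_subgroup.a_closed [OF ideal.axioms(1) [OF P(1)]] by blast
  then show "x \<in> P" using x yc by (simp add: a_minus_def a_assoc l_neg)
qed blast

lemma primeideal_quotient:
  assumes I: "ideal I R" and P: "primeideal P R" "I \<subseteq> P"
  shows "primeideal ((+>) I ` P) (R Quot I)"
proof (rule primeidealI)
  note iP = primeideal.axioms(1) [OF P(1)]
  note mem = coset_mem_image_iff [OF I iP P(2)]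
  have carr: "carrier (R Quot I) = (+>) I ` carrier R" by (auto simp: FactRing_def A_RCOSETS_def')
  show "ideal ((+>) I ` P) (R Quot I)" by (rule ring_ideal_imp_quot_ideal [OF I iP])
  show "cring (R Quot I)" by (rule ideal.quotient_is_cring [OF I is_cring])
  show "carrier (R Quot I) \<noteq> (+>) I ` P"
  proof
    assume "carrier (R Quot I) = (+>) I ` P"
    then have "I +> x \<in> (+>) I ` P" if "x \<in> carrier R" for x using that carr by blast
    then have "carrier R \<subseteq> P" using mem by blast
    then show False using primeideal.I_notcarr [OF P(1)] ideal.Icarr [OF iP] by blast
  qed
  fix X Y assume X: "X \<in> carrier (R Quot I)" and Y: "Y \<in> carrier (R Quot I)"
    and XY: "X \<otimes>\<^bsub>R Quot I\<^esub> Y \<in> (+>) I ` P"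
  obtain a b where ab: "a \<in> carrier R" "X = I +> a" "b \<in> carrier R" "Y = I +> b"
    using X Y unfolding carr by blast
  have "X \<otimes>\<^bsub>R Quot I\<^esub> Y = I +> (a \<otimes> b)"
    using ideal.rcoset_mult_add [OF I ab(1,3)] ab by (simp add: FactRing_def)
  then have "a \<otimes> b \<in> P" using XY mem ab by simp
  then have "a \<in> P \<or> b \<in> P" using primeideal.I_prime [OF P(1)] ab by blast
  then show "X \<in> (+>) I ` P \<or> Y \<in> (+>) I ` P" using ab by blast
qed

lemma prime_chain_le_krull_dim_quotient:
  assumes I: "ideal I R" and C: "\<And>i. i \<le> n \<Longrightarrow> primeideal (C i) R" "\<And>i. i \<le> n \<Longrightarrow> I \<subseteq> C i"
    and strict: "\<And>i. i < n \<Longrightarrow> C i \<subset> C (Suc i)"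
  shows "enat n \<le> krull_dim (R Quot I)"
proof -
  have 1: "primeideal ((+>) I ` C i) (R Quot I)" if "i \<le> n" for i
    by (rule primeideal_quotient [OF I C(1) [OF that] C(2) [OF that]])
  have 2: "(+>) I ` C i \<subset> (+>) I ` C (Suc i)" if i: "i < n" for i
  proof -
    obtain x where x: "x \<in> C (Suc i)" "x \<notin> C i" using strict [OF i] by blast
    have 1: "ideal (C (Suc i)) R" and 2: "ideal (C i) R"
      using C(1) [of "Suc i"] C(1) [of i] i primeideal.axioms(1) by auto
    have "x \<in> carrier R" using 1 x(1) by (rule ideal.Icarr)
    then have "I +> x \<notin> (+>) I ` C i"
      using coset_mem_image_iff [OF I 2] C(2) [of i] i x(2) by simp
    then show ?thesis using x(1) strict [OF i] by blast
  qed
  show ?thesis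
    unfolding krull_dim_def enat_le_chain_sup_iff [of "\<lambda>P. primeideal P (R Quot I)", OF 1 [of 0, simplified]]
    using 1 2 by (intro exI [of _ "\<lambda>i. (+>) I ` C i"]) blast
qed

end

section \<open>Products of powers of ideals acting on a module\<close>

lemma multi_index_induct:
  fixes u :: "'s::finite \<Rightarrow> nat"
  assumes zero: "P (\<lambda>_. 0)" and step: "\<And>u l. P u \<Longrightarrow> P (u(l := u l + 1))"
  shows "P u"
proof (induction "multi_deg u" arbitrary: u)
  case 0
  then have "u = (\<lambda>_. 0)" by (auto simp: multi_deg_def)
  then show ?case using zero by simp
next
  case (Suc n)
  then have "(\<Sum>l\<in>UNIV. u l) \<noteq> 0" unfolding multi_deg_def by linarith
  then obtain l where l: "u l > 0" by (meson gr0I sum.not_neutral_contains_not_neutral)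
  have "multi_deg u = u l + (\<Sum>i\<in>UNIV - {l}. u i)"
    unfolding multi_deg_def by (rule sum.remove) auto
  moreover have "multi_deg (u(l := u l - 1)) = u l - 1 + (\<Sum>i\<in>UNIV - {l}. u i)"
    unfolding multi_deg_def by (subst sum.remove [of UNIV l]) auto
  ultimately have "n = multi_deg (u(l := u l - 1))" using Suc.hyps(2) l by linarith
  then have "P (u(l := u l - 1))" by (rule Suc.hyps(1))
  then have "P ((u(l := u l - 1))(l := (u(l := u l - 1)) l + 1))" by (rule step)
  then show ?case using l by simp
qed

lemma multi_deg_add_one: "multi_deg (u(l := u l + 1)) = multi_deg u + 1"
  unfolding multi_deg_def by (subst (1 2) sum.remove [of UNIV l]) auto

context cring
begin

lemma multi_power_ideal:
  assumes "\<And>l. ideal (J l) R"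
  shows "ideal (multi_power R J u) R"
proof -
  interpret IS: comm_monoid "ideals_set R" by (rule ideals_set_is_comm_monoid)
  have "multi_power R J u \<in> carrier (ideals_set R)"
    unfolding multi_power_def using assms
    by (intro IS.finprod_closed Pi_I IS.nat_pow_closed) (simp add: ideals_set_def)
  then show ?thesis by (simp add: ideals_set_def)
qed

lemma multi_power_zero: "multi_power R J (\<lambda>_. 0) = carrier R"
proof -
  interpret IS: comm_monoid "ideals_set R" by (rule ideals_set_is_comm_monoid)
  show ?thesis by (simp add: multi_power_def) (simp add: ideals_set_def)
qed

lemma multi_power_add_one:
  assumes "\<And>l. ideal (J l) R"
  shows "multi_power R J (u(l := u l + 1)) = J l \<cdot> multi_power R J u"
proof -
  interpret IS: comm_monoid "ideals_set R" by (rule ideals_set_is_comm_monoid)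
  have J: "J i \<in> carrier (ideals_set R)" for i using assms by (simp add: ideals_set_def)
  have "multi_power R J (u(l := u l + 1)) = (\<Otimes>\<^bsub>ideals_set R\<^esub>i\<in>UNIV.
      J i [^]\<^bsub>ideals_set R\<^esub> u i \<otimes>\<^bsub>ideals_set R\<^esub> (if l = i then J i else \<one>\<^bsub>ideals_set R\<^esub>))"
    unfolding multi_power_def using J by (intro IS.finprod_cong') auto
  also have "\<dots> = multi_power R J u \<otimes>\<^bsub>ideals_set R\<^esub>
      (\<Otimes>\<^bsub>ideals_set R\<^esub>i\<in>UNIV. if l = i then J i else \<one>\<^bsub>ideals_set R\<^esub>)"
    unfolding multi_power_def using J by (intro IS.finprod_multf) auto
  also have "(\<Otimes>\<^bsub>ideals_set R\<^esub>i\<in>UNIV. if l = i then J i else \<one>\<^bsub>ideals_set R\<^esub>) = J l"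
    using J by (intro IS.finprod_singleton) auto
  finally show ?thesis
    using ideal_prod_commute [OF multi_power_ideal [of J u, OF assms] assms [of l]] by (simp add: ideals_set_def fun_upd_def)
qed

lemma power_subset_multi_power:
  fixes J :: "'s::finite \<Rightarrow> 'a set"
  assumes J: "\<And>l. ideal (J l) R" and \<mm>: "ideal \<mm> R"
    and c: "\<And>l. \<mm> \<up> c \<subseteq> J l"
  shows "\<mm> \<up> (c * multi_deg u) \<subseteq> multi_power R J u"
proof -
  interpret IS: comm_monoid "ideals_set R" by (rule ideals_set_is_comm_monoid)
  have m: "\<mm> \<in> carrier (ideals_set R)" using \<mm> by (simp add: ideals_set_def)
  show ?thesis
  proof (induction u rule: multi_index_induct)
    case 1
    show ?case using ideal.Icarr [of "\<mm> \<up> (c * multi_deg (\<lambda>_::'s. 0))" R]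
        IS.nat_pow_closed [OF m, of "c * multi_deg (\<lambda>_::'s. 0)"]
      unfolding multi_power_zero by (auto simp: ideals_set_def)
  next
    case (2 u l)
    have e: "c * multi_deg (u(l := u l + 1)) = c + c * multi_deg u"
      unfolding multi_deg_add_one by simp
    have "\<mm> \<up> (c * multi_deg (u(l := u l + 1)))
        = (\<mm> \<up> c) \<cdot> (\<mm> \<up> (c * multi_deg u))"
      unfolding e using IS.nat_pow_mult [OF m, of c "c * multi_deg u"] by (simp add: ideals_set_def)
    also have "\<dots> \<subseteq> J l \<cdot> multi_power R J u" by (intro ideal_prod_mono c 2)
    finally show ?case unfolding multi_power_add_one [of J, OF J] .
  qed
qed

lemma power_prod_mem_power:
  assumes \<mm>: "ideal \<mm> R" and y: "y \<in> {..<n} \<rightarrow> \<mm>"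
  shows "power_prod y n b \<in> \<mm> \<up> (\<Sum>i<n. b i)"
  using y
proof (induction n)
  case 0
  show ?case by (simp add: power_prod_def) (simp add: ideals_set_def)
next
  case (Suc n)
  interpret IS: comm_monoid "ideals_set R" by (rule ideals_set_is_comm_monoid)
  have m: "\<mm> \<in> carrier (ideals_set R)" using \<mm> by (simp add: ideals_set_def)
  have mc: "\<mm> \<subseteq> carrier R" using ideal.Icarr [OF \<mm>] by (rule subsetI)
  have yn: "y n \<in> \<mm>" using Suc.prems by auto
  have yc: "y i \<in> carrier R" if "i < Suc n" for i
    using funcset_mem [OF Suc.prems, of i] mc that by auto
  have "y n [^] k \<in> \<mm> \<up> k" for k :: nat
  proof (induction k)
    case 0
    show ?case by simp (simp add: ideals_set_def)
  next
    case (Suc k)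
    have "y n [^] k \<otimes> y n \<in> (\<mm> \<up> k) \<cdot> \<mm>" using Suc yn by (rule ideal_prod.prod)
    then show ?case by (simp add: ideals_set_def)
  qed
  moreover have "power_prod y n b \<in> \<mm> \<up> (\<Sum>i<n. b i)"
    using Suc.prems by (intro Suc.IH) auto
  ultimately have "y n [^] b n \<otimes> power_prod y n b \<in> (\<mm> \<up> b n) \<cdot> (\<mm> \<up> (\<Sum>i<n. b i))"
    by (intro ideal_prod.prod)
  moreover have "power_prod y (Suc n) b = y n [^] b n \<otimes> power_prod y n b"
    unfolding power_prod_def lessThan_Suc using yc by (intro finprod_insert) auto
  moreover have "(\<mm> \<up> b n) \<cdot> (\<mm> \<up> (\<Sum>i<n. b i))
      = \<mm> \<up> (\<Sum>i<Suc n. b i)"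
    using IS.nat_pow_mult [OF m, of "b n" "\<Sum>i<n. b i"] by (simp add: ideals_set_def add.commute)
  ultimately show ?case by simp
qed

end

text \<open>The generators of all \<open>J\<^sub>l\<close> are listed in a single sequence; \<open>dir\<close> remembers the ideal.\<close>

lemma (in noetherian_ring) finite_generators_family:
  fixes J :: "'s::finite \<Rightarrow> 'a set"
  assumes "\<And>l. ideal (J l) R"
  obtains n :: nat and x :: "nat \<Rightarrow> 'a" and dir :: "nat \<Rightarrow> 's"
  where "x \<in> {..<n} \<rightarrow> carrier R" "\<And>l. J l = Idl {x i |i. i < n \<and> dir i = l}"
proof -
  have "\<forall>l. \<exists>A\<subseteq>carrier R. finite A \<and> J l = Idl A" using assms finetely_gen by blast
  then obtain G where G: "\<And>l. G l \<subseteq> carrier R" "\<And>l. finite (G l)" "\<And>l. J l = Idl (G l)" by metis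
  let ?S = "SIGMA l:UNIV. G l"
  have "finite ?S" using G(2) by auto
  then obtain f where f: "bij_betw f {0..<card ?S} ?S" using ex_bij_betw_nat_finite by blast
  then have im: "f ` {0..<card ?S} = ?S" by (simp add: bij_betw_def)
  have "{snd (f i) |i. i < card ?S \<and> fst (f i) = l} = G l" for l
  proof (intro equalityI subsetI)
    fix z assume "z \<in> {snd (f i) |i. i < card ?S \<and> fst (f i) = l}"
    then obtain i where i: "i < card ?S" "fst (f i) = l" "z = snd (f i)" by blast
    have "f i \<in> ?S" using im i(1) by (metis atLeast0LessThan imageI lessThan_iff)
    then show "z \<in> G l" using i by auto
  next
    fix z assume "z \<in> G l"
    then have "(l, z) \<in> f ` {0..<card ?S}" unfolding im by simp
    then obtain i where "i < card ?S" "f i = (l, z)" by auto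
    then show "z \<in> {snd (f i) |i. i < card ?S \<and> fst (f i) = l}" by (intro CollectI exI [of _ i]) auto
  qed
  moreover have "(\<lambda>i. snd (f i)) \<in> {..<card ?S} \<rightarrow> carrier R"
  proof
    fix i assume "i \<in> {..<card ?S}"
    then have "f i \<in> ?S" using im by (metis atLeast0LessThan imageI)
    then have "snd (f i) \<in> G (fst (f i))" by auto
    then show "snd (f i) \<in> carrier R" using G(1) by blast
  qed
  ultimately show ?thesis using that [of "\<lambda>i. snd (f i)" "card ?S" "\<lambda>i. fst (f i)"] G(3) by simp
qed

text \<open>Of \<open>n + 1\<close> exponents with sum \<open>N\<close>, the first \<open>n\<close> are at most \<open>N\<close> and determine the last one.\<close>

lemma card_exponents_unit_le: "card (exponents (\<lambda>_. ()) (Suc n) (\<lambda>_. N)) \<le> (N + 1) ^ n"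
proof (induction n arbitrary: N)
  case 0
  have "(\<Sum>a\<in>exponents (\<lambda>_. ()) (Suc 0) (\<lambda>_. N). 1 :: nat) =
      (\<Sum>v\<le>N. if v = 0 then 1 else 0)"
    unfolding sum_exponents_Suc by (intro sum.cong) (auto simp: exponents_0)
  also have "\<dots> = 1" by (simp add: sum.delta)
  finally show ?case by simp
next
  case (Suc n)
  have "card (exponents (\<lambda>_. ()) (Suc (Suc n)) (\<lambda>_. N)) = (\<Sum>a\<in>exponents (\<lambda>_. ()) (Suc (Suc n)) (\<lambda>_. N). 1)"
    by simp
  also have "\<dots> = (\<Sum>v\<le>N. card (exponents (\<lambda>_. ()) (Suc n) (\<lambda>_. v)))"
    unfolding sum_exponents_Suc [of _ "\<lambda>_. ()" "Suc n"] by (intro sum.cong) (auto simp: fun_upd_def)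
  also have "\<dots> \<le> (\<Sum>v\<le>N. (N + 1) ^ n)"
    by (intro sum_mono order_trans [OF Suc.IH] power_mono) auto
  also have "\<dots> = (N + 1) ^ Suc n" by simp
  finally show ?case .
qed

context module
begin

lemma submodule_ideal_smult:
  assumes "I \<subseteq> carrier R" "N \<subseteq> carrier M"
  shows "submodule (ideal_smult R M I N) R M"
  unfolding ideal_smult_def using assms by (intro submodule_module_span) auto

lemma ideal_smult_mem: "a \<in> I \<Longrightarrow> x \<in> N \<Longrightarrow> a \<odot>\<^sub>M x \<in> ideal_smult R M I N"
  unfolding ideal_smult_def by (rule subsetD [OF module_span_self]) blast

lemma ideal_smult_least:
  assumes "submodule V R M" "\<And>a x. a \<in> I \<Longrightarrow> x \<in> N \<Longrightarrow> a \<odot>\<^sub>M x \<in> V"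
  shows "ideal_smult R M I N \<subseteq> V"
  unfolding ideal_smult_def using assms by (intro module_span_least) auto

lemma ideal_smult_mono: "I \<subseteq> I' \<Longrightarrow> ideal_smult R M I N \<subseteq> ideal_smult R M I' N"
  unfolding ideal_smult_def by (intro module_span_mono) blast

lemma ideal_smult_Idl_least:
  assumes V: "submodule V R M" and A: "A \<subseteq> carrier R" and N: "N \<subseteq> carrier M"
    and AV: "\<And>a x. a \<in> A \<Longrightarrow> x \<in> N \<Longrightarrow> a \<odot>\<^sub>M x \<in> V"
  shows "ideal_smult R M (Idl A) N \<subseteq> V"
proof (rule ideal_smult_least [OF V])
  have "Idl A \<subseteq> {r \<in> carrier R. \<forall>m\<in>N. r \<odot>\<^sub>M m \<in> V}"
    using A AV by (intro R.genideal_minimal ideal_colon V N) auto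
  then show "a \<odot>\<^sub>M x \<in> V" if "a \<in> Idl A" "x \<in> N" for a x using that by blast
qed

lemma ideal_smult_prod:
  assumes I: "ideal I R" and K: "ideal K R"
  shows "ideal_smult R M (I \<cdot> K) (carrier M) = ideal_smult R M I (ideal_smult R M K (carrier M))"
proof
  have IR: "I \<subseteq> carrier R" and KR: "K \<subseteq> carrier R"
    using ideal.Icarr [OF I] ideal.Icarr [OF K] by (auto intro: subsetI)
  have IKR: "I \<cdot> K \<subseteq> carrier R" by (rule R.ideal_prod_in_carrier [OF I K])
  note sK = submodule_ideal_smult [OF KR order_refl]
  note sIK = submodule_ideal_smult [OF IR submodule_subset [OF sK]]
  note sP = submodule_ideal_smult [OF IKR order_refl]
  have "I \<cdot> K \<subseteq> {r \<in> carrier R. \<forall>m\<in>carrier M. r \<odot>\<^sub>M m \<in> ideal_smult R M I (ideal_smult R M K (carrier M))}"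
  proof (rule R.ideal_prod_least [OF ideal_colon [OF sIK order_refl]])
    fix a b assume a: "a \<in> I" and b: "b \<in> K"
    have "(a \<otimes> b) \<odot>\<^sub>M m \<in> ideal_smult R M I (ideal_smult R M K (carrier M))" if m: "m \<in> carrier M" for m
      using ideal_smult_mem [OF a ideal_smult_mem [OF b m]] a b m IR KR by (simp add: smult_assoc1 subset_eq)
    then show "a \<otimes> b \<in> {r \<in> carrier R. \<forall>m\<in>carrier M. r \<odot>\<^sub>M m \<in> ideal_smult R M I (ideal_smult R M K (carrier M))}"
      using a b IR KR by auto
  qed
  then show "ideal_smult R M (I \<cdot> K) (carrier M) \<subseteq> ideal_smult R M I (ideal_smult R M K (carrier M))"
    by (intro ideal_smult_least sIK) blast
  show "ideal_smult R M I (ideal_smult R M K (carrier M)) \<subseteq> ideal_smult R M (I \<cdot> K) (carrier M)"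
  proof (rule ideal_smult_least [OF sP])
    fix a z assume a: "a \<in> I" and z: "z \<in> ideal_smult R M K (carrier M)"
    have ac: "a \<in> carrier R" using a IR by blast
    have "ideal_smult R M K (carrier M) \<subseteq> {z \<in> carrier M. a \<odot>\<^sub>M z \<in> ideal_smult R M (I \<cdot> K) (carrier M)}"
    proof (rule ideal_smult_least)
      show "submodule {z \<in> carrier M. a \<odot>\<^sub>M z \<in> ideal_smult R M (I \<cdot> K) (carrier M)} R M"
        using ac sP carrier_is_submodule by (rule submodule_colon_elements)
      fix b m assume b: "b \<in> K" and m: "m \<in> carrier M"
      have bc: "b \<in> carrier R" using b KR by blast
      have "(a \<otimes> b) \<odot>\<^sub>M m \<in> ideal_smult R M (I \<cdot> K) (carrier M)"
        using ideal_prod.prod [OF a b] m by (rule ideal_smult_mem)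
      then show "b \<odot>\<^sub>M m \<in> {z \<in> carrier M. a \<odot>\<^sub>M z \<in> ideal_smult R M (I \<cdot> K) (carrier M)}"
        using smult_assoc1 [OF ac bc m] bc m by simp
    qed
    then show "a \<odot>\<^sub>M z \<in> ideal_smult R M (I \<cdot> K) (carrier M)" using z by blast
  qed
qed

lemma ideal_smult_carrier: "ideal_smult R M (carrier R) (carrier M) = carrier M"
proof
  show "ideal_smult R M (carrier R) (carrier M) \<subseteq> carrier M"
    by (intro submodule_subset submodule_ideal_smult order_refl)
  show "carrier M \<subseteq> ideal_smult R M (carrier R) (carrier M)"
    using ideal_smult_mem [OF R.one_closed, of _ "carrier M"] by auto
qed

lemma multi_power_smult_submodule:
  assumes "\<And>l. ideal (J l) R"
  shows "submodule (multi_power_smult R M J u) R M"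
  unfolding multi_power_smult_def
  using ideal.Icarr [OF R.multi_power_ideal [of J, OF assms]] by (intro submodule_ideal_smult subsetI)

lemma multi_power_smult_zero: "multi_power_smult R M J (\<lambda>_. 0) = carrier M"
  unfolding multi_power_smult_def R.multi_power_zero by (rule ideal_smult_carrier)

lemma multi_power_smult_add_one:
  assumes "\<And>l. ideal (J l) R"
  shows "multi_power_smult R M J (u(l := u l + 1)) = ideal_smult R M (J l) (multi_power_smult R M J u)"
  unfolding multi_power_smult_def R.multi_power_add_one [of J, OF assms]
  by (intro ideal_smult_prod assms R.multi_power_ideal)

lemma monomial_span_stable:
  assumes x: "x \<in> {..<n} \<rightarrow> carrier R" and c: "c \<in> exponents dir n w"
    and y: "y \<in> monomial_span x n (exponents dir n u)"
  shows "R.power_prod x n c \<odot>\<^sub>M y \<in> monomial_span x n (exponents dir n (\<lambda>l. u l + w l))"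
proof -
  let ?V = "monomial_span x n (exponents dir n (\<lambda>l. u l + w l))"
  have p: "R.power_prod x n a \<in> carrier R" for a using x by (rule R.power_prod_closed)
  have "monomial_span x n (exponents dir n u) \<subseteq> {y \<in> carrier M. R.power_prod x n c \<odot>\<^sub>M y \<in> ?V}"
  proof (rule monomial_span_least)
    show "submodule {y \<in> carrier M. R.power_prod x n c \<odot>\<^sub>M y \<in> ?V} R M"
      using p submodule_monomial_span [OF x] carrier_is_submodule by (rule submodule_colon_elements)
    fix b m assume b: "b \<in> exponents dir n u" and m: "m \<in> carrier M"
    have "R.power_prod x n (\<lambda>i. b i + c i) \<odot>\<^sub>M m \<in> ?V"
      using exponents_add [OF b c] m by (rule monomial_span_mem)
    moreover have "R.power_prod x n (\<lambda>i. b i + c i) = R.power_prod x n c \<otimes> R.power_prod x n b"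
      using R.power_prod_add [OF x, of b c] R.m_comm [OF p p] by simp
    ultimately show "R.power_prod x n b \<odot>\<^sub>M m \<in> {y \<in> carrier M. R.power_prod x n c \<odot>\<^sub>M y \<in> ?V}"
      using p m by (simp add: smult_assoc1)
  qed
  then show ?thesis using y by blast
qed

end

lemma exponents_unit_vector:
  assumes "i < n" "dir i = l"
  shows "(\<lambda>j. if j = i then 1 else 0) \<in> exponents dir n (\<lambda>k. if k = l then 1 else 0)"
proof -
  have "(\<Sum>j | j < n \<and> dir j = k. if j = i then 1 else 0) = (if k = l then 1 else 0 :: nat)" for k
    using assms by (simp add: sum.delta)
  then show ?thesis using assms by (auto simp: exponents_def)
qed

lemma add_unit_vector: "(\<lambda>k. u k + (if k = l then 1 else 0)) = u(l := u l + 1 :: nat)"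
  by auto

lemma exponents_decrease:
  assumes b: "b \<in> exponents dir n (u(l := u l + 1))"
  obtains i b' where "i < n" "dir i = l" "b' \<in> exponents dir n u" "b = (\<lambda>j. b' j + (if j = i then 1 else 0))"
proof -
  have "(\<Sum>i | i < n \<and> dir i = l. b i) = u l + 1" using b by (simp add: exponents_def)
  then have ne: "(\<Sum>i | i < n \<and> dir i = l. b i) \<noteq> 0" by simp
  have "\<exists>i<n. dir i = l \<and> b i > 0"
  proof (rule ccontr)
    assume "\<not> ?thesis"
    then have "(\<Sum>i | i < n \<and> dir i = l. b i) = 0" by (intro sum.neutral) auto
    then show False using ne by blast
  qed
  then obtain i where i: "i < n" "dir i = l" "b i > 0" by blast
  define b' where "b' = b(i := b i - 1)"
  have bb': "b = (\<lambda>j. b' j + (if j = i then 1 else 0))" using i by (auto simp: b'_def)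
  have 1: "(\<Sum>j | j < n \<and> dir j = k. b j) = (\<Sum>j | j < n \<and> dir j = k. b' j) + (if k = l then 1 else 0)" for k
    using i by (subst bb') (simp add: sum.distrib sum.delta)
  have 2: "(\<Sum>j | j < n \<and> dir j = k. b j) = (u(l := u l + 1)) k" for k using b by (simp add: exponents_def)
  have "(\<Sum>j | j < n \<and> dir j = k. b' j) = u k" for k
    using 1 [of k] 2 [of k] by (cases "k = l") simp_all
  moreover have "\<forall>j\<ge>n. b' j = 0" using b i by (auto simp: b'_def exponents_def)
  ultimately have "b' \<in> exponents dir n u" by (simp add: exponents_def)
  then show ?thesis using that i bb' by blast
qed

context module
begin

lemma power_prod_shift:
  assumes x: "x \<in> {..<n} \<rightarrow> carrier R" and "i < n"
  shows "R.power_prod x n (\<lambda>j. b j + (if j = i then 1 else 0)) = x i \<otimes> R.power_prod x n b"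
  using R.power_prod_add [OF x, of b "\<lambda>j. if j = i then 1 else 0"] R.power_prod_single [OF x \<open>i < n\<close>]
    R.m_comm [OF R.power_prod_closed [OF x, of b], of "x i"] assms by auto

lemma monomial_span_antimono:
  assumes x: "x \<in> {..<n} \<rightarrow> carrier R"
  shows "monomial_span x n (exponents dir n (u(l := u l + 1))) \<subseteq> monomial_span x n (exponents dir n u)"
proof (rule monomial_span_least [OF submodule_monomial_span [OF x]])
  fix b m assume b: "b \<in> exponents dir n (u(l := u l + 1))" and m: "m \<in> carrier M"
  obtain i b' where i: "i < n" "dir i = l" and b': "b' \<in> exponents dir n u" "b = (\<lambda>j. b' j + (if j = i then 1 else 0))"
    using b by (rule exponents_decrease)
  have xi: "x i \<in> carrier R" using x i by auto
  have p: "R.power_prod x n b' \<in> carrier R" using x by (rule R.power_prod_closed)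
  have "R.power_prod x n b' \<odot>\<^sub>M (x i \<odot>\<^sub>M m) \<in> monomial_span x n (exponents dir n u)"
    using b'(1) xi m by (intro monomial_span_mem) auto
  also have "R.power_prod x n b' \<odot>\<^sub>M (x i \<odot>\<^sub>M m) = R.power_prod x n b \<odot>\<^sub>M m"
    unfolding b'(2) power_prod_shift [OF x i(1)] using xi p m by (simp add: smult_assoc1 [symmetric] R.m_comm)
  finally show "R.power_prod x n b \<odot>\<^sub>M m \<in> monomial_span x n (exponents dir n u)" .
qed

text \<open>This presents \<open>J\<^sup>u M\<close> as the part of degree \<open>u\<close> of a Rees module.\<close>

lemma multi_power_smult_eq_monomial_span:
  assumes x: "x \<in> {..<n} \<rightarrow> carrier R" and J: "\<And>l. ideal (J l) R"
    and gen: "\<And>l. J l = Idl {x i |i. i < n \<and> dir i = l}"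
  shows "multi_power_smult R M J u = monomial_span x n (exponents dir n u)"
proof (induction u rule: multi_index_induct)
  case 1
  have "m \<in> monomial_span x n (exponents dir n (\<lambda>_. 0))" if m: "m \<in> carrier M" for m
    using monomial_span_mem [of "\<lambda>_. 0" "exponents dir n (\<lambda>_. 0)" m x n] m
    by (simp add: exponents_def R.power_prod_zero)
  then show ?case
    unfolding multi_power_smult_zero using submodule_subset [OF submodule_monomial_span [OF x]] by blast
next
  case (2 u l)
  let ?X = "monomial_span x n (exponents dir n u)"
  let ?X' = "monomial_span x n (exponents dir n (u(l := u l + 1)))"
  note sX = submodule_monomial_span [OF x, of "exponents dir n u"]
  have "multi_power_smult R M J (u(l := u l + 1)) = ideal_smult R M (J l) ?X"
    using multi_power_smult_add_one [of J u l, OF J] 2 by simp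
  also have "\<dots> = ?X'"
  proof
    have S: "{x i |i. i < n \<and> dir i = l} \<subseteq> carrier R" using x by auto
    show "ideal_smult R M (J l) ?X \<subseteq> ?X'"
      unfolding gen [of l]
    proof (rule ideal_smult_Idl_least [OF submodule_monomial_span [OF x] S submodule_subset [OF sX]])
      fix a y assume "a \<in> {x i |i. i < n \<and> dir i = l}" and y: "y \<in> ?X"
      then obtain i where i: "i < n" "dir i = l" "a = x i" by blast
      show "a \<odot>\<^sub>M y \<in> ?X'"
        using monomial_span_stable [OF x exponents_unit_vector [of i n dir l, OF i(1,2)] y]
        unfolding R.power_prod_single [OF x i(1)] add_unit_vector i(3) .
    qed
    show "?X' \<subseteq> ideal_smult R M (J l) ?X"
    proof (rule monomial_span_least)
      show "submodule (ideal_smult R M (J l) ?X) R M"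
        using ideal.Icarr [OF J [of l]] submodule_subset [OF sX] by (intro submodule_ideal_smult subsetI) auto
      fix b m assume b: "b \<in> exponents dir n (u(l := u l + 1))" and m: "m \<in> carrier M"
      obtain i b' where i: "i < n" "dir i = l" and b': "b' \<in> exponents dir n u" "b = (\<lambda>j. b' j + (if j = i then 1 else 0))"
        using b by (rule exponents_decrease)
      have xi: "x i \<in> carrier R" using x i by auto
      have p: "R.power_prod x n b' \<in> carrier R" using x by (rule R.power_prod_closed)
      have "x i \<in> J l" unfolding gen [of l] using i R.genideal_self [OF S] by blast
      then have "x i \<odot>\<^sub>M (R.power_prod x n b' \<odot>\<^sub>M m) \<in> ideal_smult R M (J l) ?X"
        by (rule ideal_smult_mem [OF _ monomial_span_mem [OF b'(1) m]])
      also have "x i \<odot>\<^sub>M (R.power_prod x n b' \<odot>\<^sub>M m) = R.power_prod x n b \<odot>\<^sub>M m"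
        unfolding b'(2) power_prod_shift [OF x i(1)] using xi p m by (simp add: smult_assoc1)
      finally show "R.power_prod x n b \<odot>\<^sub>M m \<in> ideal_smult R M (J l) ?X" .
    qed
  qed
  finally show ?case .
qed

text \<open>Here \<open>lam\<close> bounds the length of \<open>M/(y)M\<close>. The quotient \<open>(y)\<^sup>k M/(y)\<^bsup>k+1\<^esup>M\<close> is covered by copies of
  \<open>M/(y)M\<close>, one for each monomial of degree \<open>k\<close> in \<open>D\<close> variables; there are at most
  \<open>(k + 1)\<^bsup>D-1\<^esup>\<close> of these.\<close>

lemma seg_length_powers_le:
  assumes y: "y \<in> {..<D} \<rightarrow> carrier R" and "D \<ge> 1"
    and lam: "seg_length (carrier M) (monomial_span y D (exponents (\<lambda>_. ()) D (\<lambda>_. 1))) \<le> enat lam"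
  shows "seg_length (carrier M) (monomial_span y D (exponents (\<lambda>_. ()) D (\<lambda>_. N))) \<le> enat (N ^ D * lam)"
proof -
  define Y where "Y u = monomial_span y D (exponents (\<lambda>_. ()) D u)" for u
  have sY: "submodule (Y u) R M" for u unfolding Y_def by (rule submodule_monomial_span [OF y])
  have upd: "(\<lambda>_::unit. k)(() := (\<lambda>_. k) () + 1) = (\<lambda>_. k + 1)" for k :: nat by auto
  have anti: "Y (\<lambda>_. u () + 1) \<subseteq> Y u" for u
  proof -
    have "u(() := u () + 1) = (\<lambda>_. u () + 1)" by auto
    then show ?thesis using monomial_span_antimono [OF y, of "\<lambda>_. ()" u "()"] unfolding Y_def by simp
  qed
  have step: "seg_length (Y (\<lambda>_. k)) (Y (\<lambda>_. k + 1)) \<le> enat ((k + 1) ^ (D - 1) * lam)" for k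
  proof -
    have "seg_length (Y (\<lambda>_. k)) (Y (\<lambda>_. k + 1)) \<le>
        of_nat (card (exponents (\<lambda>_. ()) D (\<lambda>_. k))) * seg_length (carrier M) (Y (\<lambda>_. 1))"
      using rees_length_le [of y D "\<lambda>u. Y (\<lambda>_. u () + 1)" "\<lambda>_. ()" "Y (\<lambda>_. 1)" "\<lambda>_. k", folded Y_def, OF y sY anti submodule_subset [OF sY]]
        monomial_span_stable [OF y, of _ "\<lambda>_. ()" "\<lambda>_. k" _ "\<lambda>_. 1"] unfolding Y_def by (simp add: add.commute)
    also have "\<dots> \<le> of_nat (card (exponents (\<lambda>_. ()) D (\<lambda>_. k))) * enat lam"
      using lam unfolding Y_def by (intro mult_left_mono) auto
    also have "\<dots> = enat (card (exponents (\<lambda>_. ()) D (\<lambda>_. k)) * lam)" by (simp add: of_nat_eq_enat)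
    also have "\<dots> \<le> enat ((k + 1) ^ (D - 1) * lam)"
      using card_exponents_unit_le [of "D - 1" k] \<open>D \<ge> 1\<close> by simp
    finally show ?thesis .
  qed
  have "seg_length (carrier M) (Y (\<lambda>_. k)) \<le> enat ((\<Sum>i<k. (i + 1) ^ (D - 1)) * lam)" for k
  proof (induction k)
    case 0
    have "m \<in> Y (\<lambda>_. 0)" if m: "m \<in> carrier M" for m
      using monomial_span_mem [of "\<lambda>_. 0" "exponents (\<lambda>_. ()) D (\<lambda>_. 0)" m y D] m
      by (simp add: Y_def exponents_def R.power_prod_zero)
    then have "Y (\<lambda>_. 0) = carrier M" using submodule_subset [OF sY] by blast
    then show ?case by (simp add: seg_length_self zero_enat_def)
  next
    case (Suc k)
    have "seg_length (carrier M) (Y (\<lambda>_. Suc k)) =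
        seg_length (carrier M) (Y (\<lambda>_. k)) + seg_length (Y (\<lambda>_. k)) (Y (\<lambda>_. Suc k))"
      using anti [of "\<lambda>_. k"] submodule_subset [OF sY]
      by (intro seg_length_add carrier_is_submodule sY) auto
    also have "\<dots> \<le> enat ((\<Sum>i<k. (i + 1) ^ (D - 1)) * lam) + enat ((k + 1) ^ (D - 1) * lam)"
      using Suc step [of k] by (intro add_mono) auto
    also have "\<dots> = enat ((\<Sum>i<Suc k. (i + 1) ^ (D - 1)) * lam)" by (simp add: distrib_right)
    finally show ?case .
  qed
  from this [of N] have "seg_length (carrier M) (Y (\<lambda>_. N)) \<le> enat ((\<Sum>i<N. (i + 1) ^ (D - 1)) * lam)" .
  also have "(\<Sum>i<N. (i + 1) ^ (D - 1)) \<le> (\<Sum>i<N. N ^ (D - 1))" by (intro sum_mono power_mono) auto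
  then have "(\<Sum>i<N. (i + 1) ^ (D - 1)) \<le> N ^ D"
    using \<open>D \<ge> 1\<close> by (simp add: power_eq_if [of N D])
  then have "enat ((\<Sum>i<N. (i + 1) ^ (D - 1)) * lam) \<le> enat (N ^ D * lam)" by simp
  finally show ?thesis unfolding Y_def .
qed

end

section \<open>The Hilbert-Samuel polynomial and the mixed multiplicities\<close>

text \<open>A prime above \<open>Q\<close> contains the radical \<open>\<mm>\<close> of \<open>Q\<close>.\<close>

lemma (in noetherian_local_ring) power_subset_primary:
  assumes "primary_to R \<mm> Q"
  shows "\<exists>k::nat. \<mm> \<up> k \<subseteq> Q"
proof (rule power_subset_if_primes)
  have Q: "primary_ideal Q R" and rad: "radical_ideal R Q = \<mm>"
    using assms by (auto simp: primary_to_def)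
  show "ideal Q R" using Q by (rule primary_ideal.axioms)
  fix p assume p: "primeideal p R" and Qp: "Q \<subseteq> p"
  have pow: "x \<in> p" if x: "x \<in> carrier R" "x [^] n \<in> p" for x and n :: nat
    using x(2)
  proof (induction n)
    case 0
    then have "carrier R \<subseteq> p"
      using ideal.one_imp_carrier [OF primeideal.axioms(1) [OF p]] by simp
    then show ?case using primeideal_not_carrier [OF p] by blast
  next
    case (Suc n)
    then have "x [^] n \<otimes> x \<in> p" by simp
    then have "x [^] n \<in> p \<or> x \<in> p" using primeideal.I_prime [OF p _ x(1)] x(1) by simp
    then show ?case using Suc.IH by blast
  qed
  have "\<mm> \<subseteq> p"
  proof
    fix x assume "x \<in> \<mm>"
    then obtain n :: nat where "x \<in> carrier R" "x [^] n \<in> Q" unfolding rad [symmetric] radical_ideal_def by blast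
    then show "x \<in> p" using pow Qp by blast
  qed
  then show "p = \<mm>" using primeideal_subset_maximal [OF p] by blast
qed

context module
begin

lemma annihilator_ideal: "ideal (annihilator R M) R"
proof -
  have "submodule {\<zero>\<^sub>M} R M" by (rule submoduleI) auto
  then have "ideal {r \<in> carrier R. \<forall>m\<in>carrier M. r \<odot>\<^sub>M m \<in> {\<zero>\<^sub>M}} R"
    by (rule ideal_colon) (rule order_refl)
  then show ?thesis by (simp add: annihilator_def)
qed

text \<open>For a system \<open>y\<close> of \<open>D\<close> parameters, a submodule that contains \<open>\<mm>\<^sup>k M\<close> contains \<open>(y)\<^sup>k M\<close>. Modulo the
  annihilator of \<open>M\<close> some power of \<open>\<mm>\<close> lies in \<open>(y)\<close>, so \<open>M/(y)M\<close> has finite length.\<close>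

lemma seg_length_powers_growth:
  assumes loc: "noetherian_local_ring R \<mm>" and acc: acc_submodules
    and dim: "module_dim R M = enat D" and "D \<ge> 1"
  obtains lam where "\<And>W k. submodule W R M \<Longrightarrow>
    (\<And>a m. a \<in> \<mm> \<up> k \<Longrightarrow> m \<in> carrier M \<Longrightarrow> a \<odot>\<^sub>M m \<in> W) \<Longrightarrow>
    seg_length (carrier M) W \<le> enat (k ^ D * lam)"
proof -
  interpret loc: noetherian_local_ring R \<mm> by (rule loc)
  let ?A = "annihilator R M"
  have "\<exists>y. (\<forall>i<D. y i \<in> \<mm>) \<and> (\<forall>p. primeideal p R \<longrightarrow> ?A \<subseteq> p \<longrightarrow> y ` {..<D} \<subseteq> p \<longrightarrow> p = \<mm>)"
  proof (rule loc.exists_parameters [OF annihilator_ideal])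
    fix C assume C: "\<forall>i\<le>Suc D. primeideal (C i) R \<and> ?A \<subseteq> C i" "\<forall>i<Suc D. C i \<subset> C (Suc i)"
    have "enat (Suc D) \<le> krull_dim (R Quot ?A)"
      using C by (intro R.prime_chain_le_krull_dim_quotient [OF annihilator_ideal, of "Suc D" C]) auto
    then show False using dim by (simp add: module_dim_def)
  qed
  then obtain y where ym: "\<And>i. i < D \<Longrightarrow> y i \<in> \<mm>"
    and y: "\<And>p. primeideal p R \<Longrightarrow> ?A \<subseteq> p \<Longrightarrow> y ` {..<D} \<subseteq> p \<Longrightarrow> p = \<mm>" by blast
  have mc: "\<mm> \<subseteq> carrier R" using ideal.Icarr [OF loc.maximal_is_ideal] by (rule subsetI)
  have ymP: "y \<in> {..<D} \<rightarrow> \<mm>" using ym by auto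
  have yc: "y \<in> {..<D} \<rightarrow> carrier R" using ym mc by auto
  let ?S = "?A \<union> y ` {..<D}"
  have S: "?S \<subseteq> carrier R" using yc by (auto simp: annihilator_def)
  define Y where "Y N = monomial_span y D (exponents (\<lambda>_. ()) D (\<lambda>_. N))" for N
  have sY: "submodule (Y N) R M" for N unfolding Y_def by (rule submodule_monomial_span [OF yc])
  have "\<exists>k::nat. \<mm> \<up> k \<subseteq> Idl ?S"
    using y R.genideal_self [OF S] by (intro loc.power_subset_if_primes R.genideal_ideal S) blast
  then obtain k :: nat where k: "\<mm> \<up> k \<subseteq> Idl ?S" by blast
  have "Idl ?S \<subseteq> {r \<in> carrier R. \<forall>m\<in>carrier M. r \<odot>\<^sub>M m \<in> Y 1}"
  proof (rule R.genideal_minimal [OF ideal_colon [OF sY order_refl]])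
    have "y i \<odot>\<^sub>M m \<in> Y 1" if i: "i < D" and m: "m \<in> carrier M" for i m
    proof -
      have "(\<lambda>j. if j = i then 1 else 0) \<in> exponents (\<lambda>_. ()) D (\<lambda>_. 1)"
        using exponents_unit_vector [of i D "\<lambda>_. ()" "()"] i by simp
      then have "R.power_prod y D (\<lambda>j. if j = i then 1 else 0) \<odot>\<^sub>M m \<in> Y 1"
        unfolding Y_def using m by (rule monomial_span_mem)
      then show ?thesis unfolding R.power_prod_single [OF yc i] .
    qed
    moreover have "a \<odot>\<^sub>M m \<in> Y 1" if "a \<in> ?A" "m \<in> carrier M" for a m
      using that submodule_zero [OF sY] by (simp add: annihilator_def)
    ultimately show "?S \<subseteq> {r \<in> carrier R. \<forall>m\<in>carrier M. r \<odot>\<^sub>M m \<in> Y 1}" using S by auto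
  qed
  then have "seg_length (carrier M) (Y 1) \<noteq> \<infinity>"
    using k by (intro seg_length_finite [OF loc acc sY, of k]) blast
  then obtain lam where "seg_length (carrier M) (Y 1) = enat lam" by auto
  then have bound: "seg_length (carrier M) (Y N) \<le> enat (N ^ D * lam)" for N
    unfolding Y_def by (intro seg_length_powers_le [OF yc \<open>D \<ge> 1\<close>]) simp
  show ?thesis
  proof (rule that)
    fix W and k :: nat
    assume W: "submodule W R M" and k: "\<And>a m. a \<in> \<mm> \<up> k \<Longrightarrow> m \<in> carrier M \<Longrightarrow> a \<odot>\<^sub>M m \<in> W"
    have "Y k \<subseteq> W"
      unfolding Y_def
    proof (rule monomial_span_least [OF W])
      fix b m assume b: "b \<in> exponents (\<lambda>_. ()) D (\<lambda>_. k)" and m: "m \<in> carrier M"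
      have "(\<Sum>i<D. b i) = k" using b by (simp add: exponents_def lessThan_def)
      then have "R.power_prod y D b \<in> \<mm> \<up> k"
        using R.power_prod_mem_power [OF loc.maximal_is_ideal ymP, of b] by simp
      then show "R.power_prod y D b \<odot>\<^sub>M m \<in> W" using m by (rule k)
    qed
    then have "seg_length (carrier M) W \<le> seg_length (carrier M) (Y k)" by (intro seg_length_mono) auto
    also have "\<dots> \<le> enat (k ^ D * lam)" by (rule bound)
    finally show "seg_length (carrier M) W \<le> enat (k ^ D * lam)" .
  qed
qed

text \<open>The Hilbert-Samuel function has differences given by graded pieces of Rees modules, hence it
  is a sum of products of eventually polynomial functions; the growth bound limits the
  degree of its polynomial. Since \<open>\<mm>\<^bsup>r+1\<^esup>\<close> is contained in \<open>J\<^sub>j\<close> for large \<open>r\<close>, the differences of this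
  function are also the values of the directional Hilbert function.\<close>

lemma samuel_polynomial:
  fixes J :: "'s::finite \<Rightarrow> 'a set"
  assumes loc: "noetherian_local_ring R \<mm>" and fg: "fin_gen_module R M"
    and dim: "module_dim R M = enat D" and "D \<ge> 1" and J: "\<And>l. primary_to R \<mm> (J l)"
  obtains P where "agrees_with (samuel_fun R M J) P"
    and "\<And>a. a \<in> Poly_Mapping.keys P \<Longrightarrow> multi_deg a \<le> D"
    and "\<And>j. agrees_with (dir_hilbert_fun R \<mm> M J j) (difference_mpol j P)"
proof -
  interpret loc: noetherian_local_ring R \<mm> by (rule loc)
  have acc: acc_submodules using loc.noetherian_ring_axioms fg by (rule acc_submodules_fin_gen)
  have iJ: "ideal (J l) R" for l using J [of l] by (auto simp: primary_to_def intro: primary_ideal.axioms)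
  obtain kk :: "'s \<Rightarrow> nat" where kk: "\<And>l. \<mm> \<up> kk l \<subseteq> J l"
    using loc.power_subset_primary [OF J] by metis
  define c where "c = Max (range kk)"
  have c: "\<mm> \<up> k \<subseteq> J l" if "c \<le> k" for k l
  proof -
    have "kk l \<le> k" using that by (simp add: c_def)
    then show ?thesis using loc.power_antimono kk by blast
  qed
  obtain n :: nat and x dir where x: "x \<in> {..<n} \<rightarrow> carrier R"
    and gen: "\<And>l. J l = Idl {x i |i. i < n \<and> dir i = l}"
    by (rule loc.finite_generators_family [of J, OF iJ]) blast
  let ?N = "multi_power_smult R M J"
  let ?f = "\<lambda>u. seg_length (carrier M) (?N u)"
  note mps = multi_power_smult_eq_monomial_span [of x n J dir, OF x iJ gen]
  have sN: "submodule (?N u) R M" for u by (rule multi_power_smult_submodule [of J, OF iJ])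
  obtain lam where lam: "\<And>W k. submodule W R M \<Longrightarrow>
    (\<And>a m. a \<in> \<mm> \<up> k \<Longrightarrow> m \<in> carrier M \<Longrightarrow> a \<odot>\<^sub>M m \<in> W) \<Longrightarrow>
    seg_length (carrier M) W \<le> enat (k ^ D * lam)"
    using seg_length_powers_growth [OF loc acc dim \<open>D \<ge> 1\<close>] by blast
  have bound: "?f u \<le> enat ((c * multi_deg u) ^ D * lam)" for u
  proof (rule lam [OF sN])
    fix a m assume a: "a \<in> \<mm> \<up> (c * multi_deg u)" and m: "m \<in> carrier M"
    have "a \<in> multi_power R J u"
      using R.power_subset_multi_power [of J \<mm> c u, OF iJ loc.maximal_is_ideal c] a by blast
    then show "a \<odot>\<^sub>M m \<in> ?N u" unfolding multi_power_smult_def using m by (rule ideal_smult_mem)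
  qed
  then have fin: "?f u \<noteq> \<infinity>" for u by (metis enat_ord_simps(5) infinity_ileE)
  define h where "h u = the_enat (?f u)" for u
  have h: "?f u = enat (h u)" for u using fin [of u] by (auto simp: h_def)
  have sub: "?N (u(l := u l + 1)) \<subseteq> ?N u" for u l unfolding mps by (rule monomial_span_antimono [OF x])
  have diff: "?f (u(l := u l + 1)) = ?f u + seg_length (?N u) (?N (u(l := u l + 1)))" for u l
    using sub submodule_subset [OF sN] by (intro seg_length_add carrier_is_submodule sN)
  have dfin: "seg_length (?N u) (?N (u(l := u l + 1))) = enat (h (u(l := u l + 1)) - h u)"
    and hmono: "h u \<le> h (u(l := u l + 1))" for u l
    using diff [of u l] unfolding h by (cases "seg_length (?N u) (?N (u(l := u l + 1)))"; simp)+
  have "sep_poly (\<lambda>u. real (h u))"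
  proof (rule sep_poly_of_differences)
    fix l
    have "sep_poly (\<lambda>u. real (the_enat (seg_length (monomial_span x n (exponents dir n u))
        (?N (u(l := u l + 1))))))"
    proof (rule sep_poly_rees_length [OF acc x])
      show "?N (u(l := u l + 1)) \<subseteq> monomial_span x n (exponents dir n u)" for u
        using sub [of u l] mps [of u] by simp
      show "seg_length (monomial_span x n (exponents dir n u)) (?N (u(l := u l + 1))) \<noteq> \<infinity>" for u
        using dfin [of u l] mps [of u] by simp
      show "R.power_prod x n e \<odot>\<^sub>M y \<in> ?N ((\<lambda>l. u l + w l)(l := (\<lambda>l. u l + w l) l + 1))"
        if "e \<in> exponents dir n w" "y \<in> ?N (u(l := u l + 1))" for u w e y
      proof -
        have "(\<lambda>k. (u(l := u l + 1)) k + w k) = (\<lambda>l. u l + w l)(l := (\<lambda>l. u l + w l) l + 1)" by auto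
        then show ?thesis using monomial_span_stable [OF x that(1), of y "u(l := u l + 1)"] that(2) unfolding mps by simp
      qed
    qed (rule sN)
    moreover have "real (the_enat (seg_length (monomial_span x n (exponents dir n u)) (?N (u(l := u l + 1)))))
        = real (h (u(l := u l + 1))) - real (h u)" for u
      unfolding mps [symmetric] dfin using hmono [of u l] by (simp add: of_nat_diff)
    ultimately show "sep_poly (\<lambda>u. real (h (u(l := u l + 1))) - real (h u))" by simp
  qed
  then obtain P N where P: "\<And>u. (\<And>v. N \<le> u v) \<Longrightarrow> real (h u) = mpol_eval P (\<lambda>v. real (u v))"
    using sep_poly_imp_mpol by metis
  show ?thesis
  proof (rule that)
    show "agrees_with (samuel_fun R M J) P"
      unfolding agrees_with_def
    proof (rule exI [of _ N], intro allI impI)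
      fix u :: "'s \<Rightarrow> nat" assume "\<forall>v. N \<le> u v"
      then have "real (h u) = mpol_eval P (\<lambda>v. real (u v))" by (intro P) blast
      moreover have "samuel_fun R M J u = enat (h u)"
        unfolding samuel_fun_def h [symmetric]
        by (rule quot_length_eq_seg_length [OF carrier_is_submodule sN submodule_subset [OF sN]])
      ultimately show "\<exists>n. samuel_fun R M J u = enat n \<and> real n = mpol_eval P (\<lambda>v. real (u v))" by blast
    qed
    show "multi_deg a \<le> D" if "a \<in> Poly_Mapping.keys P" for a
    proof (rule mpol_degree_le_if_bounded [OF _ _ that])
      fix u :: "'s \<Rightarrow> nat" assume u: "\<And>v. N \<le> u v"
      have e: "mpol_eval P (\<lambda>v. real (u v)) = real (h u)" by (rule P [symmetric]) (rule u)
      show "0 \<le> mpol_eval P (\<lambda>v. real (u v))" unfolding e by simp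
      have "h u \<le> (c * multi_deg u) ^ D * lam" using bound [of u] unfolding h by simp
      then have "real (h u) \<le> real ((c * multi_deg u) ^ D * lam)" by (rule of_nat_mono)
      then show "mpol_eval P (\<lambda>v. real (u v)) \<le> (real (c ^ D * lam)) * real (multi_deg u) ^ D"
        unfolding e by (simp add: power_mult_distrib mult.commute mult.left_commute)
    qed
    show "agrees_with (dir_hilbert_fun R \<mm> M J j) (difference_mpol j P)" for j
      unfolding agrees_with_def
    proof (rule exI [of _ "max N c"], intro allI impI)
      fix w :: "'s option \<Rightarrow> nat" assume w: "\<forall>v. max N c \<le> w v"
      define u where "u l = w (Some l)" for l
      let ?u = "u(j := u j + 1)"
      have "c \<le> w None + 1" using w by (meson le_add1 le_trans max.bounded_iff)
      then have "ideal_smult R M (\<mm> \<up> (w None + 1)) (?N u) \<subseteq> ideal_smult R M (J j) (?N u)"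
        by (intro ideal_smult_mono c)
      also have "\<dots> = ?N ?u" using multi_power_smult_add_one [of J u j, OF iJ] by simp
      finally have le: "ideal_smult R M (\<mm> \<up> (w None + 1)) (?N u) \<subseteq> ?N ?u" .
      have "submodule (ideal_smult R M (\<mm> \<up> (w None + 1)) (?N u)) R M"
        using ideal.Icarr [OF loc.power_ideal [of "w None + 1"]]
        by (intro submodule_ideal_smult submodule_subset sN) (rule subsetI)
      then have eq: "ideal_smult R M (\<mm> \<up> (w None + 1)) (?N u) <+>\<^sub>M ?N ?u = ?N ?u"
        using le sN by (intro equalityI set_add_least set_add_upper(2)) auto
      have "dir_hilbert_fun R \<mm> M J j w = quot_length R M (?N u)
          (ideal_smult R M (\<mm> \<up> (w None + 1)) (?N u) <+>\<^sub>M ?N ?u)"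
        unfolding dir_hilbert_fun_def Let_def u_def ..
      also have "\<dots> = enat (h ?u - h u)"
        unfolding eq dfin [symmetric] by (rule quot_length_eq_seg_length [OF sN sN sub])
      finally have H: "dir_hilbert_fun R \<mm> M J j w = enat (h ?u - h u)" .
      have Nw: "N \<le> w v" for v using w by (meson max.bounded_iff)
      have "real (h ?u - h u) = real (h ?u) - real (h u)" using hmono [of u j] by (rule of_nat_diff)
      also have "\<dots> = mpol_eval P (\<lambda>l. real (?u l)) - mpol_eval P (\<lambda>l. real (u l))"
        using Nw by (subst (1 2) P) (auto simp: u_def le_SucI)
      also have "(\<lambda>l. real (?u l)) = (\<lambda>l. real (w (Some l)))(j := real (w (Some j)) + 1)"
        by (auto simp: u_def)
      also have "mpol_eval P \<dots> - mpol_eval P (\<lambda>l. real (u l)) = mpol_eval (difference_mpol j P) (\<lambda>v. real (w v))"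
        unfolding mpol_eval_difference_mpol u_def ..
      finally show "\<exists>n. dir_hilbert_fun R \<mm> M J j w = enat n \<and> real n = mpol_eval (difference_mpol j P) (\<lambda>v. real (w v))"
        using H by blast
    qed
  qed
qed

end

theorem theorem3p3:
  fixes R :: "('a, 'r) ring_scheme"
    and \<mm> :: "'a set"
    and M :: "('a, 'b, 'm) module_scheme"
    and J :: "'s::finite \<Rightarrow> 'a set"
    and d :: "'s \<Rightarrow> nat"
    and D :: nat
    and j :: 's
  assumes "noetherian_local_ring R \<mm>"
    and "module R M"
    and "fin_gen_module R M"
    and "carrier M \<noteq> {\<zero>\<^bsub>M\<^esub>}"
    and "module_dim R M = enat D"
    and "D \<ge> 1"
    and "\<And>l. primary_to R \<mm> (J l)"
    and "d j > 0"
  shows "(1 \<le> multi_deg d \<and> multi_deg d < D \<longrightarrow> dir_mixed_mult R \<mm> M J j d = 0) \<and>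
    (multi_deg d = D \<longrightarrow> dir_mixed_mult R \<mm> M J j d = mixed_mult R M J d) \<and>
    (\<forall>l. multi_deg d = D \<and> d l > 0 \<longrightarrow>
      dir_mixed_mult R \<mm> M J j d = dir_mixed_mult R \<mm> M J l d)"
proof -
  obtain P where samuel: "agrees_with (samuel_fun R M J) P"
    and deg: "\<And>a. a \<in> Poly_Mapping.keys P \<Longrightarrow> multi_deg a \<le> D"
    and dir: "\<And>l. agrees_with (dir_hilbert_fun R \<mm> M J l) (difference_mpol l P)"
    using module.samuel_polynomial [of R M \<mm> D J, OF assms(2,1,3,5,6,7)] by blast
  have mixed: "mixed_mult R M J d = (\<Prod>l\<in>UNIV. fact (d l)) * Poly_Mapping.lookup P d"
    unfolding mixed_mult_def hilbert_poly_eq [OF samuel] ..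
  have dir_mixed: "dir_mixed_mult R \<mm> M J l d = fact (D - multi_deg d) * fact (d l - 1) *
      (\<Prod>i\<in>UNIV - {l}. fact (d i)) * Poly_Mapping.lookup (difference_mpol l P)
        (case_option (D - multi_deg d) (d(l := d l - 1)))" for l
    unfolding dir_mixed_mult_def hilbert_poly_eq [OF dir] by (simp add: assms(5))
  have top: "dir_mixed_mult R \<mm> M J l d = mixed_mult R M J d" if "multi_deg d = D" "d l > 0" for l
  proof -
    have "(\<Prod>i\<in>UNIV. fact (d i)) = fact (d l) * (\<Prod>i\<in>UNIV - {l}. fact (d i) :: real)"
      by (rule prod.remove) auto
    moreover have "fact (d l) = real (d l) * fact (d l - 1)" using that(2) by (rule fact_reduce)
    ultimately show ?thesis
      unfolding dir_mixed mixed using lookup_difference_mpol_top [of P d l] deg that by simp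
  qed
  have "dir_mixed_mult R \<mm> M J j d = 0" if "multi_deg d < D"
    unfolding dir_mixed lookup_difference_mpol using that by simp
  then show ?thesis using top assms(8) by metis
qed

end
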